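(* Let $-A$ be the generator of a bounded $C_0$-semigroup $(e^{-tA})_{t\ge0}$ on a Banach space $X$ such that $\overline{\operatorname{ran}}(A)=X$, and let $\varphi\in\Phi$, $\varphi(z)\not\equiv z$. For $t>0$, $n\in\mathbb N$ put $$\Delta^\varphi_{t,n}(A):=e^{-nt\varphi(A/n)}-e^{-tA},\qquad E^\varphi_{t,n}(A):=e^{-n\varphi(tA/n)}-e^{-tA}.$$ (i) If $\{|s|:s\in\mathbb R,\ is\in\sigma(A)\}=[0,\infty)$, then there exist $c>0$ and $T>0$ such that for every $\alpha\in(0,2]$, all $t\ge T$ and all $n\in\mathbb N$, $$\|A^{-\alpha}\Delta^\varphi_{t,n}(A)\|\ge c\left(\frac tn\right)^{\alpha/2},\qquad \|A^{-\alpha}E^\varphi_{t,n}(A)\|\ge c\left(\frac{t^2}n\right)^{\alpha/2}.$$ (ii) If $[0,\infty)\subset\sigma(A)$, then there exist $T>0$ and $c>0$ such that for every $\alpha\in[0,2]$, all $t\ge T$ and all $n\in\mathbb N$, $$\|A^{-\alpha}\Delta^\varphi_{t,n}(A)\|\ge c\,n^{-1}t^{\alpha-1},\qquad \|A^{-\alpha}E^\varphi_{t,n}(A)\|\ge c\,n^{-1}t^{\alpha}.$$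
   Context: A function $f\in C^\infty(0,\infty)$ is completely monotone if $f\ge0$ and $(-1)^nf^{(n)}\ge0$ on $(0,\infty)$ for all $n\in\mathbb N$. A nonnegative $\varphi\in C^\infty(0,\infty)$ is a Bernstein function if $\varphi'$ is completely monotone; it extends analytically to $\mathbb C_+=\{\operatorname{Re}z>0\}$ and continuously to $\overline{\mathbb C_+}$, and is identified with this extension. $\Phi$ is the set of Bernstein functions $\varphi$ with $\varphi(0)=0$, $\varphi'(0+)=1$, $|\varphi''(0+)|<\infty$. Subordination: for a Bernstein function $\varphi$ and $t\ge0$ there is a unique positive Radon measure $\nu_t$ on $[0,\infty)$ of total mass at most $1$ with $\int_0^\infty e^{-zs}\nu_t(ds)=e^{-t\varphi(z)}$ for $z\in\mathbb C_+$. For any generator $-B$ of a bounded $C_0$-semigroup, $e^{-t\varphi(B)}:=\int_0^\infty e^{-sB}\,\nu_t(ds)$ (strong integral); this is used with $B=A/n$ and $B=tA/n$. Banach spaces are complex; $\sigma(A)$ is the spectrum and $\overline{\operatorname{ran}}(A)$ the norm closure of the range of $A$. Since $A$ has dense range it is injective, and $A^{-\alpha}=(A^\alpha)^{-1}$ is the inverse of the usual fractional power ($A^0=I$). For $\alpha\in[0,2]$ the operators $A^{-\alpha}\Delta^\varphi_{t,n}(A)$ and $A^{-\alpha}E^\varphi_{t,n}(A)$ are everywhere defined and bounded. *)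

theory Defs
  imports "HOL-Analysis.Analysis"
begin

section \<open>Complex Banach spaces\<close>

class complex_banach = banach +
  fixes scaleC :: "complex \<Rightarrow> 'a \<Rightarrow> 'a" (infixr "*\<^sub>C" 75)
  assumes scaleC_add_right: "c *\<^sub>C (x + y) = c *\<^sub>C x + c *\<^sub>C y"
    and scaleC_add_left: "(c + d) *\<^sub>C x = c *\<^sub>C x + d *\<^sub>C x"
    and scaleC_scaleC: "c *\<^sub>C d *\<^sub>C x = (c * d) *\<^sub>C x"
    and scaleC_one: "1 *\<^sub>C x = x"
    and scaleC_of_real: "complex_of_real r *\<^sub>C x = r *\<^sub>R x"
    and norm_scaleC: "norm (c *\<^sub>C x) = cmod c * norm x"

instantiation complex :: complex_banach
begin

definition "scaleC c x = c * x" for c x :: complex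

instance
  by standard (simp_all add: scaleC_complex_def algebra_simps scaleR_conv_of_real norm_mult)

end


section \<open>Unbounded operators\<close>

text \<open>A possibly unbounded operator is identified with its graph, a set of pairs. Thus its domain
  is \<^const>\<open>Domain\<close>, its range \<^const>\<open>Range\<close>, its inverse the converse relation, and
  \<open>R O S\<close> is ``first \<open>R\<close>, then \<open>S\<close>''.\<close>

definition fun_graph :: "('a \<Rightarrow> 'b) \<Rightarrow> ('a \<times> 'b) set" where
  "fun_graph f = {(x, f x) | x. True}"

definition shift_minus :: "complex \<Rightarrow> ('a \<times> 'a) set \<Rightarrow> ('a::complex_banach \<times> 'a) set" where
  "shift_minus z A = {(x, z *\<^sub>C x - y) | x y. (x, y) \<in> A}"

text \<open>A real-linear two-sided inverse of \<open>z - A\<close> is automatically complex-linear when \<open>A\<close> is,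
  so it is enough to ask for a bounded real-linear one.\<close>

definition resolvent_set :: "('a::complex_banach \<times> 'a) set \<Rightarrow> complex set" where
  "resolvent_set A =
     {z. \<exists>R :: 'a \<Rightarrow>\<^sub>L 'a. (shift_minus z A)\<inverse> = fun_graph (blinfun_apply R)}"

definition spectrum :: "('a::complex_banach \<times> 'a) set \<Rightarrow> complex set" where
  "spectrum A = - resolvent_set A"

text \<open>Operator norm, with value \<open>\<infinity>\<close> for operators that are not bounded on their domain.\<close>

definition op_norm :: "('a::real_normed_vector \<times> 'b::real_normed_vector) set \<Rightarrow> ereal" where
  "op_norm G = Sup {ereal (norm y) | x y. (x, y) \<in> G \<and> norm x \<le> 1}"

lemma op_norm_blinfun:
  fixes B :: "'a::real_normed_vector \<Rightarrow>\<^sub>L 'b::real_normed_vector"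
  shows "op_norm (fun_graph (blinfun_apply B)) = ereal (norm B)"
proof -
  let ?S = "{ereal (norm y) | x y. (x, y) \<in> fun_graph (blinfun_apply B) \<and> norm x \<le> 1}"
  have S: "?S = {ereal (norm (B x)) | x. norm x \<le> 1}"
    by (auto simp: fun_graph_def)
  have "Sup ?S = ereal (norm B)"
  proof (rule antisym)
    have "norm (B x) \<le> norm B" if "norm x \<le> 1" for x
      using norm_blinfun[of B x] mult_left_mono[OF that norm_ge_zero[of B]] by simp
    then show "Sup ?S \<le> ereal (norm B)"
      unfolding S by (auto intro!: Sup_least)
  next
    have "ereal (norm B) \<le> u" if u: "\<And>y. y \<in> ?S \<Longrightarrow> y \<le> u" for u
    proof (cases u)
      case (real r)
      have le: "norm (B x) \<le> r" if "norm x \<le> 1" for x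
        using u[unfolded S] that real by force
      have "0 \<le> r" using le[of 0] by simp
      have "norm (B x) \<le> r * norm x" for x
      proof (cases "x = 0")
        case False
        have "norm (B (x /\<^sub>R norm x)) \<le> r" using False by (intro le) simp
        then show ?thesis using False by (simp add: blinfun.scaleR_right field_simps)
      qed simp
      then show ?thesis using real \<open>0 \<le> r\<close> by (simp add: norm_blinfun_bound)
    next
      case MInf
      then show ?thesis using u[of "ereal (norm (B 0))"] unfolding S by (force simp del: blinfun.zero_right)
    qed simp
    then show "ereal (norm B) \<le> Sup ?S"
      by (meson Sup_upper)
  qed
  then show ?thesis by (simp add: op_norm_def)
qed


section \<open>Bounded \<open>C\<^sub>0\<close>-semigroups\<close>

text \<open>Values of \<open>T\<close> at negative times are irrelevant. The operator norm of \<open>T t\<close> as a real-linear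
  map coincides with its norm as a complex-linear map.\<close>

definition bounded_C0_semigroup :: "(real \<Rightarrow> 'a::complex_banach \<Rightarrow>\<^sub>L 'a) \<Rightarrow> bool" where
  "bounded_C0_semigroup T \<longleftrightarrow>
     (\<forall>t\<ge>0. \<forall>c x. T t (c *\<^sub>C x) = c *\<^sub>C T t x) \<and>
     T 0 = id_blinfun \<and>
     (\<forall>s\<ge>0. \<forall>t\<ge>0. T (s + t) = T s o\<^sub>L T t) \<and>
     (\<forall>x. ((\<lambda>t. T t x) \<longlongrightarrow> x) (at_right 0)) \<and>
     (\<exists>M. \<forall>t\<ge>0. norm (T t) \<le> M)"

definition generator :: "(real \<Rightarrow> 'a::complex_banach \<Rightarrow>\<^sub>L 'a) \<Rightarrow> ('a \<times> 'a) set" where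
  "generator T = {(x, y). ((\<lambda>h. (1 / h) *\<^sub>R (T h x - x)) \<longlongrightarrow> y) (at_right 0)}"

definition op_uminus :: "('a \<times> 'a) set \<Rightarrow> ('a::real_vector \<times> 'a) set" where
  "op_uminus A = {(x, - y) | x y. (x, y) \<in> A}"


section \<open>Fractional powers\<close>

text \<open>\<open>yosida A l\<close> is \<open>A (l + A)\<^sup>-\<^sup>1\<close>.\<close>

definition yosida :: "('a \<times> 'a) set \<Rightarrow> real \<Rightarrow> ('a::real_vector \<times> 'a) set" where
  "yosida A l = {(x, l *\<^sub>R x + y) | x y. (x, y) \<in> A}\<inverse> O A"

text \<open>The Balakrishnan formula for \<open>\<alpha> > 0\<close> and \<open>m = \<lfloor>\<alpha>\<rfloor> + 1\<close>,
  \[ A^\alpha x = \frac{\Gamma(m)}{\Gamma(\alpha)\Gamma(m-\alpha)}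
       \int_0^\infty \lambda^{\alpha-1} [A(\lambda+A)^{-1}]^m x \, d\lambda, \qquad x \in D(A^m), \]
  whose integral converges absolutely. For densely defined \<open>A\<close>, the fractional power is the
  closure of this operator. In the integral, \<open>u l\<close> is \<open>[A (l + A)\<^sup>-\<^sup>1]\<^sup>m x\<close>.\<close>

definition balakrishnan :: "('a \<times> 'a) set \<Rightarrow> real \<Rightarrow> ('a::banach \<times> 'a) set" where
  "balakrishnan A \<alpha> =
     (let m = Suc (nat \<lfloor>\<alpha>\<rfloor>) in
      {(x, y). x \<in> Domain (A ^^ m) \<and>
         (\<exists>u. (\<forall>l>0. (x, u l) \<in> yosida A l ^^ m) \<and>
              ((\<lambda>l. (Gamma (real m) / (Gamma \<alpha> * Gamma (real m - \<alpha>)) * l powr (\<alpha> - 1)) *\<^sub>R u l)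
                 has_integral y) {0<..})})"

definition frac_power :: "('a \<times> 'a) set \<Rightarrow> real \<Rightarrow> ('a::banach \<times> 'a) set" where
  "frac_power A \<alpha> = (if \<alpha> = 0 then Id else closure (balakrishnan A \<alpha>))"

definition neg_frac_power :: "('a \<times> 'a) set \<Rightarrow> real \<Rightarrow> ('a::banach \<times> 'a) set" where
  "neg_frac_power A \<alpha> = (frac_power A \<alpha>)\<inverse>"


section \<open>Bernstein functions\<close>

definition smooth_pos :: "(real \<Rightarrow> real) \<Rightarrow> bool" where
  "smooth_pos f \<longleftrightarrow> (\<forall>n. \<forall>x>0. ((deriv ^^ n) f) differentiable (at x))"

definition completely_monotone :: "(real \<Rightarrow> real) \<Rightarrow> bool" where
  "completely_monotone f \<longleftrightarrow>
     smooth_pos f \<and> (\<forall>n. \<forall>x>0. 0 \<le> (-1) ^ n * (deriv ^^ n) f x)"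

definition bernstein :: "(real \<Rightarrow> real) \<Rightarrow> bool" where
  "bernstein f \<longleftrightarrow> smooth_pos f \<and> (\<forall>x>0. 0 \<le> f x) \<and> completely_monotone (deriv f)"

text \<open>\<open>\<phi>\<close> is the extension of the Bernstein function \<open>f\<close> to the closed right half-plane; its values
  elsewhere are irrelevant.\<close>

definition bernstein_extension :: "(real \<Rightarrow> real) \<Rightarrow> (complex \<Rightarrow> complex) \<Rightarrow> bool" where
  "bernstein_extension f \<phi> \<longleftrightarrow>
     bernstein f \<and> (\<forall>x>0. \<phi> (of_real x) = of_real (f x)) \<and>
     \<phi> holomorphic_on {z. 0 < Re z} \<and> continuous_on {z. 0 \<le> Re z} \<phi>"

definition Phi :: "(complex \<Rightarrow> complex) set" where
  "Phi = {\<phi>. \<exists>f. bernstein_extension f \<phi> \<and> \<phi> 0 = 0 \<and>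
     (deriv f \<longlongrightarrow> 1) (at_right 0) \<and> (\<exists>L. (deriv (deriv f) \<longlongrightarrow> L) (at_right 0))}"


section \<open>Subordination\<close>

definition subordination_measure :: "(complex \<Rightarrow> complex) \<Rightarrow> real \<Rightarrow> real measure" where
  "subordination_measure \<phi> t = (THE \<nu>.
     sets \<nu> = sets borel \<and> emeasure \<nu> {..<0} = 0 \<and> emeasure \<nu> UNIV \<le> 1 \<and>
     (\<forall>z. 0 < Re z \<longrightarrow> (LINT s|\<nu>. exp (- z * of_real s)) = exp (- of_real t * \<phi> z)))"

text \<open>The Bochner integral, as in \<^const>\<open>has_bochner_integral\<close> but without its restriction to second
  countable (that is, separable) target spaces.\<close>

definition has_strong_integral :: "'b measure \<Rightarrow> ('b \<Rightarrow> 'a::real_normed_vector) \<Rightarrow> 'a \<Rightarrow> bool" where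
  "has_strong_integral M f y \<longleftrightarrow>
     f \<in> borel_measurable M \<and>
     (\<exists>s. (\<forall>i. Bochner_Integration.simple_bochner_integrable M (s i)) \<and>
          (\<lambda>i. \<integral>\<^sup>+x. norm (f x - s i x) \<partial>M) \<longlonglongrightarrow> 0 \<and>
          (\<lambda>i. Bochner_Integration.simple_bochner_integral M (s i)) \<longlonglongrightarrow> y)"

text \<open>\<open>exp_bernstein \<phi> t S\<close> is \<open>e\<^bsup>-t\<phi>(B)\<^esup>\<close>, where \<open>-B\<close> generates the semigroup \<open>S s = e\<^bsup>-sB\<^esup>\<close>.\<close>

definition exp_bernstein ::
    "(complex \<Rightarrow> complex) \<Rightarrow> real \<Rightarrow> (real \<Rightarrow> 'a::complex_banach \<Rightarrow>\<^sub>L 'a) \<Rightarrow> 'a \<Rightarrow> 'a" where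
  "exp_bernstein \<phi> t S x =
     (THE y. has_strong_integral (subordination_measure \<phi> t) (\<lambda>s. indicator {0..} s *\<^sub>R S s x) y)"

text \<open>If \<open>-A\<close> generates \<open>T\<close>, then \<open>-rA\<close> generates \<open>\<lambda>s. T (r * s)\<close> for \<open>r > 0\<close>.\<close>

definition Delta_op ::
    "(complex \<Rightarrow> complex) \<Rightarrow> real \<Rightarrow> nat \<Rightarrow> (real \<Rightarrow> 'a::complex_banach \<Rightarrow>\<^sub>L 'a) \<Rightarrow> 'a \<Rightarrow> 'a" where
  "Delta_op \<phi> t n T x = exp_bernstein \<phi> (real n * t) (\<lambda>s. T (1 / real n * s)) x - T t x"

definition E_op ::
    "(complex \<Rightarrow> complex) \<Rightarrow> real \<Rightarrow> nat \<Rightarrow> (real \<Rightarrow> 'a::complex_banach \<Rightarrow>\<^sub>L 'a) \<Rightarrow> 'a \<Rightarrow> 'a" where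
  "E_op \<phi> t n T x = exp_bernstein \<phi> (real n) (\<lambda>s. T (t / real n * s)) x - T t x"

end

theory Submission
  imports Defs "HOL-Complex_Analysis.Complex_Analysis" "HOL-Probability.Probability"
begin

text \<open>Only lower bounds for \<open>\<parallel>g(A)\<parallel>\<close> by \<open>\<bar>g(\<lambda>)\<bar>\<close>, \<open>\<lambda> \<in> \<sigma>(A)\<close>, are needed, and these follow from a
  factorization \<open>g(\<lambda>) - g(A) = (\<lambda> - A) H\<close> with a bounded \<open>H\<close> commuting with the semigroup: if
  \<open>\<bar>g(\<lambda>)\<bar> > \<parallel>g(A)\<parallel>\<close>, the left-hand side is invertible, hence so is \<open>\<lambda> - A\<close>. With \<open>\<mu> = \<bar>\<lambda>\<bar>\<close> and
  \<open>V = (\<mu> (\<mu> + A)\<^sup>-\<^sup>1)\<^sup>m\<close>, \<open>m = \<lfloor>\<alpha>\<rfloor> + 1\<close>, scaling in the Balakrishnan formula gives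
  \<open>\<parallel>A\<^sup>\<alpha> V w\<parallel> \<le> C \<mu>\<^sup>\<alpha> \<parallel>w\<parallel>\<close> with \<open>C\<close> independent of \<open>\<alpha>\<close>. Testing \<open>A\<^sup>-\<^sup>\<alpha> \<Delta>\<close> on \<open>x = A\<^sup>\<alpha> V w\<close> therefore
  bounds its norm below by \<open>\<mu>\<^sup>-\<^sup>\<alpha> \<parallel>\<Delta> V\<parallel> / C\<close>, and \<open>\<parallel>\<Delta> V\<parallel> \<ge> \<bar>\<Delta>(\<lambda>)\<bar> (\<mu> / \<bar>\<mu> + \<lambda>\<bar>)\<^sup>m \<ge> \<bar>\<Delta>(\<lambda>)\<bar> / 8\<close>.
  It remains to choose \<open>\<lambda>\<close>: \<open>\<lambda> = \<plusminus>\<i>\<kappa> \<surd>(n/t)\<close> and \<open>\<lambda> = \<plusminus>\<i>\<kappa> \<surd>n/t\<close> in (i), where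
  \<open>Re \<phi>(\<i>y) \<ge> c y\<^sup>2\<close> near \<open>0\<close>, and \<open>\<lambda> = 1/t\<close> in (ii), where \<open>\<phi>(x) \<le> x - c x\<^sup>2\<close> on \<open>(0, 1]\<close>.\<close>

section \<open>Improper vector-valued integrals\<close>

text \<open>The operator \<open>H\<close> has to be explicit each time: for \<open>T s\<close> it is
  a Duhamel integral, and sums, products and averages inherit it. On the closed right half-plane the
  Duhamel integral grows linearly in \<open>s\<close>, so averaging it over a subordination measure
  requires a finite first moment. This comes from f x \<le> x, a consequence of \<phi>'(0+) = 1 and
  the concavity of f. The second obstacle is that \<open>subordination_measure\<close> is a definite
  description: nothing is known about it before existence and uniqueness are proved. Existence is
  Bernstein's theorem for exp(-\<tau> \<phi>); uniqueness follows from Levy's theorem on the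
  imaginary axis. The bound for Re \<phi> on the imaginary axis is read off the measure too.
  |exp(-\<phi>(iy))|^2 is the characteristic function of the difference of two independent copies,
  and for small y it falls below 1 by at least a multiple of y^2 unless the measure is a point mass.
  Uniformity in \<alpha>, even as \<alpha> tends to 0, holds because the Gamma factors in the
  Balakrishnan formula cancel the poles of the integral.\<close>

lemma tendsto_dominated_increments:
  fixes F :: "'i \<Rightarrow> 'a::banach" and G :: "'i \<Rightarrow> real"
  assumes "\<And>u v. u \<in> S \<Longrightarrow> v \<in> S \<Longrightarrow> norm (F u - F v) \<le> \<bar>G u - G v\<bar>"
    and "eventually (\<lambda>u. u \<in> S) Flt" "(G \<longlongrightarrow> l) Flt" "Flt \<noteq> bot"
  shows "\<exists>L. (F \<longlongrightarrow> L) Flt"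
proof -
  have "cauchy_filter (filtermap F Flt)"
    unfolding cauchy_filter_metric_filtermap
  proof (intro allI impI)
    fix e :: real assume "e > 0"
    then have "eventually (\<lambda>u. dist (G u) l < e/2) Flt"
      using assms(3) half_gt_zero unfolding tendsto_iff by blast
    then have "eventually (\<lambda>u. u \<in> S \<and> dist (G u) l < e/2) Flt"
      using assms(2) by eventually_elim auto
    moreover have "dist (F u) (F v) < e"
      if "u \<in> S \<and> dist (G u) l < e/2" "v \<in> S \<and> dist (G v) l < e/2" for u v
    proof -
      have "dist (F u) (F v) \<le> dist (G u) (G v)"
        using assms(1)[of u v] that by (simp add: dist_norm)
      also have "\<dots> < e" using that dist_triangle_half_l[of "G u" l e "G v"] by blast
      finally show ?thesis .
    qed
    ultimately show "\<exists>P. eventually P Flt \<and> (\<forall>x y. P x \<and> P y \<longrightarrow> dist (F x) (F y) < e)"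
      by blast
  qed
  moreover have "filtermap F Flt \<noteq> bot" using assms(4) by (simp add: filtermap_bot_iff)
  ultimately have "convergent_filter (filtermap F Flt)"
    using complete_UNIV[where 'a='a] cauchy_filter_complete_converges[of "filtermap F Flt" UNIV]
    by (auto simp: convergent_filter_iff)
  then show ?thesis by (auto simp: convergent_filter_iff filterlim_def)
qed

text \<open>By \<open>has_integral_alt'\<close> the integral is a limit over intervals that contain
  large balls. Extending \<open>F\<close> by its right limit and \<open>f\<close> by zero makes the
  fundamental theorem applicable on every interval around 0, with value
  \<open>F0 b - L0\<close>.\<close>

lemma has_integral_halfline_antiderivative:
  fixes f :: "real \<Rightarrow> 'a::banach"
  assumes deriv: "\<And>x. x > 0 \<Longrightarrow> (F has_vector_derivative f x) (at x)"
    and lim0: "(F \<longlongrightarrow> L0) (at_right 0)" and lim1: "(F \<longlongrightarrow> L1) at_top"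
  shows "(f has_integral (L1 - L0)) {0<..}"
proof -
  define F0 where "F0 x = (if x = 0 then L0 else F x)" for x
  define f0 where "f0 x = (if x \<in> {0<..} then f x else 0)" for x
  have F0_deriv: "(F0 has_vector_derivative f x) (at x)" if "x > 0" for x
    by (rule has_vector_derivative_transform_within[OF deriv[OF that] that])
       (auto simp: F0_def dist_real_def)
  have cont: "continuous_on {0..b} F0" for b
  proof (rule continuous_on_eq_continuous_within[THEN iffD2], safe)
    fix x assume x: "x \<in> {0..b}"
    show "continuous (at x within {0..b}) F0"
    proof (cases "x = 0")
      case True
      have "(F0 \<longlongrightarrow> L0) (at_right 0)"
        by (rule Lim_transform_eventually[OF lim0])
           (auto simp: F0_def eventually_at_right_less eventually_at intro: exI[of _ 1])
      then show ?thesis using True x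
        by (cases "b = 0")
          (auto simp: continuous_within F0_def at_within_Icc_at_right at_within_def[of 0 "{0}"])
    next
      case False
      then show ?thesis using x F0_deriv[of x]
        by (auto intro: has_vector_derivative_continuous continuous_at_imp_continuous_at_within)
    qed
  qed
  have pos: "(f0 has_integral (F0 b - L0)) {0..b}" if "b \<ge> 0" for b
  proof (rule has_integral_spike_finite[where S="{0}"])
    have "(f has_integral (F0 b - F0 0)) {0..b}"
      by (rule fundamental_theorem_of_calculus_interior) (use that F0_deriv cont in auto)
    then show "(f has_integral (F0 b - L0)) {0..b}" by (simp add: F0_def)
  qed (auto simp: f0_def)
  have neg: "(f0 has_integral 0) {a..0}" for a
    by (rule has_integral_spike_finite[where S="{0}" and f="\<lambda>x. 0"]) (auto simp: f0_def)
  have both: "(f0 has_integral (F0 b - L0)) {a..b}" if "a \<le> 0" "0 \<le> b" for a b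
    using has_integral_combine[OF that neg pos] that by simp
  have "f0 integrable_on {a..b}" for a b
    by (rule integrable_subinterval_real[OF has_integral_integrable[OF
          both[of "-(\<bar>a\<bar>+\<bar>b\<bar>)" "\<bar>a\<bar>+\<bar>b\<bar>"]]]) auto
  moreover have "\<exists>B>0. \<forall>a b. ball 0 B \<subseteq> {a..b} \<longrightarrow> norm (integral {a..b} f0 - (L1 - L0)) < e"
    if "e > 0" for e
  proof -
    have "eventually (\<lambda>u. dist (F u) L1 < e) at_top"
      using lim1 that by (auto simp: tendsto_iff)
    then obtain N where N: "\<And>u. u \<ge> N \<Longrightarrow> dist (F u) L1 < e"
      by (auto simp: eventually_at_top_linorder)
    define B where "B = max N 1"
    have "norm (integral {a..b} f0 - (L1 - L0)) < e" if "ball 0 B \<subseteq> {a..b}" for a b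
    proof -
      \<comment> \<open>A ball of radius \<open>B\<close> inside \<open>{a..b}\<close> forces
        \<open>a \<le> 0\<close> and, since the ball is open, \<open>B \<le> b\<close> only by
        density.\<close>
      have "- r \<in> {a..b} \<and> r \<in> {a..b}" if "r \<ge> 0" "r < B" for r
        using \<open>ball 0 B \<subseteq> {a..b}\<close> that by (auto simp: subset_iff dist_real_def)
      then have "r \<le> b" if "r \<ge> 0" "r < B" for r using that by auto
      then have "b \<ge> B" by (intro dense_le_bounded[of 0 B]) (auto simp: B_def)
      moreover have "a \<le> 0" using \<open>ball 0 B \<subseteq> {a..b}\<close> by (auto simp: subset_iff B_def)
      ultimately have "integral {a..b} f0 = F0 b - L0" "b > 0" "dist (F b) L1 < e"
        using both[of a b] N[of b] by (auto simp: B_def)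
      then show ?thesis by (simp add: F0_def dist_norm)
    qed
    then show ?thesis by (intro exI[of _ B]) (auto simp: B_def)
  qed
  ultimately show ?thesis
    unfolding has_integral_alt'[of f] f0_def[abs_def, symmetric] by simp
qed

text \<open>Increments of an antiderivative \<open>F\<close> of \<open>f\<close> are dominated by
  those of an antiderivative \<open>G\<close> of \<open>g\<close>, and \<open>G\<close> has limits
  at 0 and at infinity; by completeness so does \<open>F\<close>. The base point of \<open>F\<close>
  is 1 because \<open>f\<close> may be singular at 0, while \<open>G\<close> can start at 0.\<close>

lemma integrable_dominated_halfline:
  fixes f :: "real \<Rightarrow> 'a::banach"
  assumes cont: "continuous_on {0<..} f" and le: "\<And>x. x > 0 \<Longrightarrow> norm (f x) \<le> g x"
    and g: "(g has_integral I) {0<..}"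
  obtains y where "(f has_integral y) {0<..}" "norm y \<le> I"
proof -
  define F where "F u = (if 1 \<le> u then integral {1..u} f else - integral {u..1} f)" for u
  define G where "G u = integral {0..u} g" for u
  have f_int: "f integrable_on {u..v}" if "u > 0" for u v
    using that by (intro integrable_continuous_real continuous_on_subset[OF cont]) auto
  have g_int0: "g integrable_on {0..v}" for v
  proof -
    have "(\<lambda>x. if x \<in> {0<..} then g x else 0) integrable_on {0..v}"
      using g unfolding has_integral_alt' box_real by blast
    then show ?thesis by (rule integrable_spike_finite[where S="{0}", rotated 2]) auto
  qed
  have g_int: "g integrable_on {u..v}" if "u \<ge> 0" for u v
    using integrable_subinterval_real[OF g_int0[of v], of u v] that by auto
  have F_diff: "F v - F u = integral {u..v} f" if "0 < u" "u \<le> v" for u v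
    using Henstock_Kurzweil_Integration.integral_combine[of 1 u v f] Henstock_Kurzweil_Integration.integral_combine[of u 1 v f] Henstock_Kurzweil_Integration.integral_combine[of u v 1 f]
      that f_int by (auto simp: F_def algebra_simps) 
  have G_diff: "G v - G u = integral {u..v} g" if "0 \<le> u" "u \<le> v" for u v
    using Henstock_Kurzweil_Integration.integral_combine[of 0 u v g] that g_int by (auto simp: G_def algebra_simps)
  have FG: "norm (F v - F u) \<le> G v - G u" if "0 < u" "u \<le> v" for u v
    using that le by (auto simp: F_diff G_diff intro!: integral_norm_bound_integral f_int g_int)
  have FG': "norm (F u - F v) \<le> \<bar>G u - G v\<bar>" if "u \<in> {0<..}" "v \<in> {0<..}" for u v
    using FG[of u v] FG[of v u] that by (cases "u \<le> v") (auto simp: norm_minus_commute)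
  have "continuous_on {0..1} G" unfolding G_def
    by (rule indefinite_integral_continuous_1[OF g_int]) simp
  then have "(G \<longlongrightarrow> G 0) (at 0 within {0..1})"
    by (simp add: continuous_on_def)
  then have "(G \<longlongrightarrow> G 0) (at_right 0)"
    by (subst (asm) at_within_Icc_at_right) auto
  then obtain L0 where L0: "(F \<longlongrightarrow> L0) (at_right 0)"
    using tendsto_dominated_increments[of "{0<..}" F G "at_right 0" "G 0"] FG'
    by (auto simp: eventually_at_right_less)
  have "(G \<longlongrightarrow> I) at_top"
    unfolding tendsto_iff eventually_at_top_linorder
  proof (intro allI impI)
    fix e :: real assume "e > 0"
    then obtain B where B: "B > 0" "\<And>a b. ball 0 B \<subseteq> {a..b} \<Longrightarrow>
        norm (integral {a..b} (\<lambda>x. if x \<in> {0<..} then g x else 0) - I) < e"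
      using g unfolding has_integral_alt' box_real by blast
    have "dist (G u) I < e" if "u \<ge> B" for u
    proof -
      have "(g has_integral G u) {0..u}" unfolding G_def using g_int0 by blast
      then have "((\<lambda>x. if x \<in> {0<..} then g x else 0) has_integral G u) {0..u}"
        by (rule has_integral_spike_finite[where S="{0}", rotated 2]) auto
      moreover have "((\<lambda>x. if x \<in> {0<..} then g x else 0) has_integral 0) {-u..0}"
        by (rule has_integral_is_0) auto
      ultimately have "integral {-u..u} (\<lambda>x. if x \<in> {0<..} then g x else 0) = G u"
        using has_integral_combine[of "-u" 0 u _ 0 "G u"] that B(1) by auto
      moreover have "ball 0 B \<subseteq> {-u..u}" using that by (auto simp: dist_real_def)
      ultimately show ?thesis using B(2)[of "-u" u] by (simp add: dist_norm)
    qed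
    then show "\<exists>N. \<forall>n\<ge>N. dist (G n) I < e" by blast
  qed
  then obtain L1 where L1: "(F \<longlongrightarrow> L1) at_top"
    using tendsto_dominated_increments[of "{0<..}" F G at_top I] FG'
    by (auto simp: eventually_gt_at_top)
  have "(F has_vector_derivative f x) (at x)" if "x > 0" for x
  proof -
    have "((\<lambda>u. integral {x/2..u} f) has_vector_derivative f x) (at x within {x/2..x+1})"
      using that by (intro integral_has_vector_derivative continuous_on_subset[OF cont]) auto
    then have "((\<lambda>u. integral {x/2..u} f + F (x/2)) has_vector_derivative f x) (at x within {x/2..x+1})"
      by (auto intro!: derivative_eq_intros)
    then have "(F has_vector_derivative f x) (at x within {x/2..x+1})"
      by (rule has_vector_derivative_transform[rotated 2])
         (use that in \<open>auto simp: F_diff[symmetric]\<close>)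
    then show ?thesis
      using that by (subst (asm) at_within_Icc_at) auto
  qed
  then have *: "(f has_integral (L1 - L0)) {0<..}"
    by (rule has_integral_halfline_antiderivative[OF _ L0 L1])
  have "norm (integral {0<..} f) \<le> integral {0<..} g"
    using * g le by (intro integral_norm_bound_integral) (auto simp: integrable_on_def)
  then show ?thesis using that * integral_unique[OF *] integral_unique[OF g] by metis
qed

section \<open>Bounded semigroups\<close>

lemma scaleC_scaleR: "c *\<^sub>C (r *\<^sub>R x) = r *\<^sub>R (c *\<^sub>C x)"
  by (simp add: scaleC_of_real[symmetric] scaleC_scaleC mult.commute)

lemma bounded_bilinear_scaleC: "bounded_bilinear (scaleC :: complex \<Rightarrow> 'a::complex_banach \<Rightarrow> 'a)"
  by unfold_locales
    (auto simp: scaleC_add_left scaleC_add_right scaleC_scaleR norm_scaleC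
      scaleR_conv_of_real scaleC_scaleC[symmetric] scaleC_of_real intro!: exI[of _ 1])

interpretation scaleC: bounded_bilinear "scaleC :: complex \<Rightarrow> 'a::complex_banach \<Rightarrow> 'a"
  by (rule bounded_bilinear_scaleC)

lemmas scaleC_diff_left = scaleC.diff_left and scaleC_diff_right = scaleC.diff_right
  and scaleC_minus_left = scaleC.minus_left and scaleC_minus_right = scaleC.minus_right
  and scaleC_zero_left = scaleC.zero_left and scaleC_zero_right = scaleC.zero_right

lemmas scaleC_simps = scaleC_add_left scaleC_add_right scaleC_diff_left scaleC_diff_right
  scaleC_minus_left scaleC_minus_right scaleC_zero_left scaleC_zero_right scaleC_scaleC scaleC_one

lift_definition blinfun_scaleC :: "complex \<Rightarrow> 'a::complex_banach \<Rightarrow>\<^sub>L 'a" is "\<lambda>c x. c *\<^sub>C x"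
  by (rule scaleC.bounded_linear_right)

declare blinfun_scaleC.rep_eq [simp]

primrec blinfun_power :: "('a::real_normed_vector \<Rightarrow>\<^sub>L 'a) \<Rightarrow> nat \<Rightarrow> 'a \<Rightarrow>\<^sub>L 'a" where
  "blinfun_power K 0 = id_blinfun"
| "blinfun_power K (Suc m) = K o\<^sub>L blinfun_power K m"

lemma norm_blinfun_power: "norm (blinfun_power K m x) \<le> norm K ^ m * norm x"
proof (induction m)
  case (Suc m)
  have "norm (K (blinfun_power K m x)) \<le> norm K * norm (blinfun_power K m x)"
    by (rule norm_blinfun)
  also have "\<dots> \<le> norm K * (norm K ^ m * norm x)"
    by (intro mult_left_mono Suc) auto
  finally show ?case by (simp add: mult_ac)
qed simp

text \<open>Converts a one-sided vector derivative into the quotient in which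
  \<open>generator\<close> is phrased.\<close>

lemma tendsto_difference_quotient_right:
  fixes f :: "real \<Rightarrow> 'a::real_normed_vector"
  assumes "(f has_vector_derivative D) (at_right 0)"
  shows "((\<lambda>h. (1 / h) *\<^sub>R (f h - f 0)) \<longlongrightarrow> D) (at_right 0)"
proof -
  have "((\<lambda>h. (1 / norm (h - 0)) *\<^sub>R (f h - (f 0 + (h - 0) *\<^sub>R D))) \<longlongrightarrow> 0) (at_right 0)"
    using assms unfolding has_vector_derivative_def has_derivative_within by blast
  then have "((\<lambda>h. (1 / h) *\<^sub>R (f h - f 0) - D) \<longlongrightarrow> 0) (at_right 0)"
    by (rule Lim_transform_eventually)
       (auto simp: eventually_at_filter scaleR_diff_right scaleR_add_right)
  then show ?thesis by (simp add: LIM_zero_iff)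
qed

text \<open>The normalization \<open>1 \<le> M\<close> lets \<open>M\<close> stand in denominators
  and makes \<open>ln (2 * M)\<close> nonnegative.\<close>

locale bdd_semigroup =
  fixes T :: "real \<Rightarrow> 'a::complex_banach \<Rightarrow>\<^sub>L 'a" and A :: "('a \<times> 'a) set" and M :: real
  assumes sg: "bounded_C0_semigroup T" and gen: "generator T = op_uminus A"
    and M_ge_1: "1 \<le> M" and norm_T: "0 \<le> t \<Longrightarrow> norm (T t) \<le> M"
begin

lemma T_scaleC: "0 \<le> t \<Longrightarrow> T t (c *\<^sub>C x) = c *\<^sub>C T t x"
  and T_0: "T 0 x = x"
  and T_add: "0 \<le> s \<Longrightarrow> 0 \<le> t \<Longrightarrow> T (s + t) x = T s (T t x)"
  and T_tendsto: "((\<lambda>t. T t x) \<longlongrightarrow> x) (at_right 0)"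
  using sg by (auto simp: bounded_C0_semigroup_def)

lemma norm_T_apply: "0 \<le> t \<Longrightarrow> norm (T t x) \<le> M * norm x"
  by (meson mult_right_mono norm_T norm_blinfun norm_ge_zero order_trans)

text \<open>By the semigroup law \<open>T (min s t)\<close> factors out of the difference, so right
  continuity at 0 yields continuity from both sides at every point.\<close>

lemma T_diff_le: "0 \<le> s \<Longrightarrow> 0 \<le> t \<Longrightarrow> norm (T s x - T t x) \<le> M * norm (T \<bar>s - t\<bar> x - x)"
proof (induction s t rule: linorder_wlog)
  case (le s t)
  have "T t x = T s (T \<bar>s - t\<bar> x)" using T_add[of s "t - s" x] le by simp
  then have "norm (T s x - T t x) = norm (T s (T \<bar>s - t\<bar> x - x))"
    by (simp add: blinfun.diff_right norm_minus_commute)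
  also have "\<dots> \<le> M * norm (T \<bar>s - t\<bar> x - x)"
    by (rule norm_T_apply) (use le in auto)
  finally show ?case .
next
  case (sym s t) then show ?case by (simp add: norm_minus_commute abs_minus_commute)
qed

lemma continuous_on_T: "continuous_on {0..} (\<lambda>t. T t x)"
  unfolding continuous_on_iff
proof safe
  fix t e :: real assume "0 \<le> t" "0 < e"
  have "eventually (\<lambda>h. dist (T h x) x < e / M) (at_right 0)"
    using T_tendsto[of x] \<open>0 < e\<close> M_ge_1 unfolding tendsto_iff by simp
  then obtain d where d: "d > 0" "\<And>h. 0 < h \<Longrightarrow> h < d \<Longrightarrow> dist (T h x) x < e / M"
    unfolding eventually_at_right_field by auto
  have "dist (T s x) (T t x) < e" if "0 \<le> s" "dist s t < d" for s
  proof -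
    have "norm (T \<bar>s - t\<bar> x - x) < e / M"
      using d(2)[of "\<bar>s - t\<bar>"] that \<open>0 < e\<close> M_ge_1
      by (cases "s = t") (auto simp: dist_norm T_0)
    then have "M * norm (T \<bar>s - t\<bar> x - x) < e" using M_ge_1 by (simp add: field_simps)
    then show ?thesis using T_diff_le[of s t x] that \<open>0 \<le> t\<close> by (simp add: dist_norm)
  qed
  then show "\<exists>d>0. \<forall>s\<in>{0..}. dist s t < d \<longrightarrow> dist (T s x) (T t x) < e"
    using d(1) by auto
qed

lemma A_iff: "(x, y) \<in> A \<longleftrightarrow> ((\<lambda>h. (1 / h) *\<^sub>R (T h x - x)) \<longlongrightarrow> - y) (at_right 0)"
proof -
  have "(x, y) \<in> A \<longleftrightarrow> (x, - y) \<in> op_uminus A" by (auto simp: op_uminus_def)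
  then show ?thesis unfolding gen[symmetric] generator_def by simp
qed

lemma A_unique: "(x, y) \<in> A \<Longrightarrow> (x, z) \<in> A \<Longrightarrow> y = z"
  unfolding A_iff using tendsto_unique[of "at_right (0::real)"] by (metis neg_equal_iff_equal trivial_limit_at_right_real)

lemma A_add: "(x, y) \<in> A \<Longrightarrow> (x', y') \<in> A \<Longrightarrow> (x + x', y + y') \<in> A"
  unfolding A_iff by (drule (1) tendsto_add) (simp add: blinfun.add_right algebra_simps)

text \<open>The commutant of the semigroup. Complex linearity is part of it because the type
  \<open>\<Rightarrow>\<^sub>L\<close> only provides real linearity.\<close>

definition comm :: "('a \<Rightarrow>\<^sub>L 'a) \<Rightarrow> bool" where
  "comm B \<longleftrightarrow> (\<forall>c x. B (c *\<^sub>C x) = c *\<^sub>C B x) \<and> (\<forall>s\<ge>0. \<forall>x. B (T s x) = T s (B x))"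

text \<open>The bicommutant. It contains the semigroup and is closed under algebraic operations,
  inversion and averaging, so all operators built below commute with each other and with
  \<open>A\<close>.\<close>

definition bicomm :: "('a \<Rightarrow>\<^sub>L 'a) \<Rightarrow> bool" where
  "bicomm K \<longleftrightarrow> comm K \<and> (\<forall>B. comm B \<longrightarrow> (\<forall>x. B (K x) = K (B x)))"

lemma A_comm: "comm B \<Longrightarrow> (x, y) \<in> A \<Longrightarrow> (B x, B y) \<in> A"
proof -
  assume B: "comm B" and "(x, y) \<in> A"
  then have "((\<lambda>h. (1 / h) *\<^sub>R (T h x - x)) \<longlongrightarrow> - y) (at_right 0)"
    by (simp add: A_iff)
  then have "((\<lambda>h. B ((1 / h) *\<^sub>R (T h x - x))) \<longlongrightarrow> B (- y)) (at_right 0)"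
    by (intro tendsto_intros)
  then have "((\<lambda>h. (1 / h) *\<^sub>R (T h (B x) - B x)) \<longlongrightarrow> - B y) (at_right 0)"
    unfolding blinfun.minus_right
    by (rule Lim_transform_eventually)
       (use B in \<open>auto simp: eventually_at_filter blinfun.scaleR_right blinfun.diff_right comm_def\<close>)
  then show ?thesis by (simp add: A_iff)
qed

lemma bicomm_comm: "bicomm K \<Longrightarrow> comm K"
  by (simp add: bicomm_def)

lemma bicomm_commute: "bicomm K \<Longrightarrow> comm B \<Longrightarrow> B (K x) = K (B x)"
  by (simp add: bicomm_def)

lemma comm_scaleC: "comm B \<Longrightarrow> B (c *\<^sub>C x) = c *\<^sub>C B x"
  and comm_T: "comm B \<Longrightarrow> 0 \<le> s \<Longrightarrow> B (T s x) = T s (B x)"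
  by (simp_all add: comm_def)

text \<open>Scalars and the operators \<open>T s\<close> lie in the commutant themselves; hence
  whatever commutes with the commutant already belongs to it.\<close>

lemma bicommI:
  fixes K :: "'a \<Rightarrow>\<^sub>L 'a"
  assumes "\<And>(B :: 'a \<Rightarrow>\<^sub>L 'a) x. comm B \<Longrightarrow> B (K x) = K (B x)"
  shows "bicomm K"
proof -
  have "comm (blinfun_scaleC c)" for c
    by (simp add: comm_def T_scaleC scaleC_scaleC mult.commute)
  moreover have "comm (T s)" if "0 \<le> s" for s
    using that by (simp add: comm_def T_scaleC add.commute flip: T_add)
  ultimately have "K (c *\<^sub>C x) = c *\<^sub>C K x" "0 \<le> s \<Longrightarrow> K (T s x) = T s (K x)" for c x s
    using assms[of "blinfun_scaleC c" x] assms[of "T s" x] by simp_all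
  with assms show ?thesis by (simp add: bicomm_def comm_def)
qed

lemma bicomm_scaleC: "bicomm (blinfun_scaleC c)"
  by (rule bicommI) (simp add: comm_scaleC)

lemma bicomm_T: "0 \<le> t \<Longrightarrow> bicomm (T t)"
  by (rule bicommI) (simp add: comm_T)

lemma bicomm_id: "bicomm id_blinfun"
  by (rule bicommI) simp

lemma bicomm_compose: "bicomm K \<Longrightarrow> bicomm L \<Longrightarrow> bicomm (K o\<^sub>L L)"
  by (rule bicommI) (metis bicomm_commute blinfun_apply_blinfun_compose)

lemma bicomm_add: "bicomm K \<Longrightarrow> bicomm L \<Longrightarrow> bicomm (K + L)"
  by (rule bicommI) (simp add: blinfun.add_left blinfun.add_right bicomm_commute[of K] bicomm_commute[of L])

lemma bicomm_diff: "bicomm K \<Longrightarrow> bicomm L \<Longrightarrow> bicomm (K - L)"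
  by (rule bicommI) (simp add: blinfun.diff_left blinfun.diff_right bicomm_commute[of K] bicomm_commute[of L])

lemma bicomm_power: "bicomm K \<Longrightarrow> bicomm (blinfun_power K m)"
  by (induction m) (auto intro: bicomm_id bicomm_compose)

lemma A_scaleC: "(x, y) \<in> A \<Longrightarrow> (c *\<^sub>C x, c *\<^sub>C y) \<in> A"
  using A_comm[OF bicomm_comm[OF bicomm_scaleC], of x y c] by simp

text \<open>\<open>K\<close>, \<open>k\<close> and \<open>H\<close> stand for \<open>g(A)\<close>, \<open>g(l)\<close> and the divided difference
  \<open>(g(l) - g(A)) (l - A)\<^sup>-\<^sup>1\<close>.\<close>

definition div_diff :: "complex \<Rightarrow> ('a \<Rightarrow>\<^sub>L 'a) \<Rightarrow> complex \<Rightarrow> ('a \<Rightarrow>\<^sub>L 'a) \<Rightarrow> bool" where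
  "div_diff l K k H \<longleftrightarrow> bicomm K \<and> bicomm H \<and> (\<forall>x. (H x, l *\<^sub>C H x - (k *\<^sub>C x - K x)) \<in> A)"

lemma div_diffD: "div_diff l K k H \<Longrightarrow> (H x, l *\<^sub>C H x - (k *\<^sub>C x - K x)) \<in> A"
  by (simp add: div_diff_def)

lemma div_diff_scaleC: "div_diff l K k H \<Longrightarrow> div_diff l (blinfun_scaleC c o\<^sub>L K) (c * k) (blinfun_scaleC c o\<^sub>L H)"
proof -
  assume a: "div_diff l K k H"
  have "(c *\<^sub>C H x, l *\<^sub>C c *\<^sub>C H x - ((c * k) *\<^sub>C x - c *\<^sub>C K x)) \<in> A" for x
    using A_scaleC[OF div_diffD[OF a], of c x] by (simp add: scaleC_simps mult.commute)
  with a show ?thesis by (simp add: div_diff_def bicomm_compose bicomm_scaleC)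
qed

lemma div_diff_add: "div_diff l K k H \<Longrightarrow> div_diff l K' k' H' \<Longrightarrow> div_diff l (K + K') (k + k') (H + H')"
proof -
  assume a: "div_diff l K k H" "div_diff l K' k' H'"
  have "(H x + H' x, l *\<^sub>C (H x + H' x) - ((k + k') *\<^sub>C x - (K x + K' x))) \<in> A" for x
    using A_add[OF div_diffD[OF a(1)] div_diffD[OF a(2)], of x x] by (simp add: scaleC_simps algebra_simps)
  with a show ?thesis by (simp add: div_diff_def bicomm_add blinfun.add_left)
qed

lemma div_diff_diff: "div_diff l K k H \<Longrightarrow> div_diff l K' k' H' \<Longrightarrow> div_diff l (K - K') (k - k') (H - H')"
proof -
  assume a: "div_diff l K k H" "div_diff l K' k' H'"
  have "blinfun_scaleC (- 1) o\<^sub>L L = - L" for L :: "'a \<Rightarrow>\<^sub>L 'a"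
    by (rule blinfun_eqI) (simp add: scaleC_simps blinfun.minus_left)
  then show ?thesis using div_diff_add[OF a(1) div_diff_scaleC[OF a(2), of "-1"]] by simp
qed

lemma div_diff_id: "div_diff l id_blinfun 1 0"
proof -
  have "((0::'a), 0) \<in> A" by (simp add: A_iff)
  moreover have "bicomm 0" using bicomm_diff[OF bicomm_id bicomm_id] by simp
  ultimately show ?thesis by (simp add: div_diff_def bicomm_id scaleC_one scaleC_simps)
qed

text \<open>Leibniz rule for divided differences: k k' - K K' = k (k' - K') + (k - K) K'.\<close>

lemma div_diff_compose:
  assumes "div_diff l K k H" "div_diff l K' k' H'"
  shows "div_diff l (K o\<^sub>L K') (k * k') ((blinfun_scaleC k o\<^sub>L H') + (H o\<^sub>L K'))"
proof -
  have "(k *\<^sub>C H' x + H (K' x), l *\<^sub>C (k *\<^sub>C H' x + H (K' x)) - ((k * k') *\<^sub>C x - K (K' x))) \<in> A" for x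
    using A_add[OF A_scaleC[OF div_diffD[OF assms(2)], of k] div_diffD[OF assms(1)], of x "K' x"]
    by (simp add: scaleC_simps algebra_simps)
  then show ?thesis using assms
    by (simp add: div_diff_def bicomm_add bicomm_compose bicomm_scaleC blinfun.add_left)
qed

lemma div_diff_power: "div_diff l K k H \<Longrightarrow> \<exists>H'. div_diff l (blinfun_power K m) (k ^ m) H'"
  by (induction m) (auto intro: div_diff_id div_diff_compose)

text \<open>For |k| > |K| the operator k - K has a bounded inverse \<open>u\<close>, and k - K = (l
  - A) H then shows that H u is the resolvent of \<open>A\<close> at \<open>l\<close>. The norm
  bound matters only for the resolvent estimate on the negative axis.\<close>

lemma div_diff_resolvent:
  assumes "div_diff l K k H" and less: "norm K < cmod k"
  obtains R where "(shift_minus l A)\<inverse> = fun_graph (blinfun_apply R)" "bicomm R"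
    "norm R \<le> norm H / (cmod k - norm K)"
proof -
  have K: "bicomm K" and H: "bicomm H" using assms by (auto simp: div_diff_def)
  have k: "k \<noteq> 0" using less norm_ge_zero[of K] by auto
  have bound: "norm x \<le> norm (k *\<^sub>C x - K x) / (cmod k - norm K)" for x
  proof -
    have "norm (k *\<^sub>C x) \<le> norm (k *\<^sub>C x - K x) + norm (K x)"
      by (metis diff_add_cancel norm_triangle_ineq)
    then have "cmod k * norm x \<le> norm (k *\<^sub>C x - K x) + norm K * norm x"
      using norm_blinfun[of K x] by (simp add: norm_scaleC)
    then show ?thesis using less by (simp add: field_simps)
  qed
  have inj: "x = x'" if "k *\<^sub>C x - K x = k *\<^sub>C x' - K x'" for x x'
    using bound[of "x - x'"] that by (simp add: scaleC_simps blinfun.diff_right algebra_simps)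
  have "\<exists>x. k *\<^sub>C x - K x = y" for y
  proof -
    \<comment> \<open>Solving k x - K x = y is a fixed point problem for a contraction with constant
      |K| / |k|.\<close>
    have "\<exists>!x. (1 / k) *\<^sub>C (y + K x) = x"
    proof (rule banach_fix_type[where c="norm K / cmod k"])
      show "norm K / cmod k < 1" using less k by simp
      show "\<forall>x x'. dist ((1 / k) *\<^sub>C (y + K x)) ((1 / k) *\<^sub>C (y + K x')) \<le> norm K / cmod k * dist x x'"
        using norm_blinfun[of K] k
        by (auto simp: dist_norm norm_scaleC norm_divide divide_simps simp flip: scaleC_diff_right blinfun.diff_right)
    qed simp
    then obtain x where "(1 / k) *\<^sub>C (y + K x) = x" by blast
    then have "k *\<^sub>C x = k *\<^sub>C (1 / k) *\<^sub>C (y + K x)" by simp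
    then show ?thesis using k by (intro exI[of _ x]) (simp add: scaleC_scaleC scaleC_one)
  qed
  then obtain u where u: "\<And>y. k *\<^sub>C u y - K (u y) = y" by metis
  have u_eq: "u (k *\<^sub>C x - K x) = x" for x using inj u by blast
  have "bounded_linear u"
  proof (rule bounded_linear_intro)
    show "u (x + y) = u x + u y" for x y
      by (rule inj) (use u[of x] u[of y] u[of "x + y"] in \<open>simp add: scaleC_simps blinfun.add_right algebra_simps\<close>)
    show "u (r *\<^sub>R x) = r *\<^sub>R u x" for r x
      by (rule inj) (use u[of x] u[of "r *\<^sub>R x"] in \<open>simp add: scaleC_scaleR blinfun.scaleR_right flip: scaleR_diff_right\<close>)
    show "norm (u x) \<le> norm x * (1 / (cmod k - norm K))" for x
      using bound[of "u x"] u[of x] by simp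
  qed
  then have U: "blinfun_apply (Blinfun u) = u" by (rule bounded_linear_Blinfun_apply)
  have u_comm: "B (u x) = u (B x)" if "comm B" for B x
  proof (rule inj)
    have "k *\<^sub>C B (u x) - K (B (u x)) = B (k *\<^sub>C u x - K (u x))"
      using that by (simp add: blinfun.diff_right comm_scaleC bicomm_commute[OF K])
    then show "k *\<^sub>C B (u x) - K (B (u x)) = k *\<^sub>C u (B x) - K (u (B x))" using u by simp
  qed
  have "bicomm (Blinfun u)"
    using u_comm by (intro bicommI) (simp add: U)
  then have R: "bicomm (H o\<^sub>L Blinfun u)" by (intro bicomm_compose H)
  have "norm (H o\<^sub>L Blinfun u) \<le> norm H * norm (Blinfun u)" by (rule norm_blinfun_compose)
  also have "norm (Blinfun u) \<le> 1 / (cmod k - norm K)"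
    using bound[of "u _"] u less by (intro norm_blinfun_bound) (auto simp: U)
  finally have n: "norm (H o\<^sub>L Blinfun u) \<le> norm H / (cmod k - norm K)"
    by (simp add: mult_left_mono)
  \<comment> \<open>\<open>H u\<close> is a right inverse of \<open>l - A\<close>.\<close>
  have 1: "(H (u z), l *\<^sub>C H (u z) - z) \<in> A" for z
    using div_diffD[OF assms(1), of "u z"] u[of z] by simp
  \<comment> \<open>It is also a left inverse: \<open>H\<close> commutes with \<open>A\<close>, so H
    (l x - A x) equals (l - A) H x = k x - K x, which \<open>u\<close> maps back to
    \<open>x\<close>.\<close>
  have 2: "H (u (l *\<^sub>C x - y)) = x" if "(x, y) \<in> A" for x y
  proof -
    have "(H x, H y) \<in> A" using A_comm[OF bicomm_comm[OF H] that] .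
    then have "H y = l *\<^sub>C H x - (k *\<^sub>C x - K x)" using div_diffD[OF assms(1), of x] A_unique by blast
    then have "H (l *\<^sub>C x - y) = k *\<^sub>C x - K x"
      by (simp add: blinfun.diff_right comm_scaleC[OF bicomm_comm[OF H]])
    then show ?thesis using u_eq u_comm[OF bicomm_comm[OF H]] by metis
  qed
  have "(shift_minus l A)\<inverse> = fun_graph (blinfun_apply (H o\<^sub>L Blinfun u))"
  proof (intro set_eqI iffI)
    fix p assume "p \<in> (shift_minus l A)\<inverse>"
    then obtain x y where "p = (l *\<^sub>C x - y, x)" "(x, y) \<in> A"
      by (auto simp: shift_minus_def)
    then show "p \<in> fun_graph (blinfun_apply (H o\<^sub>L Blinfun u))"
      using 2[of x y] by (simp add: fun_graph_def U)
  next
    fix p assume "p \<in> fun_graph (blinfun_apply (H o\<^sub>L Blinfun u))"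
    then obtain z where p: "p = (z, H (u z))" by (auto simp: fun_graph_def U)
    have "(H (u z), l *\<^sub>C H (u z) - (l *\<^sub>C H (u z) - z)) \<in> shift_minus l A"
      using 1[of z] unfolding shift_minus_def by blast
    then show "p \<in> (shift_minus l A)\<inverse>" by (simp add: p)
  qed
  then show ?thesis using that R n by blast
qed

section \<open>Duhamel integrals as divided differences of the semigroup\<close>

lemma continuous_on_scaleC_T:
  "continuous_on S f \<Longrightarrow> S \<subseteq> {0..} \<Longrightarrow> continuous_on S (\<lambda>r. f r *\<^sub>C T r x)"
  by (intro scaleC.continuous_on continuous_on_subset[OF continuous_on_T]) auto

text \<open>Variation of constants. Up to sign it is the divided difference of z -> exp(-s z) at
  \<open>l\<close>: (exp(-l s) - exp(-s z)) / (l - z) is minus the integral of exp(-l (s - r))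
  exp(-r z) over r in [0, s].\<close>

definition duhamel :: "complex \<Rightarrow> real \<Rightarrow> 'a \<Rightarrow> 'a" where
  "duhamel l s x = integral {0..s} (\<lambda>r. exp (- l * of_real (s - r)) *\<^sub>C T r x)"

lemma duhamel_integrable:
  "(\<lambda>r. exp (- l * of_real (s - r)) *\<^sub>C T r x) integrable_on {0..s}"
  by (intro integrable_continuous_real continuous_on_scaleC_T continuous_intros) auto

lemma norm_duhamel_integrand:
  assumes "r \<in> {0..s}"
  shows "norm (exp (- l * of_real (s - r)) *\<^sub>C T r x) \<le> exp (- Re l * (s - r)) * M * norm x"
  using norm_T_apply[of r x] assms by (simp add: norm_scaleC mult.assoc)

lemma norm_duhamel_le:
  assumes "0 \<le> s" and b: "\<And>r. r \<in> {0..s} \<Longrightarrow> exp (- Re l * (s - r)) \<le> b"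
  shows "norm (duhamel l s x) \<le> b * M * s * norm x"
proof -
  have "norm (exp (- l * of_real (s - r)) *\<^sub>C T r x) \<le> b * M * norm x" if "r \<in> {0..s}" for r
    using M_ge_1 by (intro order_trans[OF norm_duhamel_integrand[OF that]] mult_right_mono b that) auto
  then have "norm (duhamel l s x) \<le> integral {0..s} (\<lambda>r. b * M * norm x)"
    unfolding duhamel_def
    by (intro Henstock_Kurzweil_Integration.integral_norm_bound_integral duhamel_integrable) auto
  then show ?thesis using assms(1) by (simp add: mult_ac)
qed

text \<open>The exponential weight is at most 1 here. The resulting linear growth in
  \<open>s\<close> is what subordination measures are later asked to integrate.\<close>

lemma norm_duhamel:
  assumes "0 \<le> s" "0 \<le> Re l"
  shows "norm (duhamel l s x) \<le> M * s * norm x"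
  using norm_duhamel_le[OF assms(1), of l 1 x] assms(2) by (simp add: mult_nonneg_nonneg)

text \<open>Integrating the exponential exactly produces the factor \<open>1 / \<mu>\<close> of the
  resolvent bound.\<close>

lemma norm_duhamel_neg:
  assumes "0 \<le> s" "0 < \<mu>"
  shows "norm (duhamel (- of_real \<mu>) s x) \<le> exp (\<mu> * s) * M / \<mu> * norm x"
proof -
  have "((\<lambda>r. - (exp (\<mu> * (s - r)) / \<mu>) * (M * norm x)) has_vector_derivative exp (\<mu> * (s - r)) * M * norm x) (at r within S)"
    for r S
    using assms unfolding has_real_derivative_iff_has_vector_derivative[symmetric]
    by (auto intro!: derivative_eq_intros simp: field_simps)
  then have *: "((\<lambda>r. exp (\<mu> * (s - r)) * M * norm x) has_integral
      - (exp (\<mu> * (s - s)) / \<mu>) * (M * norm x) - (- (exp (\<mu> * (s - 0)) / \<mu>) * (M * norm x))) {0..s}"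
    by (intro fundamental_theorem_of_calculus assms)
  have "norm (duhamel (- of_real \<mu>) s x) \<le> integral {0..s} (\<lambda>r. exp (\<mu> * (s - r)) * M * norm x)"
    unfolding duhamel_def
    by (intro Henstock_Kurzweil_Integration.integral_norm_bound_integral duhamel_integrable
        has_integral_integrable[OF *])
      (use norm_duhamel_integrand[of _ s "- of_real \<mu>"] in auto)
  also note integral_unique[OF *]
  also have "- (exp (\<mu> * (s - s)) / \<mu>) * (M * norm x) - (- (exp (\<mu> * (s - 0)) / \<mu>) * (M * norm x))
      \<le> (exp (\<mu> * s) / \<mu>) * (M * norm x)"
    using assms M_ge_1 by simp
  finally show ?thesis by (simp add: mult_ac)
qed

lemma bounded_linear_duhamel: "0 \<le> s \<Longrightarrow> bounded_linear (duhamel l s)"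
proof (rule bounded_linear_intro)
  assume s: "0 \<le> s"
  show "duhamel l s (x + y) = duhamel l s x + duhamel l s y" for x y
    unfolding duhamel_def blinfun.add_right scaleC_add_right
    by (intro Henstock_Kurzweil_Integration.integral_add duhamel_integrable)
  show "duhamel l s (c *\<^sub>R x) = c *\<^sub>R duhamel l s x" for c x
    unfolding duhamel_def blinfun.scaleR_right scaleC_scaleR by (rule integral_cmul)
  have "- Re l * (s - r) \<le> \<bar>Re l\<bar> * s" if "r \<in> {0..s}" for r
    using that by (intro mult_mono) auto
  then show "norm (duhamel l s x) \<le> norm x * (exp (\<bar>Re l\<bar> * s) * M * s)" for x
    using norm_duhamel_le[OF s, of l "exp (\<bar>Re l\<bar> * s)" x] by (simp add: mult_ac)
qed

lemma duhamel_comm: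
  assumes "comm B"
  shows "B (duhamel l s x) = duhamel l s (B x)"
proof -
  have "B (duhamel l s x) = integral {0..s} (\<lambda>r. B (exp (- l * of_real (s - r)) *\<^sub>C T r x))"
    unfolding duhamel_def
    using integral_linear[OF duhamel_integrable blinfun.bounded_linear_right[of B]] by (simp add: o_def)
  also have "\<dots> = duhamel l s (B x)"
    unfolding duhamel_def using assms
    by (intro Henstock_Kurzweil_Integration.integral_cong) (auto simp: comm_scaleC comm_T)
  finally show ?thesis .
qed

lemma duhamel_eq:
  "duhamel l s x = exp (- l * of_real s) *\<^sub>C integral {0..s} (\<lambda>r. exp (l * of_real r) *\<^sub>C T r x)"
proof -
  let ?U = "\<lambda>r. exp (l * of_real r) *\<^sub>C T r x"
  have "?U integrable_on {0..s}"
    by (intro integrable_continuous_real continuous_on_scaleC_T continuous_intros) auto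
  then have "exp (- l * of_real s) *\<^sub>C integral {0..s} ?U = integral {0..s} (\<lambda>r. exp (- l * of_real s) *\<^sub>C ?U r)"
    using integral_linear[OF _ scaleC.bounded_linear_right, of ?U] by (auto simp: o_def)
  also have "\<dots> = duhamel l s x"
    unfolding duhamel_def
    by (intro Henstock_Kurzweil_Integration.integral_cong)
      (simp add: scaleC_scaleC algebra_simps flip: exp_add)
  finally show ?thesis by simp
qed

text \<open>Once exp(-l s) is taken out of the integral, the remaining integral \<open>J s\<close>
  is moved by \<open>T h\<close> through a mere shift of its window; differentiating at h = 0
  identifies \<open>A (J s)\<close>.\<close>

lemma duhamel_A:
  assumes s: "0 \<le> s"
  shows "(- duhamel l s x, l *\<^sub>C (- duhamel l s x) - (exp (- l * of_real s) *\<^sub>C x - T s x)) \<in> A"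
proof -
  define U where "U r = exp (l * of_real r) *\<^sub>C T r x" for r
  define J where "J u = integral {0..u} U" for u
  have U_cont: "continuous_on {0..} U"
    unfolding U_def by (intro continuous_on_scaleC_T continuous_intros) auto
  have J_deriv: "(J has_vector_derivative U u) (at u within {0..b})" if "u \<in> {0..b}" for u b
    unfolding J_def using that
    by (intro integral_has_vector_derivative continuous_on_subset[OF U_cont]) auto
  have duhamel_J: "duhamel l s x = exp (- l * of_real s) *\<^sub>C J s"
    unfolding J_def U_def by (rule duhamel_eq)
  \<comment> \<open>\<open>T h\<close> moves the window from [0, s] to [h, s + h], at the price of
    the scalar exp(-l h).\<close>
  have TJ: "T h (J s) = exp (- l * of_real h) *\<^sub>C (J (s + h) - J h)" if h: "0 \<le> h" for h
  proof -
    have "((\<lambda>r. J (r + h)) has_vector_derivative U (r + h)) (at r within {0..s})" if "r \<in> {0..s}" for r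
    proof -
      have "(J \<circ> (\<lambda>r. r + h) has_vector_derivative 1 *\<^sub>R U (r + h)) (at r within {0..s})"
        by (rule vector_diff_chain_within[OF _ has_vector_derivative_within_subset[OF J_deriv[of _ "s + h"]]])
           (use that h in \<open>auto intro!: derivative_eq_intros\<close>)
      then show ?thesis by (simp add: o_def)
    qed
    then have *: "((\<lambda>r. U (r + h)) has_integral J (s + h) - J (0 + h)) {0..s}"
      by (intro fundamental_theorem_of_calculus s)
    have U_int: "(U has_integral J s) {0..s}" unfolding J_def
      by (intro integrable_integral integrable_continuous_real continuous_on_subset[OF U_cont]) auto
    have "((\<lambda>r. exp (l * of_real h) *\<^sub>C T h (U r)) has_integral exp (l * of_real h) *\<^sub>C T h (J s)) {0..s}"
      using has_integral_linear[OF has_integral_linear[OF U_int blinfun.bounded_linear_right[of "T h"]]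
          scaleC.bounded_linear_right[of "exp (l * of_real h)"]] by (simp only: o_def)
    then have "((\<lambda>r. U (r + h)) has_integral exp (l * of_real h) *\<^sub>C T h (J s)) {0..s}"
      by (rule has_integral_eq[rotated])
         (use h in \<open>auto simp: U_def T_scaleC scaleC_scaleC algebra_simps simp flip: T_add exp_add\<close>)
    from has_integral_unique[OF this *]
    have "exp (l * of_real h) *\<^sub>C T h (J s) = J (s + h) - J h" by simp
    then have "exp (- l * of_real h) *\<^sub>C exp (l * of_real h) *\<^sub>C T h (J s) = exp (- l * of_real h) *\<^sub>C (J (s + h) - J h)"
      by simp
    then show ?thesis by (simp add: scaleC_scaleC scaleC_one flip: exp_add)
  qed
  have J_0: "J 0 = 0" by (simp add: J_def)
  \<comment> \<open>\<open>Q h\<close> equals \<open>T h (J s)\<close>; its right derivative at 0 is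
    computed by the product rule.\<close>
  define Q where "Q h = exp (- l * of_real h) *\<^sub>C (J (s + h) - J h)" for h
  have "(J \<circ> (\<lambda>h. s + h) has_vector_derivative 1 *\<^sub>R U (s + 0)) (at 0 within {0..1})"
    by (rule vector_diff_chain_within[OF _ has_vector_derivative_within_subset[OF J_deriv[of _ "s + 1"]]])
       (use s in \<open>auto intro!: derivative_eq_intros\<close>)
  then have 1: "((\<lambda>h. J (s + h)) has_vector_derivative U s) (at 0 within {0..1})"
    by (simp add: o_def)
  have 2: "(J has_vector_derivative U 0) (at 0 within {0..1})"
    by (rule J_deriv) simp
  have 3: "((\<lambda>h. exp (- l * of_real h)) has_vector_derivative - l) (at 0 within {0..1})"
    by (rule has_vector_derivative_real_field[where f="\<lambda>z. exp (- l * z)"]) 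
       (auto intro!: derivative_eq_intros)
  have "(Q has_vector_derivative exp (- l * of_real 0) *\<^sub>C (U s - U 0) + (- l) *\<^sub>C (J (s + 0) - J 0)) (at 0 within {0..1})"
    unfolding Q_def
    by (rule scaleC.has_vector_derivative[OF 3 has_vector_derivative_diff[OF 1 2]])
  then have "(Q has_vector_derivative (U s - x) - l *\<^sub>C J s) (at_right 0)"
    by (subst (asm) at_within_Icc_at_right) (auto simp: scaleC_simps U_def T_0 J_def)
  from tendsto_difference_quotient_right[OF this]
  have "((\<lambda>h. (1 / h) *\<^sub>R (T h (J s) - J s)) \<longlongrightarrow> (U s - x) - l *\<^sub>C J s) (at_right 0)"
    by (rule Lim_transform_eventually)
       (auto simp: eventually_at_filter TJ Q_def scaleC_one J_0)
  then have "(J s, l *\<^sub>C J s - (U s - x)) \<in> A"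
    by (simp add: A_iff algebra_simps)
  from A_scaleC[OF this, of "- exp (- l * of_real s)"]
  show ?thesis
    by (simp add: duhamel_J U_def scaleC_simps algebra_simps flip: exp_add)
qed

section \<open>The resolvent on the negative axis\<close>

lemma div_diff_T:
  assumes "0 \<le> s"
  shows "div_diff l (T s) (exp (- l * of_real s)) (- Blinfun (duhamel l s))"
proof -
  note ap = bounded_linear_Blinfun_apply[OF bounded_linear_duhamel[OF assms]]
  have "bicomm (- Blinfun (duhamel l s))"
    by (rule bicommI) (simp add: blinfun.minus_left blinfun.minus_right ap duhamel_comm)
  then show ?thesis
    using duhamel_A[OF assms] by (simp add: div_diff_def bicomm_T assms blinfun.minus_left ap)
qed

text \<open>No Laplace integral is used: the factorization of one operator \<open>T s\<close> at
  \<open>l = - \<mu>\<close> suffices. The time \<open>s\<close> is chosen so that exp(\<mu> s) = 2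
  M, which exceeds |T s| by at least \<open>M\<close>; the bound is then (2 M M / \<mu>) / M. The
  final sign change turns the inverse of - \<mu> - A into that of \<mu> + A.\<close>

lemma resolvent_exists:
  assumes "0 < \<mu>"
  obtains R :: "'a \<Rightarrow>\<^sub>L 'a" where "\<And>x. (R x, x - \<mu> *\<^sub>R R x) \<in> A" "\<And>x y. (x, y) \<in> A \<Longrightarrow> R (\<mu> *\<^sub>R x + y) = x"
    "bicomm R" "norm R \<le> 2 * M / \<mu>"
proof -
  define s where "s = ln (2 * M) / \<mu>"
  have s: "0 \<le> s" using M_ge_1 assms by (simp add: s_def)
  have e: "exp (\<mu> * s) = 2 * M" using M_ge_1 assms by (simp add: s_def)
  let ?H = "- Blinfun (duhamel (- of_real \<mu>) s)"
  have H: "norm ?H \<le> 2 * M * M / \<mu>"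
    using norm_duhamel_neg[OF s assms] assms M_ge_1
    by (intro norm_blinfun_bound)
      (auto simp: blinfun.minus_left bounded_linear_Blinfun_apply[OF bounded_linear_duhamel[OF s]] e)
  have k: "cmod (exp (- (- of_real \<mu>) * of_real s)) = 2 * M"
    using e by (simp add: norm_exp_eq_Re)
  have K: "norm (T s) \<le> M" by (rule norm_T[OF s])
  obtain R where R: "(shift_minus (- of_real \<mu>) A)\<inverse> = fun_graph (blinfun_apply R)" "bicomm R"
    "norm R \<le> norm ?H / (cmod (exp (- (- of_real \<mu>) * of_real s)) - norm (T s))"
    using div_diff_resolvent[OF div_diff_T[OF s, of "- of_real \<mu>"]] K k M_ge_1 by auto
  have "norm R \<le> (2 * M * M / \<mu>) / M"
    using R(3) unfolding k
    by (rule order_trans) (intro frac_le H, use K M_ge_1 assms in auto)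
  then have n: "norm (- R) \<le> 2 * M / \<mu>" using M_ge_1 by simp
  have b: "bicomm (- R)"
    by (intro bicommI) (simp add: blinfun.minus_left blinfun.minus_right bicomm_commute[OF R(2)])
  have of_real: "(- of_real \<mu>) *\<^sub>C x = - (\<mu> *\<^sub>R x)" for x :: 'a
    by (simp add: scaleC_minus_left scaleC_of_real)
  have 1: "((- R) x, x - \<mu> *\<^sub>R (- R) x) \<in> A" for x
  proof -
    have "(x, R x) \<in> (shift_minus (- of_real \<mu>) A)\<inverse>" unfolding R(1) by (simp add: fun_graph_def)
    then obtain y where y: "(R x, y) \<in> A" "x = - (\<mu> *\<^sub>R R x) - y"
      by (auto simp: shift_minus_def of_real)
    have "(- R x, - y) \<in> A" using A_scaleC[OF y(1), of "-1"] by (simp add: scaleC_simps)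
    moreover have "- v = z + u" if "z = - u - v" for u v z :: 'a using that by simp
    from this[OF y(2)] have "- y = x - \<mu> *\<^sub>R (- R x)" by simp
    ultimately show ?thesis by (simp add: blinfun.minus_left)
  qed
  have 2: "(- R) (\<mu> *\<^sub>R x + y) = x" if "(x, y) \<in> A" for x y
  proof -
    have "(- (\<mu> *\<^sub>R x) - y, x) \<in> (shift_minus (- of_real \<mu>) A)\<inverse>"
      using that by (force simp: shift_minus_def of_real)
    then have "R (- (\<mu> *\<^sub>R x) - y) = x" unfolding R(1) by (auto simp: fun_graph_def)
    then show ?thesis by (simp add: blinfun.minus_left flip: blinfun.minus_right)
  qed
  show ?thesis using that[OF 1 2 b n] by blast
qed

text \<open>The inverse of \<mu> + A, that is, the resolvent at \<mu> of the generator -A.\<close>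

definition Res :: "real \<Rightarrow> 'a \<Rightarrow>\<^sub>L 'a" where
  "Res \<mu> = (SOME R :: 'a \<Rightarrow>\<^sub>L 'a. bicomm R \<and> norm R \<le> 2 * M / \<mu> \<and>
     (\<forall>x. (R x, x - \<mu> *\<^sub>R R x) \<in> A) \<and> (\<forall>x y. (x, y) \<in> A \<longrightarrow> R (\<mu> *\<^sub>R x + y) = x))"

lemma
  assumes "0 < \<mu>"
  shows Res_A: "(Res \<mu> x, x - \<mu> *\<^sub>R Res \<mu> x) \<in> A"
    and Res_eq: "(x, y) \<in> A \<Longrightarrow> Res \<mu> (\<mu> *\<^sub>R x + y) = x"
    and bicomm_Res: "bicomm (Res \<mu>)"
    and norm_Res: "norm (Res \<mu>) \<le> 2 * M / \<mu>"
proof -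
  have "\<exists>R :: 'a \<Rightarrow>\<^sub>L 'a. bicomm R \<and> norm R \<le> 2 * M / \<mu> \<and>
     (\<forall>x. (R x, x - \<mu> *\<^sub>R R x) \<in> A) \<and> (\<forall>x y. (x, y) \<in> A \<longrightarrow> R (\<mu> *\<^sub>R x + y) = x)"
    using resolvent_exists[OF assms] by metis
  from someI_ex[OF this] show "(Res \<mu> x, x - \<mu> *\<^sub>R Res \<mu> x) \<in> A"
    "(x, y) \<in> A \<Longrightarrow> Res \<mu> (\<mu> *\<^sub>R x + y) = x" "bicomm (Res \<mu>)" "norm (Res \<mu>) \<le> 2 * M / \<mu>"
    unfolding Res_def by blast+
qed

lemma Res_diff:
  assumes "0 < \<mu>" "0 < \<nu>"
  shows "Res \<mu> x - Res \<nu> x = (\<nu> - \<mu>) *\<^sub>R Res \<mu> (Res \<nu> x)"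
proof -
  have "Res \<nu> x = Res \<mu> (\<mu> *\<^sub>R Res \<nu> x + (x - \<nu> *\<^sub>R Res \<nu> x))"
    using Res_eq[OF assms(1) Res_A[OF assms(2)]] by simp
  also have "\<dots> = Res \<mu> x - (\<nu> - \<mu>) *\<^sub>R Res \<mu> (Res \<nu> x)"
    by (simp add: blinfun.add_right blinfun.diff_right blinfun.scaleR_right algebra_simps)
  finally show ?thesis by (metis add_diff_cancel_left' diff_add_cancel)
qed

text \<open>From 1/(\<mu> + l) - 1/(\<mu> + z) = - (l - z) / ((\<mu> + l) (\<mu> + z)), the divided
  difference is again a multiple of the resolvent.\<close>

lemma div_diff_Res:
  assumes "0 < \<mu>" "of_real \<mu> + l \<noteq> 0"
  obtains H where "div_diff l (Res \<mu>) (1 / (of_real \<mu> + l)) H"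
proof -
  let ?k = "1 / (of_real \<mu> + l)"
  have *: "?k *\<^sub>C (x - of_real \<mu> *\<^sub>C y) = l *\<^sub>C ?k *\<^sub>C y + ?k *\<^sub>C x - y" for x y :: 'a
  proof -
    have "?k * of_real \<mu> + l * ?k = 1"
      using assms(2) by (simp add: add.commute flip: add_divide_distrib)
    then have "?k *\<^sub>C of_real \<mu> *\<^sub>C y + l *\<^sub>C ?k *\<^sub>C y = y"
      by (simp only: scaleC_scaleC scaleC_one flip: scaleC_add_left)
    then show ?thesis by (simp add: scaleC_diff_right algebra_simps)
  qed
  have "((- ?k) *\<^sub>C Res \<mu> x, l *\<^sub>C (- ?k) *\<^sub>C Res \<mu> x - (?k *\<^sub>C x - Res \<mu> x)) \<in> A" for x
  proof -
    have "- a - (b - c) = - (a + b - c)" for a b c :: 'a by simp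
    then have "l *\<^sub>C (- ?k) *\<^sub>C Res \<mu> x - (?k *\<^sub>C x - Res \<mu> x) = (- ?k) *\<^sub>C (x - \<mu> *\<^sub>R Res \<mu> x)"
      using *[of x "Res \<mu> x"] by (simp only: scaleC_minus_left scaleC_minus_right scaleC_of_real)
    then show ?thesis using A_scaleC[OF Res_A[OF assms(1)], of "- ?k" x] by simp
  qed
  then have "div_diff l (Res \<mu>) ?k (blinfun_scaleC (- ?k) o\<^sub>L Res \<mu>)"
    by (simp add: div_diff_def bicomm_compose bicomm_scaleC bicomm_Res assms)
  then show ?thesis by (rule that)
qed

end

section \<open>Fractional powers\<close>

lemma blinfun_power_commute:
  fixes B K :: "'a::real_normed_vector \<Rightarrow>\<^sub>L 'a"
  assumes "\<And>x. B (K x) = K (B x)"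
  shows "B (blinfun_power K m x) = blinfun_power K m (B x)"
  by (induction m) (simp_all add: assms)

lemma blinfun_power_compose:
  fixes K L :: "'a::real_normed_vector \<Rightarrow>\<^sub>L 'a"
  assumes "\<And>x. K (L x) = L (K x)"
  shows "blinfun_power (K o\<^sub>L L) m x = blinfun_power K m (blinfun_power L m x)"
  by (induction m) (simp_all add: blinfun_power_commute[of L K] assms)

lemma blinfun_power_scaleR: "blinfun_power (c *\<^sub>R K) m x = c ^ m *\<^sub>R blinfun_power K m x"
  by (induction m) (simp_all add: blinfun.scaleR_left blinfun.scaleR_right)

lemma continuous_on_blinfun_power:
  fixes f :: "real \<Rightarrow> 'a::real_normed_vector \<Rightarrow>\<^sub>L 'a"
  shows "continuous_on S f \<Longrightarrow> continuous_on S (\<lambda>l. blinfun_power (f l) m)"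
  by (induction m) (auto intro!: continuous_intros bounded_bilinear.continuous_on[OF bounded_bilinear_blinfun_compose])

lemma fun_graph_relpow: "fun_graph (blinfun_apply K) ^^ m = fun_graph (blinfun_apply (blinfun_power K m))"
  by (induction m) (auto simp: fun_graph_def)

text \<open>By compactness; \<open>\<alpha> + 1\<close> and \<open>m - \<alpha> + 1\<close> both lie
  in [1, 3] when \<alpha> is in [0, 2] and \<open>m\<close> is the integer above \<alpha>.\<close>

lemma Gamma_ge_on_1_3: "\<exists>\<gamma>>0. \<forall>x\<in>{1..3}. \<gamma> \<le> Gamma (x::real)"
proof -
  have "continuous_on {1..3::real} Gamma"
    by (intro continuous_on_Gamma continuous_on_id) (auto elim!: nonpos_Ints_cases)
  then obtain z :: real where "z \<in> {1..3}" "\<forall>x\<in>{1..3}. Gamma z \<le> Gamma x"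
    using continuous_attains_inf[of "{1..3::real}" Gamma] by auto
  then show ?thesis by (intro exI[of _ "Gamma z"]) (auto intro: Gamma_real_pos)
qed

text \<open>The majorant of the Balakrishnan integrand on smoothed vectors. It converges at 0
  because \<alpha> > 0 and at infinity because \<alpha> < m; the power of \<mu> is the scaling l =
  \<mu> l'.\<close>

lemma has_integral_powr_min:
  fixes \<alpha> m \<mu> :: real
  assumes "0 < \<alpha>" "\<alpha> < m" "0 < \<mu>"
  shows "((\<lambda>l. l powr (\<alpha> - 1) * (if l \<le> \<mu> then 1 else (\<mu> / l) powr m)) has_integral
    \<mu> powr \<alpha> * (1 / \<alpha> + 1 / (m - \<alpha>))) {0<..}"
proof -
  let ?g = "\<lambda>l. l powr (\<alpha> - 1) * (if l \<le> \<mu> then 1 else (\<mu> / l) powr m)"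
  have "((\<lambda>l. l powr (\<alpha> - 1)) has_integral \<mu> powr (\<alpha> - 1 + 1) / (\<alpha> - 1 + 1)) {0..\<mu>}"
    by (rule has_integral_powr_from_0) (use assms in auto)
  then have 1: "(?g has_integral \<mu> powr \<alpha> / \<alpha>) {0..\<mu>}"
    by (subst has_integral_cong[where g="\<lambda>l. l powr (\<alpha> - 1)"]) auto
  have "((\<lambda>l. l powr (\<alpha> - 1 - m)) has_integral - (\<mu> powr (\<alpha> - 1 - m + 1)) / (\<alpha> - 1 - m + 1)) {\<mu>..}"
    by (rule has_integral_powr_to_inf) (use assms in auto)
  then have "((\<lambda>l. \<mu> powr m * l powr (\<alpha> - 1 - m)) has_integral
      \<mu> powr m * (- (\<mu> powr (\<alpha> - 1 - m + 1)) / (\<alpha> - 1 - m + 1))) {\<mu>..}"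
    by (rule has_integral_mult_right)
  also have "\<mu> powr m * (- (\<mu> powr (\<alpha> - 1 - m + 1)) / (\<alpha> - 1 - m + 1)) = \<mu> powr \<alpha> / (m - \<alpha>)"
  proof -
    have "\<mu> powr m * \<mu> powr (\<alpha> - m) = \<mu> powr \<alpha>" by (simp flip: powr_add)
    moreover have "- (\<mu> powr (\<alpha> - 1 - m + 1)) / (\<alpha> - 1 - m + 1) = \<mu> powr (\<alpha> - m) / (m - \<alpha>)"
      using assms by (simp add: field_simps)
    ultimately show ?thesis by simp
  qed
  finally have 2: "(?g has_integral \<mu> powr \<alpha> / (m - \<alpha>)) {\<mu>..}"
    by (rule has_integral_eq[rotated])
       (use assms in \<open>auto simp: powr_divide powr_diff mult.commute\<close>)
  have "(?g has_integral \<mu> powr \<alpha> / \<alpha> + \<mu> powr \<alpha> / (m - \<alpha>)) ({0..\<mu>} \<union> {\<mu>..})"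
    by (rule has_integral_Un[OF 1 2], rule negligible_subset[of "{\<mu>}"]) auto
  also have "{0..\<mu>} \<union> {\<mu>..} = {0..}" using assms by auto
  finally have "(?g has_integral \<mu> powr \<alpha> / \<alpha> + \<mu> powr \<alpha> / (m - \<alpha>)) {0<..}"
  proof (rule has_integral_spike_set_eq[THEN iffD1, rotated 2])
    show "negligible {x \<in> {0..} - {0<..}. ?g x \<noteq> 0}" "negligible {x \<in> {0<..} - {0..}. ?g x \<noteq> 0}"
      by (rule negligible_subset[of "{0}"]; force)+
  qed
  then show ?thesis by (simp add: algebra_simps)
qed

context bdd_semigroup
begin

section \<open>The Balakrishnan formula on smoothed vectors\<close>

lemma bicomm_scaleR: "bicomm K \<Longrightarrow> bicomm (r *\<^sub>R K)"
  by (rule bicommI) (simp add: blinfun.scaleR_left blinfun.scaleR_right bicomm_commute[of K])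

definition yosida_op :: "real \<Rightarrow> 'a \<Rightarrow>\<^sub>L 'a" where
  "yosida_op l = id_blinfun - l *\<^sub>R Res l"

lemma yosida_op_apply: "yosida_op l x = x - l *\<^sub>R Res l x"
  by (simp add: yosida_op_def blinfun.diff_left blinfun.scaleR_left)

lemma bicomm_yosida_op: "0 < l \<Longrightarrow> bicomm (yosida_op l)"
  unfolding yosida_op_def by (intro bicomm_diff bicomm_id bicomm_scaleR bicomm_Res)

lemma norm_scaleR_Res: "0 < l \<Longrightarrow> norm (l *\<^sub>R Res l) \<le> 1 + 2 * M"
  using norm_Res[of l] by (simp add: field_simps)

lemma norm_yosida_op: "0 < l \<Longrightarrow> norm (yosida_op l) \<le> 1 + 2 * M"
proof -
  assume l: "0 < l"
  have "norm (yosida_op l) \<le> norm (id_blinfun :: 'a \<Rightarrow>\<^sub>L 'a) + norm (l *\<^sub>R Res l)"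
    unfolding yosida_op_def by (rule norm_triangle_ineq4)
  moreover have "norm (id_blinfun :: 'a \<Rightarrow>\<^sub>L 'a) \<le> 1" by (rule norm_blinfun_id_le)
  ultimately show ?thesis using norm_Res[OF l] l by (simp add: field_simps)
qed

lemma yosida_eq: "0 < l \<Longrightarrow> yosida A l = fun_graph (blinfun_apply (yosida_op l))"
proof (intro set_eqI iffI)
  fix p assume l: "0 < l" and "p \<in> yosida A l"
  then obtain x y z where "(x, y) \<in> A" "(x, z) \<in> A" "p = (l *\<^sub>R x + y, z)"
    by (auto simp: yosida_def)
  moreover from this have "y = z" using A_unique by blast
  ultimately show "p \<in> fun_graph (blinfun_apply (yosida_op l))"
    using Res_eq[OF l, of x y] by (simp add: fun_graph_def yosida_op_apply)
next
  fix p assume l: "0 < l" and "p \<in> fun_graph (blinfun_apply (yosida_op l))"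
  then obtain z where "p = (l *\<^sub>R Res l z + yosida_op l z, yosida_op l z)" "(Res l z, yosida_op l z) \<in> A"
    using Res_A[OF l] by (auto simp: fun_graph_def yosida_op_apply)
  then show "p \<in> yosida A l" unfolding yosida_def by blast
qed

lemma A_relpow_comm: "comm B \<Longrightarrow> (x, y) \<in> A ^^ m \<Longrightarrow> (B x, B y) \<in> A ^^ m"
proof (induction m arbitrary: y)
  case (Suc m)
  then obtain z where z: "(x, z) \<in> A ^^ m" "(z, y) \<in> A" by auto
  then have "(B x, B z) \<in> A ^^ m" "(B z, B y) \<in> A"
    using Suc.IH[OF Suc.prems(1) z(1)] A_comm[OF Suc.prems(1) z(2)] by auto
  then show ?case by auto
qed simp

text \<open>Each factor \<mu> (\<mu> + A)^-1 absorbs one \<open>A\<close>; the image under A^m is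
  the \<open>m\<close>-th power of \<mu> A (\<mu> + A)^-1 applied to the same vector.\<close>

lemma smoothing_in_Domain:
  assumes "0 < \<mu>"
  shows "blinfun_power (\<mu> *\<^sub>R Res \<mu>) m x \<in> Domain (A ^^ m)"
proof -
  have "(blinfun_power (\<mu> *\<^sub>R Res \<mu>) m x, blinfun_power (\<mu> *\<^sub>R yosida_op \<mu>) m x) \<in> A ^^ m" for x
  proof (induction m arbitrary: x)
    case (Suc m)
    let ?R = "\<mu> *\<^sub>R Res \<mu>" and ?B = "\<mu> *\<^sub>R yosida_op \<mu>"
    have R: "bicomm ?R" and B: "bicomm ?B"
      using assms by (auto intro: bicomm_scaleR bicomm_Res bicomm_yosida_op)
    have "(?R z, ?B z) \<in> A" for z
      using A_scaleC[OF Res_A[OF assms, of z], of "of_real \<mu>"]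
      by (simp add: scaleC_of_real blinfun.scaleR_left yosida_op_apply)
    then have "(blinfun_power ?R m (?R x), blinfun_power ?B m (?R x)) \<in> A ^^ m"
      "(?R (blinfun_power ?B m x), ?B (blinfun_power ?B m x)) \<in> A"
      using Suc by auto
    moreover have "blinfun_power ?B m (?R x) = ?R (blinfun_power ?B m x)"
      by (rule bicomm_commute[OF R bicomm_comm[OF bicomm_power[OF B]]])
    moreover have "blinfun_power ?R m (?R x) = ?R (blinfun_power ?R m x)"
      by (rule bicomm_commute[OF R bicomm_comm[OF bicomm_power[OF R]]])
    ultimately show ?case by auto
  qed simp
  then show ?thesis by blast
qed

lemma continuous_on_Res: "continuous_on {0<..} Res"
  unfolding continuous_on_def
proof
  fix k :: real assume "k \<in> {0<..}"
  then have k: "0 < k" by simp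
  have "((\<lambda>l. Res l - Res k) \<longlongrightarrow> 0) (at k within {0<..})"
  proof (rule Lim_null_comparison)
    have "eventually (\<lambda>l. l > k / 2) (at k within {0<..})"
      using k by (intro eventually_at_topological[THEN iffD2] exI[of _ "{k/2<..}"]) auto
    then show "eventually (\<lambda>l. norm (Res l - Res k) \<le> \<bar>l - k\<bar> * ((4 * M / k) * (2 * M / k))) (at k within {0<..})"
    proof eventually_elim
      case (elim l)
      have "norm (Res l) \<le> 2 * M / (k / 2)"
        using norm_Res[of l] elim k M_ge_1 by (intro order_trans[OF norm_Res divide_left_mono]) auto
      then have "norm (Res l (Res k x)) \<le> (4 * M / k) * ((2 * M / k) * norm x)" for x
        using norm_Res[OF k] M_ge_1 k
        by (intro order_trans[OF norm_blinfun] mult_mono order_trans[OF norm_blinfun[of "Res k"]] mult_right_mono) auto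
      then have "norm ((Res l - Res k) x) \<le> \<bar>l - k\<bar> * ((4 * M / k) * ((2 * M / k) * norm x))" for x
        using Res_diff[of l k x] elim k
        by (simp only: blinfun.diff_left norm_scaleR abs_minus_commute[of l k]) (rule mult_left_mono, auto)
      then show ?case using k M_ge_1 by (intro norm_blinfun_bound) (auto simp: mult_ac)
    qed
    have "((\<lambda>l. \<bar>l - k\<bar> * ((4 * M / k) * (2 * M / k))) \<longlongrightarrow> \<bar>k - k\<bar> * ((4 * M / k) * (2 * M / k))) (at k within {0<..})"
      by (intro tendsto_intros)
    then show "((\<lambda>l. \<bar>l - k\<bar> * ((4 * M / k) * (2 * M / k))) \<longlongrightarrow> 0) (at k within {0<..})" by simp
  qed
  then show "(Res \<longlongrightarrow> Res k) (at k within {0<..})" by (simp add: LIM_zero_iff)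
qed

lemma continuous_on_yosida_op_power: "continuous_on {0<..} (\<lambda>l. blinfun_power (yosida_op l) m x)"
  unfolding yosida_op_def
  by (intro blinfun.continuous_on continuous_on_blinfun_power continuous_intros continuous_on_Res)

lemma norm_power_le:
  assumes "norm K \<le> N"
  shows "norm (blinfun_power K m x) \<le> N ^ m * norm x"
  by (intro order_trans[OF norm_blinfun_power] mult_right_mono power_mono assms) auto

text \<open>For l \<le> \<mu> all factors are simply bounded. For l > \<mu> the \<open>A\<close> is
  handed to the other resolvent: A (l + A)^-1 \<mu> (\<mu> + A)^-1 = (\<mu>/l) l (l + A)^-1 A (\<mu>
  + A)^-1, which gains (\<mu>/l)^m. There are 2 m bounded factors in both cases.\<close>

lemma norm_yosida_op_power_smoothing:
  assumes "0 < \<mu>" "0 < l"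
  shows "norm (blinfun_power (yosida_op l) m (blinfun_power (\<mu> *\<^sub>R Res \<mu>) m x))
    \<le> (1 + 2 * M) ^ (2 * m) * norm x * (if l \<le> \<mu> then 1 else (\<mu> / l) ^ m)"
proof -
  define N where "N = 1 + 2 * M"
  have N: "0 \<le> N" using M_ge_1 by (simp add: N_def)
  have bounds: "norm (k *\<^sub>R Res k) \<le> N" "norm (yosida_op k) \<le> N" if "0 < k" for k
    using norm_scaleR_Res[OF that] norm_yosida_op[OF that] by (auto simp: N_def)
  have two: "norm (blinfun_power K m (blinfun_power L m x)) \<le> N ^ (2 * m) * norm x"
    if "norm K \<le> N" "norm L \<le> N" for K L
  proof -
    have "norm (blinfun_power K m (blinfun_power L m x)) \<le> N ^ m * (N ^ m * norm x)"
      using N by (intro order_trans[OF norm_power_le[OF that(1)]] mult_left_mono norm_power_le[OF that(2)]) auto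
    then show ?thesis by (simp add: mult_2 power_add mult.assoc)
  qed
  show ?thesis
  proof (cases "l \<le> \<mu>")
    case True
    then show ?thesis using two[OF bounds(2)[OF assms(2)] bounds(1)[OF assms(1)]] by (simp add: N_def)
  next
    case False
    have comm1: "yosida_op l ((\<mu> *\<^sub>R Res \<mu>) z) = (\<mu> *\<^sub>R Res \<mu>) (yosida_op l z)" for z
      by (intro bicomm_commute bicomm_comm bicomm_scaleR bicomm_Res bicomm_yosida_op assms)
    have comm2: "(l *\<^sub>R Res l) (yosida_op \<mu> z) = yosida_op \<mu> ((l *\<^sub>R Res l) z)" for z
      by (intro bicomm_commute bicomm_comm bicomm_scaleR bicomm_Res bicomm_yosida_op assms)
    have "yosida_op l o\<^sub>L (\<mu> *\<^sub>R Res \<mu>) = (\<mu> / l) *\<^sub>R ((l *\<^sub>R Res l) o\<^sub>L yosida_op \<mu>)"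
    proof (rule blinfun_eqI)
      fix z
      \<comment> \<open>Both sides are A (l + A)^-1 (\<mu> + A)^-1 z, by the resolvent
        identity.\<close>
      have "Res \<mu> z - l *\<^sub>R Res l (Res \<mu> z) = Res l z - \<mu> *\<^sub>R Res l (Res \<mu> z)"
        using Res_diff[OF assms(2,1), of z] by (simp add: algebra_simps)
      then have "\<mu> *\<^sub>R (Res \<mu> z - l *\<^sub>R Res l (Res \<mu> z)) = \<mu> *\<^sub>R (Res l z - \<mu> *\<^sub>R Res l (Res \<mu> z))"
        by simp
      then show "(yosida_op l o\<^sub>L (\<mu> *\<^sub>R Res \<mu>)) z = ((\<mu> / l) *\<^sub>R ((l *\<^sub>R Res l) o\<^sub>L yosida_op \<mu>)) z"
        using assms by (simp add: yosida_op_apply blinfun.scaleR_left blinfun.scaleR_right blinfun.diff_right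
            scaleR_diff_right mult.commute)
    qed
    then have "blinfun_power (yosida_op l) m (blinfun_power (\<mu> *\<^sub>R Res \<mu>) m x)
        = (\<mu> / l) ^ m *\<^sub>R blinfun_power (l *\<^sub>R Res l) m (blinfun_power (yosida_op \<mu>) m x)"
      using blinfun_power_compose[of "yosida_op l" "\<mu> *\<^sub>R Res \<mu>" m x, OF comm1]
        blinfun_power_compose[of "l *\<^sub>R Res l" "yosida_op \<mu>" m x, OF comm2]
      by (simp add: blinfun_power_scaleR)
    then show ?thesis
      using False two[OF bounds(1)[OF assms(2)] bounds(2)[OF assms(1)]] assms
      by (simp add: N_def mult.commute mult_left_mono)
  qed
qed

text \<open>A bounded \<open>B\<close> in the commutant passes through the powers of the Yosida
  operators and through the integral. It is applied with \<open>B = D\<close>, to see that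
  \<open>D\<close> maps the test pair into the graph of the fractional power.\<close>

lemma balakrishnan_comm:
  assumes "comm B" "(x, y) \<in> balakrishnan A \<alpha>"
  shows "(B x, B y) \<in> balakrishnan A \<alpha>"
proof -
  define m where "m = Suc (nat \<lfloor>\<alpha>\<rfloor>)"
  define c where "c l = Gamma (real m) / (Gamma \<alpha> * Gamma (real m - \<alpha>)) * l powr (\<alpha> - 1)" for l
  obtain u where u: "x \<in> Domain (A ^^ m)" "\<And>l. l > 0 \<Longrightarrow> (x, u l) \<in> yosida A l ^^ m"
    "((\<lambda>l. c l *\<^sub>R u l) has_integral y) {0<..}"
    using assms(2) by (auto simp: balakrishnan_def Let_def m_def c_def)
  have "(B x, B (u l)) \<in> yosida A l ^^ m" if "l > 0" for l
  proof -
    have "u l = blinfun_power (yosida_op l) m x"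
      using u(2)[OF that] unfolding yosida_eq[OF that] fun_graph_relpow by (auto simp: fun_graph_def)
    then show ?thesis
      using bicomm_commute[OF bicomm_power[OF bicomm_yosida_op[OF that]] assms(1), of m x]
      unfolding yosida_eq[OF that] fun_graph_relpow by (auto simp: fun_graph_def)
  qed
  moreover have "((\<lambda>l. c l *\<^sub>R B (u l)) has_integral B y) {0<..}"
    using has_integral_linear[OF u(3) blinfun.bounded_linear_right[of B]]
    by (simp add: o_def blinfun.scaleR_right)
  moreover have "B x \<in> Domain (A ^^ m)" using u(1) A_relpow_comm[OF assms(1)] by blast
  ultimately show ?thesis
    unfolding balakrishnan_def Let_def m_def[symmetric] c_def
    by (intro CollectI case_prodI conjI exI[of _ "\<lambda>l. B (u l)"]) auto
qed

text \<open>Here \<open>y\<close> is A^\<alpha> applied to the smoothed vector. One \<open>y\<close>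
  serves all \<open>B\<close>, and \<open>C\<close> depends neither on \<alpha> nor on \<mu>, as the
  final constants must be uniform in \<alpha>.\<close>

lemma frac_power_smoothing_bound:
  "\<exists>C>0. \<forall>\<alpha>\<in>{0..2}. \<forall>\<mu>>0. \<forall>w. \<exists>y.
     (\<forall>B. comm B \<longrightarrow> (B (blinfun_power (\<mu> *\<^sub>R Res \<mu>) (Suc (nat \<lfloor>\<alpha>\<rfloor>)) w), B y) \<in> frac_power A \<alpha>) \<and>
     norm y \<le> C * \<mu> powr \<alpha> * norm w"
proof -
  obtain \<gamma> :: real where \<gamma>: "\<gamma> > 0" "\<And>x. x \<in> {1..3} \<Longrightarrow> \<gamma> \<le> Gamma x"
    using Gamma_ge_on_1_3 by blast
  define N where "N = 1 + 2 * M"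
  have N: "1 \<le> N" using M_ge_1 by (simp add: N_def)
  \<comment> \<open>The summand \<open>N\<close> serves \<alpha> = 0, where A^\<alpha> is the
    identity and m = 1. In the other, 6 = 3! bounds Gamma (m + 1), \<open>\<gamma>\<^sup>2\<close>
    the two Gamma factors below, and \<open>N ^ 6\<close> is N^(2 m) for m \<le> 3.\<close>
  define C where "C = N + 6 / \<gamma>\<^sup>2 * N ^ 6"
  have C: "C > 0" "N \<le> C" using N \<gamma> by (auto simp: C_def intro: add_pos_nonneg)
  have "\<exists>y. (\<forall>B. comm B \<longrightarrow> (B (blinfun_power (\<mu> *\<^sub>R Res \<mu>) (Suc (nat \<lfloor>\<alpha>\<rfloor>)) w), B y) \<in> frac_power A \<alpha>) \<and>
     norm y \<le> C * \<mu> powr \<alpha> * norm w" if \<alpha>: "\<alpha> \<in> {0..2}" and \<mu>: "\<mu> > 0" for \<alpha> \<mu> :: real and w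
  proof (cases "\<alpha> = 0")
    case True
    have "norm ((\<mu> *\<^sub>R Res \<mu>) w) \<le> N * norm w"
      using norm_scaleR_Res[OF \<mu>] unfolding N_def
      by (intro order_trans[OF norm_blinfun] mult_right_mono) auto
    also have "\<dots> \<le> C * norm w" using C by (intro mult_right_mono) auto
    finally show ?thesis using True \<mu>
      by (intro exI[of _ "(\<mu> *\<^sub>R Res \<mu>) w"]) (simp add: frac_power_def)
  next
    case False
    define m where "m = Suc (nat \<lfloor>\<alpha>\<rfloor>)"
    have real_m: "real m = of_int \<lfloor>\<alpha>\<rfloor> + 1" using \<alpha> by (simp add: m_def)
    have m: "\<alpha> < real m" "real m \<le> \<alpha> + 1" unfolding real_m by linarith+
    have "m \<le> 3" using m \<alpha> by simp
    define v where "v = blinfun_power (\<mu> *\<^sub>R Res \<mu>) m w"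
    define c where "c = Gamma (real m) / (Gamma \<alpha> * Gamma (real m - \<alpha>))"
    have G: "Gamma (real m) > 0" "Gamma \<alpha> > 0" "Gamma (real m - \<alpha>) > 0"
      using m \<alpha> False by (auto intro!: Gamma_real_pos simp: m_def)
    then have c: "c > 0" by (simp add: c_def)
    have gI: "((\<lambda>l. (c * (N ^ (2 * m) * norm w)) * (l powr (\<alpha> - 1) * (if l \<le> \<mu> then 1 else (\<mu> / l) powr real m))) has_integral
        (c * (N ^ (2 * m) * norm w)) * (\<mu> powr \<alpha> * (1 / \<alpha> + 1 / (real m - \<alpha>)))) {0<..}"
      using m \<alpha> \<mu> False by (intro has_integral_mult_right has_integral_powr_min) auto
    have le: "norm ((c * l powr (\<alpha> - 1)) *\<^sub>R blinfun_power (yosida_op l) m v)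
        \<le> (c * (N ^ (2 * m) * norm w)) * (l powr (\<alpha> - 1) * (if l \<le> \<mu> then 1 else (\<mu> / l) powr real m))"
      if "l > 0" for l
    proof -
      have "(\<mu> / l) powr real m = (\<mu> / l) ^ m" using \<mu> that by (simp add: powr_realpow)
      then have "norm (blinfun_power (yosida_op l) m v) \<le> N ^ (2 * m) * norm w * (if l \<le> \<mu> then 1 else (\<mu> / l) powr real m)"
        using norm_yosida_op_power_smoothing[OF \<mu> that, of m w] by (simp only: N_def v_def)
      then have "(c * l powr (\<alpha> - 1)) * norm (blinfun_power (yosida_op l) m v)
        \<le> (c * l powr (\<alpha> - 1)) * (N ^ (2 * m) * norm w * (if l \<le> \<mu> then 1 else (\<mu> / l) powr real m))"
        using c by (intro mult_left_mono) auto
      then show ?thesis using c by (simp add: mult_ac)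
    qed
    have ct: "continuous_on {0<..} (\<lambda>l. (c * l powr (\<alpha> - 1)) *\<^sub>R blinfun_power (yosida_op l) m v)"
      by (intro continuous_intros continuous_on_yosida_op_power) auto
    obtain y where y: "((\<lambda>l. (c * l powr (\<alpha> - 1)) *\<^sub>R blinfun_power (yosida_op l) m v) has_integral y) {0<..}"
      "norm y \<le> (c * (N ^ (2 * m) * norm w)) * (\<mu> powr \<alpha> * (1 / \<alpha> + 1 / (real m - \<alpha>)))"
      by (rule integrable_dominated_halfline[OF ct le gI])
    have "(v, y) \<in> balakrishnan A \<alpha>"
      unfolding balakrishnan_def Let_def m_def[symmetric]
    proof (intro CollectI case_prodI conjI exI)
      show "v \<in> Domain (A ^^ m)" unfolding v_def by (rule smoothing_in_Domain[OF \<mu>])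
      show "\<forall>l>0. (v, blinfun_power (yosida_op l) m v) \<in> yosida A l ^^ m"
        by (simp add: yosida_eq fun_graph_relpow) (simp add: fun_graph_def)
      show "((\<lambda>l. (Gamma (real m) / (Gamma \<alpha> * Gamma (real m - \<alpha>)) * l powr (\<alpha> - 1)) *\<^sub>R blinfun_power (yosida_op l) m v)
          has_integral y) {0<..}"
        using y(1) by (simp add: c_def)
    qed
    then have mem: "(B v, B y) \<in> frac_power A \<alpha>" if "comm B" for B
      using closure_subset[THEN subsetD, OF balakrishnan_comm[OF that]] False by (auto simp: frac_power_def)
    \<comment> \<open>The poles of 1/\<alpha> + 1/(m - \<alpha>) at \<alpha> = 0 and \<alpha> = m
      are absorbed by the functional equation of Gamma; what is left is bounded on the whole
      range.\<close>
    have "c * (1 / \<alpha> + 1 / (real m - \<alpha>)) = Gamma (real m + 1) / (Gamma (\<alpha> + 1) * Gamma (real m - \<alpha> + 1))"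
    proof -
      have "1 / \<alpha> + 1 / (real m - \<alpha>) = real m / (\<alpha> * (real m - \<alpha>))"
        using m \<alpha> False by (simp add: field_simps)
      moreover have "Gamma (x + 1) = x * Gamma x" if "x > 0" for x :: real
        using that by (intro Gamma_plus1) (auto elim!: nonpos_Ints_cases)
      then have "Gamma (real m + 1) = real m * Gamma (real m)" "Gamma (\<alpha> + 1) = \<alpha> * Gamma \<alpha>"
        "Gamma (real m - \<alpha> + 1) = (real m - \<alpha>) * Gamma (real m - \<alpha>)"
        using m \<alpha> False by auto
      ultimately show ?thesis by (simp add: c_def mult_ac)
    qed
    also have "\<dots> \<le> 6 / \<gamma>\<^sup>2"
    proof (rule frac_le)
      have "Gamma (real m + 1) = fact m" using Gamma_fact[of m, where 'a=real] by (simp add: add.commute)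
      also have "\<dots> \<le> fact 3" using \<open>m \<le> 3\<close> by (rule fact_mono)
      finally show "Gamma (real m + 1) \<le> 6" by (simp add: fact_numeral)
      show "\<gamma>\<^sup>2 \<le> Gamma (\<alpha> + 1) * Gamma (real m - \<alpha> + 1)"
        unfolding power2_eq_square using \<gamma> m \<alpha> by (intro mult_mono) (auto intro!: \<gamma>(2) order_trans[OF less_imp_le[OF \<gamma>(1)] \<gamma>(2)])
    qed (use \<gamma> in auto)
    finally have "c * (1 / \<alpha> + 1 / (real m - \<alpha>)) * N ^ (2 * m) \<le> 6 / \<gamma>\<^sup>2 * N ^ 6"
      using N \<open>m \<le> 3\<close> m \<alpha> False c by (intro mult_mono power_increasing) auto
    also have "\<dots> \<le> C" using N by (simp add: C_def)
    finally have "c * (1 / \<alpha> + 1 / (real m - \<alpha>)) * N ^ (2 * m) * (\<mu> powr \<alpha> * norm w) \<le> C * (\<mu> powr \<alpha> * norm w)"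
      by (rule mult_right_mono) auto
    then have "norm y \<le> C * \<mu> powr \<alpha> * norm w"
      using y(2) by (simp add: mult_ac)
    then show ?thesis using mem unfolding v_def m_def by blast
  qed
  then show ?thesis using C(1) by blast
qed

text \<open>\<open>d\<close> is the value at \<open>l\<close> of the symbol of \<open>D\<close>. The
  operator norm of the composed relation is an extended real, so a bound by infinity is trivial and
  only a finite value requires the test vectors.\<close>

lemma spectral_lower_bound:
  "\<exists>c>0. \<forall>\<alpha>\<in>{0..2}. \<forall>l D d H. l \<in> spectrum A \<longrightarrow> 0 \<le> Re l \<longrightarrow> l \<noteq> 0 \<longrightarrow> div_diff l D d H \<longrightarrow>
     ereal (c * cmod l powr (- \<alpha>) * cmod d) \<le> op_norm (fun_graph (blinfun_apply D) O neg_frac_power A \<alpha>)"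
proof -
  obtain C where C: "C > 0" "\<And>\<alpha> \<mu> w. \<alpha> \<in> {0..2} \<Longrightarrow> \<mu> > 0 \<Longrightarrow> \<exists>y.
     (\<forall>B. comm B \<longrightarrow> (B (blinfun_power (\<mu> *\<^sub>R Res \<mu>) (Suc (nat \<lfloor>\<alpha>\<rfloor>)) w), B y) \<in> frac_power A \<alpha>) \<and>
     norm y \<le> C * \<mu> powr \<alpha> * norm w"
    using frac_power_smoothing_bound by metis
  have "ereal (1 / (8 * C) * cmod l powr (- \<alpha>) * cmod d) \<le> op_norm (fun_graph (blinfun_apply D) O neg_frac_power A \<alpha>)"
    if \<alpha>: "\<alpha> \<in> {0..2}" and l: "l \<in> spectrum A" "0 \<le> Re l" "l \<noteq> 0" and D: "div_diff l D d H" for \<alpha> l D d H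
  proof -
    define \<mu> where "\<mu> = cmod l"
    define m where "m = Suc (nat \<lfloor>\<alpha>\<rfloor>)"
    have "real m = of_int \<lfloor>\<alpha>\<rfloor> + 1" using \<alpha> by (simp add: m_def)
    then have "real m \<le> 3" using \<alpha> of_int_floor_le[of \<alpha>] by simp
    then have m: "m \<le> 3" by simp
    have \<mu>: "\<mu> > 0" using l by (simp add: \<mu>_def)
    define V where "V = blinfun_power (\<mu> *\<^sub>R Res \<mu>) m"
    \<comment> \<open>With Re l \<ge> 0 and \<mu> > 0 the real part of \<mu> + l is
      positive.\<close>
    have ne: "of_real \<mu> + l \<noteq> 0" using \<mu> l(2) by (auto simp: complex_eq_iff)
    obtain H1 where "div_diff l (Res \<mu>) (1 / (of_real \<mu> + l)) H1" using div_diff_Res[OF \<mu> ne] .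
    from div_diff_scaleC[OF this, of "of_real \<mu>"]
    have "\<exists>H. div_diff l (\<mu> *\<^sub>R Res \<mu>) (of_real \<mu> / (of_real \<mu> + l)) H"
      by (metis (no_types, lifting) blinfun_eqI blinfun_apply_blinfun_compose blinfun_scaleC.rep_eq
          blinfun.scaleR_left scaleC_of_real mult.right_neutral times_divide_eq_right)
    then obtain H2 where "div_diff l V ((of_real \<mu> / (of_real \<mu> + l)) ^ m) H2"
      unfolding V_def using div_diff_power by blast
    with D obtain G where G: "div_diff l (D o\<^sub>L V) (d * (of_real \<mu> / (of_real \<mu> + l)) ^ m) G"
      using div_diff_compose by blast
    have comm_D: "comm D" using D by (auto simp: div_diff_def bicomm_comm)
    have "cmod d * (1 / 8) \<le> cmod (d * (of_real \<mu> / (of_real \<mu> + l)) ^ m)"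
    proof -
      \<comment> \<open>Since \<mu> = |l|, each smoothing factor has modulus at least 1/2 at
        \<open>l\<close>, and there are at most three of them.\<close>
      have "cmod (of_real \<mu> + l) \<le> 2 * \<mu>"
        using norm_triangle_ineq[of "of_real \<mu>" l] \<mu> by (simp add: \<mu>_def)
      then have "1 / 2 \<le> \<mu> / cmod (of_real \<mu> + l)" using ne by (simp add: field_simps)
      then have "(1 / 2) ^ m \<le> (\<mu> / cmod (of_real \<mu> + l)) ^ m" by (intro power_mono) auto
      moreover have "(1 / 2) ^ 3 \<le> (1 / 2 :: real) ^ m" using m by (intro power_decreasing) auto
      ultimately have "1 / 8 \<le> (\<mu> / cmod (of_real \<mu> + l)) ^ m" by (simp add: power3_eq_cube)
      then have "cmod d * (1 / 8) \<le> cmod d * (\<mu> / cmod (of_real \<mu> + l)) ^ m"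
        by (rule mult_left_mono) simp
      then show ?thesis using \<mu> by (simp add: norm_mult norm_power norm_divide)
    qed
    also have "\<dots> \<le> norm (D o\<^sub>L V)"
    proof (rule ccontr)
      assume "\<not> ?thesis"
      then obtain R where "(shift_minus l A)\<inverse> = fun_graph (blinfun_apply R)"
        using div_diff_resolvent[OF G] by (metis not_le)
      then show False using l(1) by (auto simp: spectrum_def resolvent_set_def)
    qed
    finally have d: "cmod d * (1 / 8) \<le> norm (D o\<^sub>L V)" .
    show ?thesis
    proof (cases "op_norm (fun_graph (blinfun_apply D) O neg_frac_power A \<alpha>)")
      case (real r)
      have small: "norm (D (V w)) \<le> r" if "C * \<mu> powr \<alpha> * norm w \<le> 1" for w
      proof -
        obtain y where y: "\<And>B. comm B \<Longrightarrow> (B (V w), B y) \<in> frac_power A \<alpha>" "norm y \<le> C * \<mu> powr \<alpha> * norm w"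
          using C(2)[OF \<alpha> \<mu>, of w] unfolding V_def m_def by blast
        \<comment> \<open>With y = A^\<alpha> V w, commutation gives D y = A^\<alpha> D V w, so the
          operator under test sends \<open>y\<close> to D V w.\<close>
        have "(y, D (V w)) \<in> fun_graph (blinfun_apply D) O neg_frac_power A \<alpha>"
          using y(1)[OF comm_D] by (auto simp: fun_graph_def neg_frac_power_def)
        then have "ereal (norm (D (V w))) \<le> op_norm (fun_graph (blinfun_apply D) O neg_frac_power A \<alpha>)"
          unfolding op_norm_def using y(2) that by (intro Sup_upper) force
        then show ?thesis using real by simp
      qed
      have C\<mu>: "C * \<mu> powr \<alpha> > 0" using C \<mu> by simp
      have r: "0 \<le> r" using small[of 0] by simp
      have "norm (D (V w)) \<le> r * (C * \<mu> powr \<alpha>) * norm w" for w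
      proof (cases "w = 0")
        case False
        define b where "b = C * \<mu> powr \<alpha> * norm w"
        have b: "b > 0" using False C\<mu> by (simp add: b_def)
        have "norm (D (V ((1 / b) *\<^sub>R w))) \<le> r"
          using b by (intro small) (simp add: b_def)
        then have "norm (D (V w)) / b \<le> r" using b by (simp add: blinfun.scaleR_right)
        then have "norm (D (V w)) \<le> r * b" using b by (simp add: pos_divide_le_eq)
        then show ?thesis by (simp add: b_def mult.assoc)
      qed simp
      then have "norm (D o\<^sub>L V) \<le> r * (C * \<mu> powr \<alpha>)"
        using r C\<mu> by (intro norm_blinfun_bound) auto
      with d have "cmod d * (1 / 8) \<le> r * (C * \<mu> powr \<alpha>)" by simp
      then have "1 / (8 * C) * cmod l powr (- \<alpha>) * cmod d \<le> r"
        using C\<mu> C(1) \<mu> unfolding \<mu>_def[symmetric] powr_minus by (simp add: field_simps)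
      then show ?thesis using real by simp
    next
      case MInf
      \<comment> \<open>The value minus infinity would be the supremum of the empty set; the pair of
        zeros excludes it.\<close>
      have "(0, 0) \<in> fun_graph (blinfun_apply D) O neg_frac_power A \<alpha>"
      proof -
        obtain y where y: "\<And>B. comm B \<Longrightarrow> (B (V 0), B y) \<in> frac_power A \<alpha>" "norm y \<le> C * \<mu> powr \<alpha> * norm (0::'a)"
          using C(2)[OF \<alpha> \<mu>, of 0] unfolding V_def m_def by blast
        then have "(D 0, D 0) \<in> frac_power A \<alpha>" using y(1)[OF comm_D] by simp
        then show ?thesis by (auto simp: fun_graph_def neg_frac_power_def intro: relcompI)
      qed
      then have "ereal (norm (0::'a)) \<le> op_norm (fun_graph (blinfun_apply D) O neg_frac_power A \<alpha>)"
        unfolding op_norm_def by (intro Sup_upper) force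
      then show ?thesis using MInf by simp
    qed simp
  qed
  then show ?thesis using C(1) by (intro exI[of _ "1 / (8 * C)"]) auto
qed

end

section \<open>Strong integrals\<close>

abbreviation "sb_integrable \<equiv> Bochner_Integration.simple_bochner_integrable"
abbreviation "sb_integral \<equiv> Bochner_Integration.simple_bochner_integral"
abbreviation "L1_dist M f g \<equiv> \<integral>\<^sup>+x. norm (f x - g x) \<partial>M"

text \<open>In a nonseparable space a difference of Borel functions need not be Borel. Splitting
  over the finitely many values of \<open>s\<close> leaves only functions |f - c| with constant
  \<open>c\<close>, which are compositions of \<open>f\<close> with a continuous map.\<close>

lemma borel_measurable_norm_diff_simple:
  fixes f :: "'b \<Rightarrow> 'a::real_normed_vector"
  assumes f: "f \<in> borel_measurable M" and s: "simple_function M s"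
  shows "(\<lambda>x. norm (f x - s x)) \<in> borel_measurable M"
proof -
  have [measurable]: "(\<lambda>x. norm (f x - c)) \<in> borel_measurable M" for c
    by (rule measurable_compose[OF f]) (intro borel_measurable_continuous_onI continuous_intros)
  have [measurable]: "s -` {c} \<inter> space M \<in> sets M" for c
    using s by (rule simple_functionD(2))
  have fin: "finite (s ` space M)" using s by (rule simple_functionD(1))
  have "(\<lambda>x. \<Sum>c\<in>s ` space M. indicator (s -` {c} \<inter> space M) x * norm (f x - c)) \<in> borel_measurable M"
    by measurable
  moreover have "(\<Sum>c\<in>s ` space M. indicator (s -` {c} \<inter> space M) x * norm (f x - c)) = norm (f x - s x)"
    if "x \<in> space M" for x
  proof -
    have "(\<Sum>c\<in>s ` space M. indicator (s -` {c} \<inter> space M) x * norm (f x - c))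
        = (\<Sum>c\<in>s ` space M. if c = s x then norm (f x - s x) else 0)"
      by (intro sum.cong) (use that in \<open>auto simp: indicator_def\<close>)
    also have "\<dots> = norm (f x - s x)" using fin that by simp
    finally show ?thesis .
  qed
  ultimately show ?thesis by (simp cong: measurable_cong)
qed

lemma norm_simple_bochner_integral_le:
  assumes "sb_integrable M s"
  shows "ennreal (norm (sb_integral M s)) \<le> (\<integral>\<^sup>+x. norm (s x) \<partial>M)"
proof -
  have "sb_integrable M (\<lambda>x. norm (s x))"
    using simple_bochner_integrable_compose2[of "\<lambda>x y. norm x" M s s] assms by simp
  then have "(\<integral>\<^sup>+x. norm (s x) \<partial>M) = sb_integral M (\<lambda>x. norm (s x))"
    by (intro simple_bochner_integral_eq_nn_integral[symmetric]) auto
  then show ?thesis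
    using simple_bochner_integral_norm_bound[OF assms] by (simp add: ennreal_leI)
qed

lemma simple_bochner_integrable_simple_function:
  "sb_integrable M s \<Longrightarrow> simple_function M s"
  by (auto elim: simple_bochner_integrable.cases)

lemma nn_integral_norm_le_add_errors:
  fixes f g :: "'b \<Rightarrow> 'a::real_normed_vector" and h :: "'b \<Rightarrow> real"
  assumes "f \<in> borel_measurable M" "g \<in> borel_measurable M" "sb_integrable M s" "sb_integrable M t"
    and le: "\<And>x. h x \<le> norm (f x - s x) + norm (g x - t x)"
  shows "(\<integral>\<^sup>+x. h x \<partial>M) \<le> L1_dist M f s + L1_dist M g t"
proof -
  have "(\<integral>\<^sup>+x. h x \<partial>M) \<le> (\<integral>\<^sup>+x. ennreal (norm (f x - s x)) + ennreal (norm (g x - t x)) \<partial>M)"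
    by (intro nn_integral_mono) (simp add: ennreal_leI le flip: ennreal_plus)
  also have "\<dots> = L1_dist M f s + L1_dist M g t"
    by (intro nn_integral_add measurable_compose[OF _ measurable_ennreal] borel_measurable_norm_diff_simple
        simple_bochner_integrable_simple_function assms)
  finally show ?thesis .
qed

text \<open>The common source of uniqueness (two approximating sequences) and of existence (the
  Cauchy property of one sequence).\<close>

lemma simple_bochner_integral_diff_le:
  fixes f :: "'b \<Rightarrow> 'a::real_normed_vector"
  assumes f: "f \<in> borel_measurable M"
    and s: "sb_integrable M s" and t: "sb_integrable M t"
  shows "ennreal (norm (sb_integral M s - sb_integral M t))
    \<le> L1_dist M f s + L1_dist M f t"
proof -
  have "sb_integrable M (\<lambda>x. s x - t x)"
    using simple_bochner_integrable_compose2[of "(-)" M s t] s t by simp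
  then have "ennreal (norm (sb_integral M s - sb_integral M t))
      \<le> L1_dist M s t"
    using norm_simple_bochner_integral_le simple_bochner_integral_diff[OF s t] by metis
  also have "\<dots> \<le> L1_dist M f s + L1_dist M f t"
  proof (rule nn_integral_norm_le_add_errors[OF f f s t])
    fix x
    show "norm (s x - t x) \<le> norm (f x - s x) + norm (f x - t x)"
      using norm_triangle_ineq4[of "f x - t x" "f x - s x"] by simp
  qed
  finally show ?thesis .
qed

lemma has_strong_integralE:
  assumes "has_strong_integral M f y"
  obtains s where "\<And>i. sb_integrable M (s i)" "(\<lambda>i. L1_dist M f (s i)) \<longlonglongrightarrow> 0"
    "(\<lambda>i. sb_integral M (s i)) \<longlonglongrightarrow> y" "f \<in> borel_measurable M"
  using assms unfolding has_strong_integral_def by blast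

lemma has_strong_integral_unique:
  assumes "has_strong_integral M f y" "has_strong_integral M f z"
  shows "y = z"
proof -
  from assms(1) obtain s where s: "\<And>i. sb_integrable M (s i)" "(\<lambda>i. L1_dist M f (s i)) \<longlonglongrightarrow> 0"
      "(\<lambda>i. sb_integral M (s i)) \<longlonglongrightarrow> y" and f: "f \<in> borel_measurable M" by (rule has_strong_integralE) auto
  from assms(2) obtain t where t: "\<And>i. sb_integrable M (t i)" "(\<lambda>i. L1_dist M f (t i)) \<longlonglongrightarrow> 0"
      "(\<lambda>i. sb_integral M (t i)) \<longlonglongrightarrow> z" by (rule has_strong_integralE) auto
  have "(\<lambda>i. ennreal (norm (sb_integral M (s i) - sb_integral M (t i)))) \<longlonglongrightarrow> 0"
    by (rule tendsto_sandwich[OF _ _ tendsto_const tendsto_add[OF s(2) t(2), simplified]])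
       (auto intro!: always_eventually simple_bochner_integral_diff_le f s(1) t(1))
  moreover have "(\<lambda>i. ennreal (norm (sb_integral M (s i) - sb_integral M (t i)))) \<longlonglongrightarrow> ennreal (norm (y - z))"
    by (intro tendsto_intros s(3) t(3)) 
  ultimately have "ennreal (norm (y - z)) = 0" using LIMSEQ_unique by blast
  then show ?thesis by simp
qed

lemma has_strong_integral_linear:
  assumes "has_strong_integral M f y" and B: "bounded_linear B"
  shows "has_strong_integral M (\<lambda>x. B (f x)) (B y)"
proof -
  interpret B: bounded_linear B by fact
  obtain s where s: "\<And>i. sb_integrable M (s i)" "(\<lambda>i. L1_dist M f (s i)) \<longlonglongrightarrow> 0"
      "(\<lambda>i. sb_integral M (s i)) \<longlonglongrightarrow> y"
    and f: "f \<in> borel_measurable M"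
    using assms unfolding has_strong_integral_def by blast
  obtain K where K: "0 \<le> K" "\<And>x. norm (B x) \<le> norm x * K" using B.nonneg_bounded by blast
  have "(\<lambda>i. \<integral>\<^sup>+x. norm (B (f x) - B (s i x)) \<partial>M) \<longlonglongrightarrow> 0"
  proof (rule tendsto_sandwich[OF _ _ tendsto_const])
    have "(\<lambda>i. ennreal K * L1_dist M f (s i)) \<longlonglongrightarrow> ennreal K * 0"
      by (intro ennreal_tendsto_cmult s(2)) simp
    then show "(\<lambda>i. ennreal K * L1_dist M f (s i)) \<longlonglongrightarrow> 0" by simp
    have "(\<integral>\<^sup>+x. norm (B (f x) - B (s i x)) \<partial>M) \<le> (\<integral>\<^sup>+x. ennreal K * norm (f x - s i x) \<partial>M)" for i
      using K by (intro nn_integral_mono)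
        (auto simp: B.diff[symmetric] mult.commute ennreal_mult[symmetric] intro!: ennreal_leI)
    also have "\<dots> i = ennreal K * L1_dist M f (s i)" for i
      using borel_measurable_norm_diff_simple[OF f simple_bochner_integrable_simple_function[OF s(1)]]
      by (intro nn_integral_cmult) auto
    finally show "eventually (\<lambda>i. (\<integral>\<^sup>+x. norm (B (f x) - B (s i x)) \<partial>M) \<le> ennreal K * L1_dist M f (s i)) sequentially"
      by simp
  qed simp
  moreover have "sb_integrable M (\<lambda>x. B (s i x))" for i
    using simple_bochner_integrable_compose2[of "\<lambda>x y. B x" M "s i" "s i"] s(1) by (simp add: B.zero)
  moreover have "(\<lambda>i. sb_integral M (\<lambda>x. B (s i x))) \<longlonglongrightarrow> B y"
    using B.tendsto[OF s(3)] s(1) by (simp add: simple_bochner_integral_linear B.linear_axioms)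
  moreover have "(\<lambda>x. B (f x)) \<in> borel_measurable M"
    by (rule measurable_compose[OF f]) (intro borel_measurable_continuous_onI B.continuous_on continuous_on_id)
  ultimately show ?thesis unfolding has_strong_integral_def by (intro conjI exI[of _ "\<lambda>i x. B (s i x)"]) auto
qed

text \<open>Measurability of the sum is an assumption because it does not follow from that of the
  summands in a nonseparable space; in the applications it comes from continuity.\<close>

lemma has_strong_integral_add:
  assumes "has_strong_integral M f y" "has_strong_integral M g z"
    and m: "(\<lambda>x. f x + g x) \<in> borel_measurable M"
  shows "has_strong_integral M (\<lambda>x. f x + g x) (y + z)"
proof -
  from assms(1) obtain s where s: "\<And>i. sb_integrable M (s i)" "(\<lambda>i. L1_dist M f (s i)) \<longlonglongrightarrow> 0"
      "(\<lambda>i. sb_integral M (s i)) \<longlonglongrightarrow> y" and f: "f \<in> borel_measurable M" by (rule has_strong_integralE) auto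
  from assms(2) obtain t where t: "\<And>i. sb_integrable M (t i)" "(\<lambda>i. L1_dist M g (t i)) \<longlonglongrightarrow> 0"
      "(\<lambda>i. sb_integral M (t i)) \<longlonglongrightarrow> z" and g: "g \<in> borel_measurable M" by (rule has_strong_integralE) auto
  have le: "(\<integral>\<^sup>+x. norm (f x + g x - (s i x + t i x)) \<partial>M)
      \<le> L1_dist M f (s i) + L1_dist M g (t i)" for i
  proof (rule nn_integral_norm_le_add_errors[OF f g s(1) t(1)])
    fix x
    show "norm (f x + g x - (s i x + t i x)) \<le> norm (f x - s i x) + norm (g x - t i x)"
      using norm_triangle_ineq[of "f x - s i x" "g x - t i x"] by (simp add: algebra_simps)
  qed
  have "(\<lambda>i. \<integral>\<^sup>+x. norm (f x + g x - (s i x + t i x)) \<partial>M) \<longlonglongrightarrow> 0"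
    by (rule tendsto_sandwich[OF _ _ tendsto_const tendsto_add[OF s(2) t(2), simplified]])
       (auto intro!: always_eventually le)
  moreover have "(\<lambda>i. sb_integral M (\<lambda>x. s i x + t i x)) \<longlonglongrightarrow> y + z"
    using tendsto_add[OF s(3) t(3)] by (simp add: simple_bochner_integral_add s(1) t(1))
  moreover have "sb_integrable M (\<lambda>x. s i x + t i x)" for i
    using simple_bochner_integrable_compose2[of "(+)" M "s i" "t i"] s(1) t(1) by simp
  ultimately show ?thesis unfolding has_strong_integral_def
    by (intro conjI exI[of _ "\<lambda>i x. s i x + t i x"]) (auto intro: m)
qed

lemma has_strong_integral_norm_le:
  assumes "has_strong_integral M f y" and h: "integrable M h" "AE x in M. norm (f x) \<le> h x"
  shows "norm y \<le> (LINT x|M. h x)"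
proof -
  obtain s where s: "\<And>i. sb_integrable M (s i)" "(\<lambda>i. L1_dist M f (s i)) \<longlonglongrightarrow> 0"
      "(\<lambda>i. sb_integral M (s i)) \<longlonglongrightarrow> y"
    and f: "f \<in> borel_measurable M"
    using assms unfolding has_strong_integral_def by blast
  have h0: "AE x in M. 0 \<le> h x" using h(2) by eventually_elim (use norm_ge_zero order_trans in blast)
  have le: "ennreal (norm (sb_integral M (s i))) \<le> ennreal (LINT x|M. h x) + L1_dist M f (s i)" for i
  proof -
    have "ennreal (norm (sb_integral M (s i))) \<le> (\<integral>\<^sup>+x. norm (s i x) \<partial>M)"
      by (rule norm_simple_bochner_integral_le[OF s(1)])
    also have "\<dots> \<le> (\<integral>\<^sup>+x. ennreal (h x) + ennreal (norm (f x - s i x)) \<partial>M)"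
    proof (rule nn_integral_mono_AE)
      show "AE x in M. ennreal (norm (s i x)) \<le> ennreal (h x) + ennreal (norm (f x - s i x))"
        using h(2) h0
      proof eventually_elim
        case (elim x)
        have "norm (s i x) \<le> norm (f x) + norm (f x - s i x)"
          using norm_triangle_ineq4[of "f x" "f x - s i x"] by simp
        then show ?case using elim by (simp add: ennreal_leI flip: ennreal_plus)
      qed
    qed
    also have "\<dots> = (\<integral>\<^sup>+x. h x \<partial>M) + L1_dist M f (s i)"
      using borel_measurable_norm_diff_simple[OF f simple_bochner_integrable_simple_function[OF s(1)]] h(1)
      by (intro nn_integral_add) auto
    also have "(\<integral>\<^sup>+x. h x \<partial>M) = ennreal (LINT x|M. h x)"
      by (rule nn_integral_eq_integral[OF h(1) h0])
    finally show ?thesis .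
  qed
  have "ennreal (norm y) \<le> ennreal (LINT x|M. h x) + 0"
  proof (rule LIMSEQ_le)
    show "(\<lambda>i. ennreal (norm (sb_integral M (s i)))) \<longlonglongrightarrow> ennreal (norm y)"
      by (intro tendsto_intros s(3))
    show "(\<lambda>i. ennreal (LINT x|M. h x) + L1_dist M f (s i)) \<longlonglongrightarrow> ennreal (LINT x|M. h x) + 0"
      by (intro tendsto_intros s(2))
  qed (use le in auto)
  then show ?thesis using integral_nonneg_AE[OF h0] by simp
qed

lemma has_strong_integral_complex:
  fixes f :: "'b \<Rightarrow> complex"
  assumes "has_strong_integral M f y"
  shows "integral\<^sup>L M f = y"
proof -
  have "has_bochner_integral M f y"
    using assms unfolding has_strong_integral_def has_bochner_integral.simps by blast
  then show ?thesis by (rule has_bochner_integral_integral_eq)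
qed

text \<open>Rounding is downwards so that values stay in [0, \<infinity>), where the integrands are
  continuous.\<close>

definition dyadic_floor :: "nat \<Rightarrow> real \<Rightarrow> real" where
  "dyadic_floor i s = of_int \<lfloor>s * 2 ^ i\<rfloor> / 2 ^ i"

lemma dyadic_floor_le: "dyadic_floor i s \<le> s"
  and dyadic_floor_ge: "s - 1 / 2 ^ i \<le> dyadic_floor i s"
  and dyadic_floor_nonneg: "0 \<le> s \<Longrightarrow> 0 \<le> dyadic_floor i s"
proof -
  show "dyadic_floor i s \<le> s" using of_int_floor_le[of "s * 2 ^ i"] by (simp add: dyadic_floor_def field_simps)
  have "s * 2 ^ i - 1 \<le> of_int \<lfloor>s * 2 ^ i\<rfloor>" by linarith
  then have "(s * 2 ^ i - 1) / 2 ^ i \<le> of_int \<lfloor>s * 2 ^ i\<rfloor> / 2 ^ i" by (intro divide_right_mono) auto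
  then show "s - 1 / 2 ^ i \<le> dyadic_floor i s" by (simp add: dyadic_floor_def diff_divide_distrib)
qed (simp add: dyadic_floor_def)

lemma dyadic_floor_tendsto: "(\<lambda>i. dyadic_floor i s) \<longlonglongrightarrow> s"
proof (rule tendsto_sandwich[of "\<lambda>i. s - (1/2) ^ i" _ _ "\<lambda>i. s"])
  have "(\<lambda>i. s - (1/2) ^ i) \<longlonglongrightarrow> s - 0"
    by (intro tendsto_intros LIMSEQ_power_zero) auto
  then show "(\<lambda>i. s - (1/2) ^ i) \<longlonglongrightarrow> s" by simp
qed (auto simp: dyadic_floor_le power_one_over intro!: always_eventually dyadic_floor_ge)

text \<open>The properties of a subordination measure that are used for integrating semigroups and
  Duhamel integrals.\<close>

locale first_moment_prob =
  fixes \<nu> :: "real measure"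
  assumes prob: "prob_space \<nu>" and sets_nu [measurable_cong, simp]: "sets \<nu> = sets borel"
    and neg_null: "emeasure \<nu> {..<0} = 0" and moment: "integrable \<nu> (\<lambda>s. s)"
begin

sublocale prob_space \<nu> by (rule prob)

lemma space_nu [simp]: "space \<nu> = UNIV"
  using sets_eq_imp_space_eq[OF sets_nu] by simp

lemma AE_nonneg: "AE s in \<nu>. 0 \<le> s"
  by (rule AE_I[of _ _ "{..<0}"]) (auto simp: neg_null)

text \<open>A class large enough for bounded orbits and for Duhamel integrals, and integrable by the
  first moment.\<close>

definition linear_growth :: "(real \<Rightarrow> 'a::real_normed_vector) \<Rightarrow> bool" where
  "linear_growth F \<longleftrightarrow> continuous_on {0..} F \<and> (\<exists>C. \<forall>s\<ge>0. norm (F s) \<le> C * (1 + s))"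

lemma measurable_half_line: "continuous_on {0..} F \<Longrightarrow> (\<lambda>s. indicator {0..} s *\<^sub>R F s) \<in> borel_measurable \<nu>"
  for F :: "real \<Rightarrow> 'a::real_normed_vector"
  by (subst measurable_cong_sets[OF sets_nu refl])
     (rule borel_measurable_continuous_on_indicator, auto)

text \<open>Sampling \<open>F\<close> at dyadic points of [0, i) gives simple functions that
  converge pointwise by continuity; dominated convergence with majorant 2 C (1 + |s|) makes this L1
  convergence, and completeness provides the integral.\<close>

lemma strong_integral_exists:
  fixes F :: "real \<Rightarrow> 'a::banach"
  assumes "linear_growth F"
  shows "\<exists>y. has_strong_integral \<nu> (\<lambda>s. indicator {0..} s *\<^sub>R F s) y"
proof -
  define f where "f s = indicator {0..} s *\<^sub>R F s" for s
  define g where "g i s = (if 0 \<le> s \<and> s < real i then F (dyadic_floor i s) else 0)" for i s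
  obtain C where cont: "continuous_on {0..} F" and C: "\<And>s. 0 \<le> s \<Longrightarrow> norm (F s) \<le> C * (1 + s)"
    using assms by (auto simp: linear_growth_def)
  have C0: "0 \<le> C" using order_trans[OF norm_ge_zero C[of 0]] by simp
  have f: "f \<in> borel_measurable \<nu>" unfolding f_def by (rule measurable_half_line[OF cont])
  have g: "sb_integrable \<nu> (g i)" for i
  proof
    \<comment> \<open>An integer code with finite range through which \<open>g i\<close> factors;
      the default -1 marks points outside [0, i) and is never a floor of a nonnegative
      number.\<close>
    define q where "q s = (if 0 \<le> s \<and> s < real i then \<lfloor>s * 2 ^ i\<rfloor> else - 1)" for s
    have [measurable]: "q \<in> measurable borel (count_space UNIV)" unfolding q_def by measurable
    have "q s \<in> {- 1..int i * 2 ^ i}" for s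
    proof (cases "0 \<le> s \<and> s < real i")
      case True
      then have "s * 2 ^ i \<le> of_int (int i * 2 ^ i)" by (simp add: mult_right_mono)
      then have "\<lfloor>s * 2 ^ i\<rfloor> \<le> int i * 2 ^ i" by (metis floor_mono floor_of_int)
      then show ?thesis using True by (auto simp: q_def intro: order_trans[of _ 0])
    qed (auto simp: q_def intro: order_trans[of "- 1" 0])
    then have "finite (range q)" by (intro finite_subset[of "range q" "{- 1..int i * 2 ^ i}"]) auto
    moreover have "q -` {c} \<in> sets \<nu>" for c
      using measurable_sets[of q borel "count_space UNIV" "{c}"] by simp
    ultimately have "simple_function \<nu> q" by (simp add: simple_function_def)
    then have "simple_function \<nu> (\<lambda>s. if q s = - 1 then 0 else F (of_int (q s) / 2 ^ i))"
      by (rule simple_function_compose1)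
    also have "(\<lambda>s. if q s = - 1 then 0 else F (of_int (q s) / 2 ^ i)) = g i"
    proof
      fix s :: real
      have "\<lfloor>s * 2 ^ i\<rfloor> \<noteq> - 1" if "0 \<le> s"
      proof -
        have "0 \<le> \<lfloor>s * 2 ^ i\<rfloor>" using that by simp
        then show ?thesis by linarith
      qed
      then show "(if q s = - 1 then 0 else F (of_int (q s) / 2 ^ i)) = g i s"
        by (auto simp: q_def g_def dyadic_floor_def)
    qed
    finally show "simple_function \<nu> (g i)" .
  qed (simp add: emeasure_eq_measure)
  have norm_g: "norm (g i s) \<le> C * (1 + \<bar>s\<bar>)" for i s
  proof (cases "0 \<le> s \<and> s < real i")
    case True
    have "norm (g i s) \<le> C * (1 + dyadic_floor i s)"
      using True C dyadic_floor_nonneg by (simp add: g_def)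
    also have "\<dots> \<le> C * (1 + \<bar>s\<bar>)" using True dyadic_floor_le[of i s] C0 by (intro mult_left_mono) auto
    finally show ?thesis .
  qed (use C0 in \<open>auto simp: g_def\<close>)
  have lim_g: "(\<lambda>i. g i s) \<longlonglongrightarrow> f s" for s
  proof (cases "0 \<le> s")
    case True
    have "(\<lambda>i. F (dyadic_floor i s)) \<longlonglongrightarrow> F s"
      by (rule continuous_on_tendsto_compose[OF cont dyadic_floor_tendsto])
         (use True dyadic_floor_nonneg in auto)
    moreover have "eventually (\<lambda>i. F (dyadic_floor i s) = g i s) sequentially"
      using True by (auto simp: g_def intro!: eventually_mono[OF eventually_gt_at_top[of "nat \<lceil>s\<rceil>"]]) linarith+
    ultimately have "(\<lambda>i. g i s) \<longlonglongrightarrow> F s" by (rule Lim_transform_eventually)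
    then show ?thesis using True by (simp add: f_def)
  qed (simp add: g_def f_def)
  have "(\<lambda>i. \<integral>\<^sup>+s. norm (f s - g i s) \<partial>\<nu>) \<longlonglongrightarrow> (\<integral>\<^sup>+s. 0 \<partial>\<nu>)"
  proof (rule nn_integral_dominated_convergence[where w="\<lambda>s. ennreal (2 * C * (1 + \<bar>s\<bar>))"])
    show "(\<lambda>s. ennreal (norm (f s - g i s))) \<in> borel_measurable \<nu>" for i
      using borel_measurable_norm_diff_simple[OF f simple_bochner_integrable_simple_function[OF g]] by simp
    have norm_f: "norm (f s) \<le> C * (1 + \<bar>s\<bar>)" for s
      using C[of s] C0 by (cases "0 \<le> s") (auto simp: f_def)
    have "norm (f s - g i s) \<le> 2 * C * (1 + \<bar>s\<bar>)" for i s
    proof -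
      have "norm (f s - g i s) \<le> C * (1 + \<bar>s\<bar>) + C * (1 + \<bar>s\<bar>)"
        by (rule norm_triangle_le_diff[OF add_mono[OF norm_f norm_g]])
      then show ?thesis by simp
    qed
    then show "AE s in \<nu>. ennreal (norm (f s - g i s)) \<le> ennreal (2 * C * (1 + \<bar>s\<bar>))" for i
      by (intro AE_I2 ennreal_leI) 
    have "integrable \<nu> (\<lambda>s. 2 * C * (1 + \<bar>s\<bar>))"
      using moment by (intro integrable_mult_right integrable_add integrable_abs) auto
    then show "(\<integral>\<^sup>+s. ennreal (2 * C * (1 + \<bar>s\<bar>)) \<partial>\<nu>) < \<infinity>"
      using C0 by (subst nn_integral_eq_integral) auto
    have "(\<lambda>i. ennreal (norm (f s - g i s))) \<longlonglongrightarrow> ennreal (norm (f s - f s))" for s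
      by (intro tendsto_intros lim_g)
    then show "AE s in \<nu>. (\<lambda>i. ennreal (norm (f s - g i s))) \<longlonglongrightarrow> 0" by simp
  qed auto
  then have lim0: "(\<lambda>i. \<integral>\<^sup>+s. norm (f s - g i s) \<partial>\<nu>) \<longlonglongrightarrow> 0" by simp
  have "Cauchy (\<lambda>i. sb_integral \<nu> (g i))"
  proof (rule metric_CauchyI)
    fix e :: real assume e: "0 < e"
    then have "eventually (\<lambda>i. (\<integral>\<^sup>+s. norm (f s - g i s) \<partial>\<nu>) < ennreal (e / 2)) sequentially"
      by (intro order_tendstoD(2)[OF lim0]) (simp add: ennreal_zero_less_divide)
    then obtain N where N: "\<And>i. i \<ge> N \<Longrightarrow> (\<integral>\<^sup>+s. norm (f s - g i s) \<partial>\<nu>) < ennreal (e / 2)"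
      by (auto simp: eventually_sequentially)
    have "dist (sb_integral \<nu> (g i)) (sb_integral \<nu> (g j)) < e" if "i \<ge> N" "j \<ge> N" for i j
    proof -
      have "ennreal (norm (sb_integral \<nu> (g i) - sb_integral \<nu> (g j)))
          < ennreal (e / 2) + ennreal (e / 2)"
        using simple_bochner_integral_diff_le[OF f g g, of i j] add_strict_mono[OF N[OF that(1)] N[OF that(2)]]
        by (rule le_less_trans)
      also have "\<dots> = ennreal e" using e by (simp flip: ennreal_plus)
      finally show ?thesis using e by (simp add: dist_norm ennreal_less_iff)
    qed
    then show "\<exists>N. \<forall>i\<ge>N. \<forall>j\<ge>N. dist (sb_integral \<nu> (g i)) (sb_integral \<nu> (g j)) < e"
      by blast
  qed
  then obtain y where "(\<lambda>i. sb_integral \<nu> (g i)) \<longlonglongrightarrow> y"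
    by (auto simp: Cauchy_convergent_iff convergent_def)
  then show ?thesis
    using f g lim0 unfolding has_strong_integral_def f_def[symmetric] by blast
qed

end

section \<open>Subordinate semigroups\<close>

context first_moment_prob
begin

text \<open>The same description as in \<open>exp_bernstein\<close>, so that the two agree by
  unfolding.\<close>

definition half_line_integral :: "(real \<Rightarrow> 'a::banach) \<Rightarrow> 'a" where
  "half_line_integral F = (THE y. has_strong_integral \<nu> (\<lambda>s. indicator {0..} s *\<^sub>R F s) y)"

lemma half_line_integral_eq:
  "has_strong_integral \<nu> (\<lambda>s. indicator {0..} s *\<^sub>R F s) y \<Longrightarrow> half_line_integral F = y"
  unfolding half_line_integral_def using has_strong_integral_unique by blast

lemma half_line_integral_cong:
  assumes "\<And>s. 0 \<le> s \<Longrightarrow> F s = G s"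
  shows "half_line_integral F = half_line_integral G"
proof -
  have "indicator {0..} s *\<^sub>R F s = indicator {0..} s *\<^sub>R G s" for s :: real
    using assms by (cases "0 \<le> s") auto
  then show ?thesis by (simp only: half_line_integral_def)
qed

lemma has_half_line_integral:
  "linear_growth F \<Longrightarrow> has_strong_integral \<nu> (\<lambda>s. indicator {0..} s *\<^sub>R F s) (half_line_integral F)"
  using strong_integral_exists half_line_integral_eq by metis

lemma linear_growth_linear:
  assumes "linear_growth F" "bounded_linear B"
  shows "linear_growth (\<lambda>s. B (F s))"
proof -
  interpret B: bounded_linear B by fact
  obtain K where K: "0 \<le> K" "\<And>x. norm (B x) \<le> norm x * K" using B.nonneg_bounded by blast
  obtain C where cont: "continuous_on {0..} F" and C: "\<And>s. 0 \<le> s \<Longrightarrow> norm (F s) \<le> C * (1 + s)"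
    using assms by (auto simp: linear_growth_def)
  have "norm (B (F s)) \<le> (C * K) * (1 + s)" if "0 \<le> s" for s
    using order_trans[OF K(2) mult_right_mono[OF C[OF that] K(1)]] by (simp add: mult_ac)
  then show ?thesis using B.continuous_on[OF cont] by (auto simp: linear_growth_def)
qed

lemma linear_growth_add:
  assumes "linear_growth F" "linear_growth G"
  shows "linear_growth (\<lambda>s. F s + G s)"
proof -
  obtain C where C: "continuous_on {0..} F" "\<And>s. 0 \<le> s \<Longrightarrow> norm (F s) \<le> C * (1 + s)"
    using assms(1) by (auto simp: linear_growth_def)
  obtain D where D: "continuous_on {0..} G" "\<And>s. 0 \<le> s \<Longrightarrow> norm (G s) \<le> D * (1 + s)"
    using assms(2) by (auto simp: linear_growth_def)
  have "norm (F s + G s) \<le> (C + D) * (1 + s)" if "0 \<le> s" for s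
    using norm_triangle_le[OF add_mono[OF C(2)[OF that] D(2)[OF that]]] by (simp add: algebra_simps)
  then show ?thesis using C(1) D(1) by (auto simp: linear_growth_def intro!: continuous_intros)
qed

lemma half_line_integral_linear:
  assumes "linear_growth F" "bounded_linear B"
  shows "half_line_integral (\<lambda>s. B (F s)) = B (half_line_integral F)"
  using has_strong_integral_linear[OF has_half_line_integral[OF assms(1)] assms(2)] assms(2)
  by (intro half_line_integral_eq) (simp add: linear_simps)

lemma half_line_integral_add:
  assumes "linear_growth F" "linear_growth G"
  shows "half_line_integral (\<lambda>s. F s + G s) = half_line_integral F + half_line_integral G"
proof (rule half_line_integral_eq)
  have "(\<lambda>s. indicator {0..} s *\<^sub>R (F s + G s)) \<in> borel_measurable \<nu>"
    using linear_growth_add[OF assms] by (intro measurable_half_line) (simp add: linear_growth_def)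
  then show "has_strong_integral \<nu> (\<lambda>s. indicator {0..} s *\<^sub>R (F s + G s)) (half_line_integral F + half_line_integral G)"
    unfolding scaleR_add_right
    by (intro has_strong_integral_add has_half_line_integral assms)
qed

lemma norm_half_line_integral_le:
  assumes "linear_growth F" "\<And>s. 0 \<le> s \<Longrightarrow> norm (F s) \<le> a + b * s"
  shows "norm (half_line_integral F) \<le> a + b * (LINT s|\<nu>. s)"
proof -
  have "norm (half_line_integral F) \<le> (LINT s|\<nu>. a + b * s)"
  proof (rule has_strong_integral_norm_le[OF has_half_line_integral[OF assms(1)]])
    show "AE s in \<nu>. norm (indicator {0..} s *\<^sub>R F s) \<le> a + b * s"
      using AE_nonneg by eventually_elim (simp add: assms(2))
  qed (use moment in simp)
  also have "\<dots> = a + b * (LINT s|\<nu>. s)" using moment prob_space by simp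
  finally show ?thesis .
qed

lemma half_line_integral_complex:
  fixes e :: "real \<Rightarrow> complex"
  assumes "linear_growth e" "e \<in> borel_measurable borel"
  shows "half_line_integral e = (LINT s|\<nu>. e s)"
proof -
  have "half_line_integral e = (LINT s|\<nu>. indicator {0..} s *\<^sub>R e s)"
    by (rule has_strong_integral_complex[OF has_half_line_integral[OF assms(1)], symmetric])
  also have "\<dots> = (LINT s|\<nu>. e s)"
    using AE_nonneg assms(2) by (intro integral_cong_AE) (auto simp: measurable_cong_sets[OF sets_nu refl])
  finally show ?thesis .
qed

end

locale subordinated_semigroup = bdd_semigroup T A M + first_moment_prob \<nu>
  for T :: "real \<Rightarrow> 'a::complex_banach \<Rightarrow>\<^sub>L 'a" and A M \<nu>
begin

lemma linear_growth_T: "0 \<le> r \<Longrightarrow> linear_growth (\<lambda>s. T (r * s) x)"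
proof -
  assume r: "0 \<le> r"
  have "norm (T (r * s) x) \<le> (M * norm x) * (1 + s)" if "0 \<le> s" for s
  proof -
    have "norm (T (r * s) x) \<le> M * norm x * 1" using r that norm_T_apply[of "r * s" x] by simp
    also have "\<dots> \<le> (M * norm x) * (1 + s)" using M_ge_1 that by (intro mult_left_mono) auto
    finally show ?thesis .
  qed
  moreover have "continuous_on {0..} (\<lambda>s. T (r * s) x)"
    using r by (intro continuous_on_compose2[OF continuous_on_T] continuous_intros) auto
  ultimately show ?thesis by (auto simp: linear_growth_def)
qed

lemma continuous_on_duhamel: "continuous_on {0..} (\<lambda>s. duhamel l s x)"
proof -
  define U where "U r = exp (l * of_real r) *\<^sub>C T r x" for r
  have U: "continuous_on {0..} U"
    unfolding U_def by (intro continuous_on_scaleC_T continuous_intros) auto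
  have "continuous_on {0..} (\<lambda>s. integral {0..s} U)"
    unfolding continuous_on_eq_continuous_within
  proof
    fix s :: real assume s: "s \<in> {0..}"
    have "continuous_on {0..s + 1} (\<lambda>s. integral {0..s} U)"
      by (intro indefinite_integral_continuous_1 integrable_continuous_real continuous_on_subset[OF U]) auto
    then have "continuous (at s within {0..s + 1}) (\<lambda>s. integral {0..s} U)"
      using s by (simp add: continuous_on_eq_continuous_within)
    moreover have "at s within {0..} = at s within {0..s + 1}"
      by (rule at_within_nhd[of _ "{..<s + 1}"]) (use s in auto)
    ultimately show "continuous (at s within {0..}) (\<lambda>s. integral {0..s} U)" by simp
  qed
  then have "continuous_on {0..} (\<lambda>s. exp (- l * of_real s) *\<^sub>C integral {0..s} U)"
    by (intro scaleC.continuous_on continuous_intros)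
  then show ?thesis unfolding U_def by (simp only: duhamel_eq)
qed

lemma linear_growth_duhamel:
  assumes "0 \<le> r" "0 \<le> Re l"
  shows "linear_growth (\<lambda>s. duhamel l (r * s) x)"
proof -
  have "norm (duhamel l (r * s) x) \<le> (M * r * norm x) * (1 + s)" if "0 \<le> s" for s
  proof -
    have "norm (duhamel l (r * s) x) \<le> (M * r * norm x) * s"
      using norm_duhamel[of "r * s" l x] assms that by (simp add: mult_ac)
    also have "\<dots> \<le> (M * r * norm x) * (1 + s)"
      using M_ge_1 assms by (intro mult_left_mono) auto
    finally show ?thesis .
  qed
  moreover have "continuous_on {0..} (\<lambda>s. duhamel l (r * s) x)"
    using assms by (intro continuous_on_compose2[OF continuous_on_duhamel] continuous_intros) auto
  ultimately show ?thesis by (auto simp: linear_growth_def)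
qed

definition subordinate :: "real \<Rightarrow> 'a \<Rightarrow>\<^sub>L 'a" where
  "subordinate r = Blinfun (\<lambda>x. half_line_integral (\<lambda>s. T (r * s) x))"

lemma subordinate_apply:
  assumes r: "0 \<le> r"
  shows "subordinate r x = half_line_integral (\<lambda>s. T (r * s) x)"
proof -
  have "bounded_linear (\<lambda>x. half_line_integral (\<lambda>s. T (r * s) x))"
  proof (rule bounded_linear_intro)
    show "half_line_integral (\<lambda>s. T (r * s) (x + y)) = half_line_integral (\<lambda>s. T (r * s) x) + half_line_integral (\<lambda>s. T (r * s) y)" for x y
      unfolding blinfun.add_right by (intro half_line_integral_add linear_growth_T r)
    show "half_line_integral (\<lambda>s. T (r * s) (c *\<^sub>R x)) = c *\<^sub>R half_line_integral (\<lambda>s. T (r * s) x)" for c x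
      unfolding blinfun.scaleR_right by (intro half_line_integral_linear linear_growth_T r bounded_linear_scaleR_right)
    show "norm (half_line_integral (\<lambda>s. T (r * s) x)) \<le> norm x * M" for x
      using norm_half_line_integral_le[OF linear_growth_T[OF r], of x "M * norm x" 0] norm_T_apply[of "r * _" x] r
      by (simp add: mult.commute)
  qed
  then show ?thesis unfolding subordinate_def by (simp add: bounded_linear_Blinfun_apply)
qed

lemma bicomm_subordinate:
  assumes r: "0 \<le> r"
  shows "bicomm (subordinate r)"
proof (rule bicommI)
  fix B :: "'a \<Rightarrow>\<^sub>L 'a" and x assume B: "comm B"
  have "B (subordinate r x) = half_line_integral (\<lambda>s. B (T (r * s) x))"
    unfolding subordinate_apply[OF r]
    by (rule half_line_integral_linear[OF linear_growth_T[OF r] blinfun.bounded_linear_right, symmetric])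
  also have "\<dots> = subordinate r (B x)"
    unfolding subordinate_apply[OF r] using r by (intro half_line_integral_cong comm_T B) simp
  finally show "B (subordinate r x) = subordinate r (B x)" .
qed

text \<open>The factorization of \<open>T (r * s)\<close> is averaged over \<nu>: \<open>k\<close>
  is the Laplace transform of \<nu> at r l, and \<open>h\<close> the average of the Duhamel
  integrals. The unbounded \<open>A\<close> must be moved through the integral, which is done with a
  resolvent.\<close>

lemma div_diff_subordinate:
  assumes r: "0 \<le> r" and l: "0 \<le> Re l"
  obtains H where "div_diff l (subordinate r) (LINT s|\<nu>. exp (- l * of_real (r * s))) H"
proof -
  define e where "e s = exp (- l * of_real (r * s))" for s
  define k where "k = (LINT s|\<nu>. e s)"
  define h where "h x = half_line_integral (\<lambda>s. - duhamel l (r * s) x)" for x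
  have D: "linear_growth (\<lambda>s. - duhamel l (r * s) x)" for x
    by (intro linear_growth_linear[OF linear_growth_duhamel[OF r l]] bounded_linear_minus bounded_linear_ident)
  have D_lin: "bounded_linear (\<lambda>x. - duhamel l (r * s) x)" if "0 \<le> s" for s
    using that r by (intro bounded_linear_minus bounded_linear_duhamel) simp
  have mom: "0 \<le> (LINT s|\<nu>. s)" using AE_nonneg by (rule integral_nonneg_AE)
  have "bounded_linear h"
  proof (rule bounded_linear_intro)
    show "h (x + y) = h x + h y" for x y
    proof -
      have "h (x + y) = half_line_integral (\<lambda>s. - duhamel l (r * s) x + - duhamel l (r * s) y)"
        unfolding h_def by (rule half_line_integral_cong) (use linear_simps(1)[OF D_lin] in simp)
      then show ?thesis unfolding h_def by (simp only: half_line_integral_add[OF D D])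
    qed
    show "h (c *\<^sub>R x) = c *\<^sub>R h x" for c x
    proof -
      have "h (c *\<^sub>R x) = half_line_integral (\<lambda>s. c *\<^sub>R (- duhamel l (r * s) x))"
        unfolding h_def by (rule half_line_integral_cong) (use linear_simps(5)[OF D_lin] in simp)
      then show ?thesis unfolding h_def by (simp only: half_line_integral_linear[OF D bounded_linear_scaleR_right])
    qed
    show "norm (h x) \<le> norm x * (M * r * (LINT s|\<nu>. s))" for x
      using norm_half_line_integral_le[OF D, of x 0 "M * r * norm x"] norm_duhamel[of "r * _" l x] r l
      by (simp add: h_def mult_ac)
  qed
  then have h: "blinfun_apply (Blinfun h) = h" by (rule bounded_linear_Blinfun_apply)
  have bi: "bicomm (Blinfun h)"
  proof (rule bicommI)
    fix B :: "'a \<Rightarrow>\<^sub>L 'a" and x assume B: "comm B"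
    have "B (h x) = half_line_integral (\<lambda>s. B (- duhamel l (r * s) x))"
      unfolding h_def by (rule half_line_integral_linear[OF D blinfun.bounded_linear_right, symmetric])
    then show "B (Blinfun h x) = Blinfun h (B x)"
      unfolding h h_def by (simp add: blinfun.minus_right duhamel_comm[OF B])
  qed
  have e_cont: "continuous_on S e" for S unfolding e_def by (intro continuous_intros)
  have "norm (e s) \<le> 1 * (1 + s)" if "0 \<le> s" for s
    using that r l by (simp add: e_def mult_nonneg_nonneg order_trans[of _ 1])
  then have e: "linear_growth e" using e_cont unfolding linear_growth_def by blast
  have k: "half_line_integral e = k"
    unfolding k_def by (intro half_line_integral_complex e borel_measurable_continuous_onI e_cont)
  have "(h x, l *\<^sub>C h x - (k *\<^sub>C x - subordinate r x)) \<in> A" for x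
  proof -
    let ?d = "\<lambda>s. - duhamel l (r * s) x"
    have e': "linear_growth (\<lambda>s. - (e s *\<^sub>C x))" "half_line_integral (\<lambda>s. - (e s *\<^sub>C x)) = - (k *\<^sub>C x)"
      using linear_growth_linear[OF e bounded_linear_minus[OF scaleC.bounded_linear_left]]
        half_line_integral_linear[OF e bounded_linear_minus[OF scaleC.bounded_linear_left]] k by auto
    have ld: "linear_growth (\<lambda>s. (1 + l) *\<^sub>C ?d s)" "half_line_integral (\<lambda>s. (1 + l) *\<^sub>C ?d s) = (1 + l) *\<^sub>C h x"
      unfolding h_def
      by (rule linear_growth_linear[OF D scaleC.bounded_linear_right] half_line_integral_linear[OF D scaleC.bounded_linear_right])+
    note sum1 = linear_growth_add[OF ld(1) e'(1)] and eq1 = half_line_integral_add[OF ld(1) e'(1)]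
    note sum2 = linear_growth_add[OF sum1 linear_growth_T[OF r, of x]]
      and eq2 = half_line_integral_add[OF sum1 linear_growth_T[OF r, of x]]
    \<comment> \<open>The relation for \<open>A\<close> is rewritten as an equation with the bounded
      operator (1 + A)^-1, which commutes with the integral; afterwards it is read backwards. The 1
      in \<open>1 + l\<close> is this shift.\<close>
    have "?d s = Res 1 ((1 + l) *\<^sub>C ?d s + - (e s *\<^sub>C x) + T (r * s) x)" if "0 \<le> s" for s
      using Res_eq[OF _ duhamel_A[of "r * s" l x], of 1] that r
      by (simp add: scaleC_add_left scaleC_one e_def algebra_simps)
    then have "h x = half_line_integral (\<lambda>s. Res 1 ((1 + l) *\<^sub>C ?d s + - (e s *\<^sub>C x) + T (r * s) x))"
      unfolding h_def by (rule half_line_integral_cong)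
    also have "\<dots> = Res 1 ((1 + l) *\<^sub>C h x + - (k *\<^sub>C x) + subordinate r x)"
      using half_line_integral_linear[OF sum2 blinfun.bounded_linear_right[of "Res 1"]] eq1 eq2 e'(2) ld(2)
      by (simp add: subordinate_apply[OF r])
    finally have hx: "h x = Res 1 ((1 + l) *\<^sub>C h x + - (k *\<^sub>C x) + subordinate r x)" .
    have "(h x, (1 + l) *\<^sub>C h x + - (k *\<^sub>C x) + subordinate r x - h x) \<in> A"
      using Res_A[of 1 "(1 + l) *\<^sub>C h x + - (k *\<^sub>C x) + subordinate r x"] unfolding hx[symmetric] by simp
    then show ?thesis by (simp add: scaleC_add_left scaleC_one algebra_simps)
  qed
  then have "div_diff l (subordinate r) k (Blinfun h)"
    by (simp add: div_diff_def bicomm_subordinate[OF r] bi h)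
  then show ?thesis using that unfolding k_def e_def by blast
qed

end

section \<open>Bernstein's theorem\<close>

text \<open>Carries sign conditions on real derivatives over to the Taylor coefficients of the
  holomorphic extension at real points.\<close>

lemma deriv_of_real_extension:
  assumes holo: "g holomorphic_on {z. 0 < Re z}" and eq: "\<And>x. x > 0 \<Longrightarrow> g (of_real x) = of_real (h x)"
    and diff: "\<And>x. x > 0 \<Longrightarrow> h differentiable (at x)" and x: "x > 0"
  shows "deriv g (of_real x) = of_real (deriv h x)"
proof -
  have "(g has_field_derivative deriv g (of_real x)) (at (of_real x))"
    using x by (intro holomorphic_derivI[OF holo]) (auto simp: open_halfspace_Re_gt)
  then have "((\<lambda>x. g (of_real x)) has_vector_derivative deriv g (of_real x)) (at x)"
    by (rule has_vector_derivative_real_field)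
  then have 1: "((\<lambda>x. complex_of_real (h x)) has_vector_derivative deriv g (of_real x)) (at x)"
    by (rule has_vector_derivative_transform_within_open[where S="{0<..}"]) (use x eq in auto)
  have "(h has_vector_derivative deriv h x) (at x)"
    using diff[OF x] by (simp add: DERIV_deriv_iff_real_differentiable flip: has_real_derivative_iff_has_vector_derivative)
  then have "((\<lambda>x. complex_of_real (h x)) has_vector_derivative of_real (deriv h x)) (at x)"
    by (rule bounded_linear.has_vector_derivative[OF bounded_linear_of_real])
  then show ?thesis using 1 vector_derivative_unique_at by blast
qed

text \<open>The factor in u^k - v^k is dominated by a full geometric series in |u|, so the bound
  does not depend on \<open>k\<close>.\<close>

lemma norm_power_diff_le:
  fixes u v :: complex
  assumes "cmod u < 1" "cmod v \<le> 1"
  shows "cmod (u ^ k - v ^ k) \<le> cmod (u - v) / (1 - cmod u)"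
proof -
  have "cmod (\<Sum>i<k. v ^ (k - Suc i) * u ^ i) \<le> (\<Sum>i<k. cmod u ^ i)"
  proof (rule sum_norm_le)
    fix i
    have "cmod v ^ (k - Suc i) * cmod u ^ i \<le> 1 * cmod u ^ i"
      using assms by (intro mult_right_mono power_le_one) auto
    then show "cmod (v ^ (k - Suc i) * u ^ i) \<le> cmod u ^ i" by (simp add: norm_mult norm_power)
  qed
  also have "\<dots> \<le> (\<Sum>i. cmod u ^ i)"
    using assms by (intro sum_le_suminf summable_geometric) auto
  also have "\<dots> = 1 / (1 - cmod u)" using assms by (intro suminf_geometric) auto
  finally have "cmod (u - v) * cmod (\<Sum>i<k. v ^ (k - Suc i) * u ^ i) \<le> cmod (u - v) * (1 / (1 - cmod u))"
    by (rule mult_left_mono) simp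
  then show ?thesis by (simp add: power_diff_sumr2 norm_mult)
qed

text \<open>With w = z/a this compares exp(-w)^k with (1 - w)^k uniformly in \<open>k\<close>. The
  assumptions give |w|^2 \<le> Re w, hence |1 - w| \<le> 1. In the constant, 3 bounds exp(Re w) in
  the Taylor remainder and 2 comes from 1 - exp(- Re w) \<ge> Re w / 2.\<close>

lemma exp_power_approx:
  fixes z :: complex
  assumes z: "0 < Re z" and a: "1 \<le> a" "cmod z ^ 2 \<le> a * Re z" "cmod z \<le> a"
  shows "cmod (exp (- z * of_real (real k / a)) - (1 - z / of_real a) ^ k) \<le> 6 * cmod z ^ 2 / (Re z * a)"
proof -
  define w where "w = z / of_real a"
  have a0: "a > 0" using a by simp
  have Re_w: "Re w = Re z / a" "cmod w = cmod z / a" using a0 by (simp_all add: w_def norm_divide)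
  have w1: "cmod w \<le> 1" "0 < Re w" using a z a0 by (simp_all add: Re_w)
  have Re_le: "Re w \<le> 1" using complex_Re_le_cmod[of w] w1 by linarith
  have "cmod (1 - w) ^ 2 = 1 - 2 * Re w + cmod w ^ 2"
    by (simp only: cmod_power2) (simp add: power2_eq_square algebra_simps)
  also have "cmod w ^ 2 \<le> Re w" using a a0 by (simp add: Re_w power_divide power2_eq_square field_simps)
  finally have "cmod (1 - w) ^ 2 \<le> 1 ^ 2" using w1 by simp
  then have v: "cmod (1 - w) \<le> 1" by (rule power2_le_imp_le) simp
  have e: "exp (- Re w) \<le> 1 - Re w / 2"
  proof -
    have "1 \<le> (1 - Re w / 2) * (1 + Re w)" using w1 Re_le by (simp add: algebra_simps power2_eq_square mult_left_le)
    also have "\<dots> \<le> (1 - Re w / 2) * exp (Re w)" using Re_le by (intro mult_left_mono exp_ge_add_one_self) auto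
    finally show ?thesis by (simp add: exp_minus field_simps)
  qed
  have u: "cmod (exp (- w)) < 1" using w1 by simp
  have "cmod (exp (- w) - (\<Sum>k\<le>1. (- w) ^ k / fact k)) \<le> exp \<bar>Re (- w)\<bar> * cmod (- w) ^ Suc 1 / fact 1"
    by (rule Taylor_exp)
  then have "cmod (exp (- w) - (1 - w)) \<le> exp (Re w) * cmod w ^ 2"
    using w1 by (simp add: power2_eq_square)
  also have "\<dots> \<le> 3 * cmod w ^ 2"
    using Re_le exp_le by (intro mult_right_mono order_trans[OF _ exp_le]) auto
  finally have d: "cmod (exp (- w) - (1 - w)) \<le> 3 * cmod w ^ 2" .
  have "cmod (exp (- w) ^ k - (1 - w) ^ k) \<le> cmod (exp (- w) - (1 - w)) / (1 - cmod (exp (- w)))"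
    by (rule norm_power_diff_le[OF u v])
  also have "\<dots> \<le> 3 * cmod w ^ 2 / (Re w / 2)"
    using d e w1 by (intro frac_le) auto
  also have "\<dots> = 6 * cmod z ^ 2 / (Re z * a)"
    using a0 z by (simp add: Re_w power_divide power2_eq_square field_simps)
  also have "exp (- w) ^ k = exp (- z * of_real (real k / a))"
    by (simp add: w_def algebra_simps flip: exp_of_nat_mult)
  finally show ?thesis by (simp add: w_def)
qed

text \<open>The image under \<open>x\<close> of the measure on the naturals with weights
  \<open>p\<close>; boundedness of \<open>g\<close> makes the series absolutely convergent.\<close>

lemma real_distribution_discrete:
  fixes p :: "nat \<Rightarrow> real"
  assumes p: "\<And>k. 0 \<le> p k" "p sums 1"
  shows "\<exists>N. real_distribution N \<and> (\<forall>(g :: real \<Rightarrow> complex) B. g \<in> borel_measurable borel \<longrightarrow>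
    (\<forall>x. norm (g x) \<le> B) \<longrightarrow> (\<lambda>k. p k * g (x k)) sums (LINT s|N. g s))"
proof -
  define D where "D = density (count_space UNIV) (\<lambda>k. ennreal (p k))"
  have "emeasure D UNIV = (\<Sum>k. ennreal (p k))"
    unfolding D_def by (subst emeasure_density) (auto simp: nn_integral_count_space_nat)
  also have "\<dots> = ennreal (suminf p)" using p by (intro suminf_ennreal2) (auto simp: sums_iff)
  also have "\<dots> = 1" using p(2) by (simp add: sums_iff)
  finally have "prob_space D" by (intro prob_spaceI) (simp add: D_def)
  then interpret D: prob_space D .
  have x: "x \<in> measurable D borel" by (simp add: D_def)
  have "real_distribution (distr D borel x)"
    using D.prob_space_distr[OF x] by (simp add: real_distribution_def real_distribution_axioms_def)
  moreover have "(\<lambda>k. p k * g (x k)) sums (LINT s|distr D borel x. g s)"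
    if g: "g \<in> borel_measurable borel" "\<forall>x. norm (g x) \<le> B" for g :: "real \<Rightarrow> complex" and B
  proof -
    have "(LINT s|distr D borel x. g s) = (LINT k|D. g (x k))"
      by (rule integral_distr[OF x g(1)])
    also have "\<dots> = (LINT k|count_space UNIV. p k *\<^sub>R g (x k))"
      unfolding D_def using p by (intro integral_density) auto
    finally have "(LINT s|distr D borel x. g s) = (LINT k|count_space UNIV. p k * g (x k))"
      by (simp add: scaleR_conv_of_real)
    moreover have "summable (\<lambda>k. p k * B)" using p by (intro summable_mult2) (simp add: sums_iff)
    then have "summable (\<lambda>k. norm (p k * g (x k)))"
      by (rule summable_comparison_test[rotated]) (use p g in \<open>auto simp: norm_mult intro!: mult_left_mono\<close>)
    then have "integrable (count_space UNIV) (\<lambda>k. p k * g (x k))"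
      by (simp add: integrable_count_space_nat_iff)
    ultimately show ?thesis using sums_integral_count_space_nat by metis
  qed
  ultimately show ?thesis by blast
qed

text \<open>Expanding \<open>F\<close> at a point \<open>a\<close> far out on the real axis, \<open>F z = (\<Sum>k. p k * (1 - z / a)\<^sup>k)\<close>
  with \<open>p k \<ge> 0\<close>, exhibits it as almost the Laplace transform of the measure with mass \<open>p k\<close> at \<open>k / a\<close>.\<close>

lemma laplace_representation:
  fixes F :: "complex \<Rightarrow> complex"
  assumes holo: "F holomorphic_on {z. 0 < Re z}"
    and cm: "\<And>k x. x > 0 \<Longrightarrow> \<exists>r\<ge>0. (deriv ^^ k) F (of_real x) = of_real ((- 1) ^ k * r)"
    and lim: "((\<lambda>x. F (of_real x)) \<longlongrightarrow> 1) (at_right 0)"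
    and le1: "\<And>x. x > 0 \<Longrightarrow> Re (F (of_real x)) \<le> 1"
  obtains \<nu> where "real_distribution \<nu>" "emeasure \<nu> {..<0} = 0"
    "\<And>z. 0 < Re z \<Longrightarrow> (LINT s|\<nu>. exp (- z * of_real s)) = F z"
proof -
  define G where "G x = Re (F (of_real x))" for x
  have F_real: "F (of_real x) = of_real (G x)" if "x > 0" for x
    using cm[OF that, of 0] by (auto simp: G_def)
  have G_lim: "(G \<longlongrightarrow> 1) (at_right 0)"
    using tendsto_Re[OF lim] by (simp add: G_def[abs_def])
  \<comment> \<open>Taylor coefficients at \<open>a\<close>, rescaled by (-a)^k to go with powers of
    1 - z/a. The alternating signs of the derivatives make them nonnegative.\<close>
  define p where "p a k = Re ((deriv ^^ k) F (of_real a) / fact k * (- of_real a) ^ k)" for a k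
  have p: "of_real (p a k) = (deriv ^^ k) F (of_real a) / fact k * (- of_real a) ^ k" "0 \<le> p a k"
    if a: "a > 0" for a k
  proof -
    obtain r where r: "r \<ge> 0" "(deriv ^^ k) F (of_real a) = of_real ((- 1) ^ k * r)" using cm[OF a] by blast
    have "(deriv ^^ k) F (of_real a) / fact k * (- of_real a) ^ k = of_real (((- 1) ^ k * r) / fact k * (- a) ^ k)"
      by (simp add: r(2))
    also have "((- 1) ^ k * r) / fact k * (- a) ^ k = r * ((- 1) ^ k * (- a) ^ k) / fact k"
      by (simp only: times_divide_eq_left times_divide_eq_right mult_ac)
    also have "(- 1) ^ k * (- a) ^ k = a ^ k" by (simp flip: power_mult_distrib)
    finally have *: "(deriv ^^ k) F (of_real a) / fact k * (- of_real a) ^ k = of_real (r * a ^ k / fact k)" .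
    have p_eq: "p a k = r * a ^ k / fact k" unfolding p_def * by (rule Re_complex_of_real)
    show "of_real (p a k) = (deriv ^^ k) F (of_real a) / fact k * (- of_real a) ^ k"
      by (simp only: p_eq *)
    show "0 \<le> p a k" using r a by (simp add: p_eq)
  qed
  have series: "(\<lambda>k. of_real (p a k) * (1 - z / of_real a) ^ k) sums F z" if a: "a > 0" and z: "cmod (of_real a - z) < a" for a z
  proof -
    have "ball (of_real a) a \<subseteq> {z. 0 < Re z}"
    proof
      fix w assume "w \<in> ball (complex_of_real a) a"
      then have "\<bar>Re (of_real a - w)\<bar> < a" using abs_Re_le_cmod[of "of_real a - w"] by (simp add: dist_norm)
      then show "w \<in> {z. 0 < Re z}" by simp
    qed
    then have "F holomorphic_on ball (of_real a) a" by (rule holomorphic_on_subset[OF holo])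
    then have "(\<lambda>k. (deriv ^^ k) F (of_real a) / fact k * (z - of_real a) ^ k) sums F z"
      using z by (intro holomorphic_power_series) (auto simp: dist_norm)
    also have "(\<lambda>k. (deriv ^^ k) F (of_real a) / fact k * (z - of_real a) ^ k)
        = (\<lambda>k. of_real (p a k) * (1 - z / of_real a) ^ k)"
    proof
      fix k
      have "z - of_real a = (- of_real a) * (1 - z / of_real a)" using a by (simp add: field_simps)
      then have "(z - of_real a) ^ k = (- of_real a) ^ k * (1 - z / of_real a) ^ k"
        by (simp only: power_mult_distrib)
      then show "(deriv ^^ k) F (of_real a) / fact k * (z - of_real a) ^ k = of_real (p a k) * (1 - z / of_real a) ^ k"
        by (simp only: p(1)[OF a] mult.assoc)
    qed
    finally show ?thesis .
  qed
  have real_series: "(\<lambda>k. p a k * (1 - x / a) ^ k) sums G x" if "0 < x" "x < a" for a x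
  proof -
    have "(\<lambda>k. of_real (p a k) * (1 - of_real x / of_real a) ^ k) sums F (of_real x)"
      using that by (intro series) (auto simp flip: of_real_diff)
    then have "(\<lambda>k. complex_of_real (p a k * (1 - x / a) ^ k)) sums of_real (G x)"
      using that by (simp add: F_real)
    then show ?thesis by (simp only: sums_of_real_iff)
  qed
  \<comment> \<open>The weights sum to the boundary value of \<open>F\<close> at 0: partial sums
    stay below 1 by letting x tend to 0 in F x \<le> 1, and the total dominates every F x.\<close>
  have p_sums: "p a sums 1" if a: "a > 0" for a
  proof -
    have partial: "(\<Sum>k<n. p a k) \<le> 1" for n
    proof (rule tendsto_upperbound)
      have "((\<lambda>x. \<Sum>k<n. p a k * (1 - x / a) ^ k) \<longlongrightarrow> (\<Sum>k<n. p a k * (1 - 0 / a) ^ k)) (at_right 0)"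
        using a by (intro tendsto_intros) auto
      then show "((\<lambda>x. \<Sum>k<n. p a k * (1 - x / a) ^ k) \<longlongrightarrow> (\<Sum>k<n. p a k)) (at_right 0)" by simp
      have "eventually (\<lambda>x. x \<in> {0<..<a}) (at_right 0)" using a by (rule eventually_at_right_real)
      then show "eventually (\<lambda>x. (\<Sum>k<n. p a k * (1 - x / a) ^ k) \<le> 1) (at_right 0)"
      proof eventually_elim
        case (elim x)
        have "(\<Sum>k<n. p a k * (1 - x / a) ^ k) \<le> G x"
          using real_series[of x a] elim p(2)[OF a]
            sum_le_suminf[of "\<lambda>k. p a k * (1 - x / a) ^ k" "{..<n}"]
          by (auto simp: sums_iff)
        also have "G x \<le> 1" using le1[of x] elim by (simp add: G_def)
        finally show ?case .
      qed
    qed simp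
    have sum: "summable (p a)"
      by (rule summableI_nonneg_bounded[of _ 1]) (use p(2)[OF a] partial in auto)
    have "suminf (p a) \<le> 1" by (rule suminf_le_const[OF sum partial])
    moreover have "1 \<le> suminf (p a)"
    proof (rule tendsto_upperbound[OF G_lim])
      have "eventually (\<lambda>x. x \<in> {0<..<a}) (at_right 0)" using a by (rule eventually_at_right_real)
      then show "eventually (\<lambda>x. G x \<le> suminf (p a)) (at_right 0)"
      proof eventually_elim
        case (elim x)
        have "p a k * (1 - x / a) ^ k \<le> p a k * 1" for k
          using elim p(2)[OF a] by (intro mult_left_mono power_le_one) auto
        then show ?case using real_series[of x a] elim by (intro sums_le[OF _ _ summable_sums[OF sum]]) auto
      qed
    qed simp
    ultimately show ?thesis using sum by (simp add: sums_iff)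
  qed
  define a where "a n = real (Suc n)" for n
  have a: "a n > 0" "a n \<ge> 1" for n by (simp_all add: a_def)
  have "\<exists>N. real_distribution N \<and> (\<forall>(g :: real \<Rightarrow> complex) B. g \<in> borel_measurable borel \<longrightarrow>
    (\<forall>x. norm (g x) \<le> B) \<longrightarrow> (\<lambda>k. p (a n) k * g (real k / a n)) sums (LINT s|N. g s))" for n
    by (rule real_distribution_discrete[OF p(2)[OF a(1)] p_sums[OF a(1)]])
  then obtain N where N: "\<And>n. real_distribution (N n)"
    and N_int: "\<And>n (g :: real \<Rightarrow> complex) B. g \<in> borel_measurable borel \<Longrightarrow> (\<And>x. norm (g x) \<le> B) \<Longrightarrow>
      (\<lambda>k. p (a n) k * g (real k / a n)) sums (LINT s|N n. g s)"
    by metis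
  \<comment> \<open>The modulus of \<open>s\<close> makes the kernel bounded and continuous on the
    whole line, as weak convergence demands; it is harmless since the discrete measures live on [0,
    \<infinity>).\<close>
  define E where "E z s = exp (- z * of_real \<bar>s\<bar>)" for z :: complex and s :: real
  have E_cont: "continuous_on S (E z)" for S z unfolding E_def by (intro continuous_intros)
  have E_meas [measurable]: "E z \<in> borel_measurable borel" for z
    by (rule borel_measurable_continuous_onI[OF E_cont])
  have E_le: "cmod (E z s) \<le> 1" if "0 < Re z" for z s using that by (simp add: E_def)
  have N_lim: "(\<lambda>n. LINT s|N n. E z s) \<longlonglongrightarrow> F z" if z: "0 < Re z" for z
  proof -
    have "(\<lambda>n. (LINT s|N n. E z s) - F z) \<longlonglongrightarrow> 0"
    proof (rule Lim_null_comparison)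
      have a_top: "filterlim a at_top sequentially"
        unfolding a_def by (rule filterlim_compose[OF filterlim_real_sequentially filterlim_Suc])
      have "eventually (\<lambda>n. a n > cmod z ^ 2 / Re z \<and> a n > cmod z) sequentially"
        using a_top by (auto simp: filterlim_at_top_dense intro: eventually_conj)
      then show "eventually (\<lambda>n. norm ((LINT s|N n. E z s) - F z) \<le> 6 * cmod z ^ 2 / (Re z * a n)) sequentially"
      proof eventually_elim
        case (elim n)
        have sq: "cmod z ^ 2 < a n * Re z" using elim z by (simp add: pos_divide_less_eq)
        have "cmod (of_real (a n) - z) ^ 2 = (a n)\<^sup>2 - 2 * a n * Re z + cmod z ^ 2"
          by (simp only: cmod_power2) (simp add: power2_eq_square algebra_simps)
        also have "\<dots> < (a n)\<^sup>2" using sq z a(1)[of n] mult_pos_pos[of "a n" "Re z"] by linarith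
        finally have "cmod (of_real (a n) - z) < a n" by (rule power2_less_imp_less) (simp add: less_imp_le a)
        then have 1: "(\<lambda>k. of_real (p (a n) k) * (1 - z / of_real (a n)) ^ k) sums F z"
          using a by (intro series)
        have 2: "(\<lambda>k. p (a n) k * E z (real k / a n)) sums (LINT s|N n. E z s)"
          by (rule N_int[OF E_meas E_le[OF z]])
        let ?\<delta> = "6 * cmod z ^ 2 / (Re z * a n)"
        have summand_le: "cmod (p (a n) k * E z (real k / a n) - of_real (p (a n) k) * (1 - z / of_real (a n)) ^ k) \<le> p (a n) k * ?\<delta>" for k
        proof -
          have "cmod (E z (real k / a n) - (1 - z / of_real (a n)) ^ k) \<le> ?\<delta>"
            using exp_power_approx[OF z a(2)[of n], of k] sq elim a(1)[of n] by (simp add: E_def)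
          then have "p (a n) k * cmod (E z (real k / a n) - (1 - z / of_real (a n)) ^ k) \<le> p (a n) k * ?\<delta>"
            using p(2)[OF a(1)] by (rule mult_left_mono)
          moreover have "p (a n) k * E z (real k / a n) - of_real (p (a n) k) * (1 - z / of_real (a n)) ^ k
              = of_real (p (a n) k) * (E z (real k / a n) - (1 - z / of_real (a n)) ^ k)"
            by (simp add: algebra_simps)
          ultimately show ?thesis using p(2)[OF a(1), of n k] by (simp add: norm_mult)
        qed
        have bound: "(\<lambda>k. p (a n) k * ?\<delta>) sums (1 * ?\<delta>)" by (intro sums_mult2 p_sums a)
        have "norm (\<Sum>k. p (a n) k * E z (real k / a n) - of_real (p (a n) k) * (1 - z / of_real (a n)) ^ k) \<le> (\<Sum>k. p (a n) k * ?\<delta>)"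
          by (rule norm_suminf_le[OF summand_le]) (use bound in \<open>simp add: sums_iff\<close>)
        then show ?case using sums_diff[OF 2 1] bound by (simp add: sums_iff)
      qed
      have "filterlim (\<lambda>n. Re z * a n) at_top sequentially"
        by (rule filterlim_tendsto_pos_mult_at_top[OF tendsto_const z a_top])
      then show "(\<lambda>n. 6 * cmod z ^ 2 / (Re z * a n)) \<longlonglongrightarrow> 0"
        by (intro tendsto_divide_0[OF tendsto_const] filterlim_at_top_imp_at_infinity)
    qed
    then show ?thesis by (simp add: LIM_zero_iff)
  qed
  \<comment> \<open>Choose x with F x > 1 - \<epsilon>/2. As 1 - u \<le> exp(-u), all discrete
    transforms at x are at least F x. Outside (-1/x, 1/x] the kernel is at most exp(-1) \<le> 1/2,
    so 1 - 2 (1 - exp(-x |s|)) minorizes the indicator and has integral above 1 -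
    \<epsilon>.\<close>
  have "tight N"
    unfolding tight_def
  proof (intro conjI allI impI N)
    fix \<epsilon> :: real assume \<epsilon>: "\<epsilon> > 0"
    have "eventually (\<lambda>x. G x > 1 - \<epsilon> / 2 \<and> x \<in> {0<..<1}) (at_right 0)"
      using \<epsilon> by (intro eventually_conj order_tendstoD(1)[OF G_lim] eventually_at_right_real) auto
    then obtain x where x: "G x > 1 - \<epsilon> / 2" "0 < x" "x < 1"
      using eventually_happens'[of "at_right (0::real)"] by (auto simp: trivial_limit_at_right_real)
    define R where "R = 1 / x"
    have "measure (N n) {- R<..R} > 1 - \<epsilon>" for n
    proof -
      interpret N: real_distribution "N n" by (rule N)
      have xa: "0 < x" "x < a n" using x a(2)[of n] by auto
      have int: "integrable (N n) (\<lambda>s. exp (- x * \<bar>s\<bar>))"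
        by (rule N.integrable_const_bound[of _ 1]) (use x in auto)
      have E_real: "E (of_real x) s = complex_of_real (exp (- x * \<bar>s\<bar>))" for s
        by (simp add: E_def flip: exp_of_real)
      have "(\<lambda>k. p (a n) k * E (of_real x) (real k / a n)) sums (LINT s|N n. E (of_real x) s)"
        by (rule N_int[OF E_meas E_le]) (use x in simp)
      then have "(\<lambda>k. complex_of_real (p (a n) k * exp (- x * (real k / a n)))) sums (LINT s|N n. E (of_real x) s)"
        unfolding E_real using a(1)[of n] by simp
      also have "(LINT s|N n. E (of_real x) s) = of_real (LINT s|N n. exp (- x * \<bar>s\<bar>))"
        unfolding E_real by (rule integral_complex_of_real)
      finally have exp_sums: "(\<lambda>k. p (a n) k * exp (- x * (real k / a n))) sums (LINT s|N n. exp (- x * \<bar>s\<bar>))"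
        by (simp only: sums_of_real_iff)
      have summand_le: "p (a n) k * (1 - x / a n) ^ k \<le> p (a n) k * exp (- x * (real k / a n))" for k
      proof -
        have "1 - x / a n \<le> exp (- (x / a n))" using exp_ge_add_one_self[of "- (x / a n)"] by simp
        then have "(1 - x / a n) ^ k \<le> exp (- (x / a n)) ^ k" using xa by (intro power_mono) auto
        also have "\<dots> = exp (- x * (real k / a n))" by (simp add: algebra_simps flip: exp_of_nat_mult)
        finally show ?thesis using p(2)[OF a(1)] by (rule mult_left_mono)
      qed
      have L: "G x \<le> (LINT s|N n. exp (- x * \<bar>s\<bar>))"
        by (rule sums_le[OF summand_le real_series[OF xa] exp_sums])
      have "1 - 2 * (1 - (LINT s|N n. exp (- x * \<bar>s\<bar>))) = (LINT s|N n. 1 - 2 * (1 - exp (- x * \<bar>s\<bar>)))"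
        using int N.prob_space by simp
      also have "\<dots> \<le> (LINT s|N n. indicator {- R<..R} s)"
      proof (rule integral_mono)
        fix s
        show "1 - 2 * (1 - exp (- x * \<bar>s\<bar>)) \<le> indicator {- R<..R} s"
        proof (cases "s \<in> {- R<..R}")
          case False
          then have "\<bar>s\<bar> \<ge> R" by auto
          then have "x * \<bar>s\<bar> \<ge> 1" using x by (simp add: R_def field_simps)
          then have "exp (- x * \<bar>s\<bar>) \<le> exp (- 1)" by simp
          moreover have "exp (- 1 :: real) \<le> 1 / 2" using exp_ge_add_one_self[of "1 :: real"] by (simp add: exp_minus field_simps)
          ultimately have "exp (- x * \<bar>s\<bar>) \<le> 1 / 2" by (rule order_trans)
          then show ?thesis using False by simp
        qed (use x in simp)
        show "integrable (N n) (indicat_real {- R<..R})"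
          by (rule N.integrable_const_bound[of _ 1]) (auto simp: indicator_def)
      qed (use int in simp)
      also have "\<dots> = measure (N n) {- R<..R}" by simp
      finally show ?thesis using L x(1) by simp
    qed
    moreover have "- R < R" using x by (simp add: R_def)
    ultimately show "\<exists>a b. a < b \<and> (\<forall>n. 1 - \<epsilon> < measure (N n) {a<..b})" by blast
  qed
  from tight_imp_convergent_subsubsequence[OF this strict_mono_id]
  obtain r \<nu> where r: "strict_mono r" and \<nu>: "real_distribution \<nu>" and conv: "weak_conv_m (N \<circ> r) \<nu>"
    by (auto simp: o_def id_def)
  interpret \<nu>: real_distribution \<nu> by (rule \<nu>)
  have weak: "(\<lambda>n. LINT s|(N \<circ> r) n. g s) \<longlonglongrightarrow> (LINT s|\<nu>. g s)"
    if "\<And>x. isCont g x" "\<And>x. norm (g x) \<le> B" for g :: "real \<Rightarrow> complex" and B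
    using weak_conv_imp_integral_bdd_continuous_conv[of "N \<circ> r" \<nu> g B] N \<nu> conv that by (simp add: o_def)
  have E_int: "(LINT s|\<nu>. E z s) = F z" if z: "0 < Re z" for z
  proof (rule LIMSEQ_unique)
    show "(\<lambda>n. LINT s|(N \<circ> r) n. E z s) \<longlonglongrightarrow> (LINT s|\<nu>. E z s)"
      using E_cont[of UNIV z] E_le[OF z] by (intro weak) (auto simp: continuous_on_eq_continuous_at)
    show "(\<lambda>n. LINT s|(N \<circ> r) n. E z s) \<longlonglongrightarrow> F z"
      using LIMSEQ_subseq_LIMSEQ[OF N_lim[OF z] r] by (simp add: o_def)
  qed
  \<comment> \<open>A bounded continuous function that is positive exactly on the negative axis; its
    integrals vanish along the sequence, hence also in the limit.\<close>
  define h where "h s = complex_of_real (min (max (- s) 0) 1)" for s :: real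
  have h_cont: "continuous_on UNIV h" unfolding h_def by (intro continuous_intros)
  have "(LINT s|N n. h s) = 0" for n
  proof -
    have "(\<lambda>k. p (a n) k * h (real k / a n)) sums (LINT s|N n. h s)"
      by (rule N_int[of _ 1]) (auto intro!: borel_measurable_continuous_onI h_cont simp: h_def)
    moreover have "h (real k / a n) = 0" for k using a(1)[of n] by (simp add: h_def max_def)
    ultimately show ?thesis by (simp add: sums_iff)
  qed
  moreover have "(\<lambda>n. LINT s|(N \<circ> r) n. h s) \<longlonglongrightarrow> (LINT s|\<nu>. h s)"
    using h_cont by (intro weak[of _ 1]) (auto simp: continuous_on_eq_continuous_at h_def)
  ultimately have "(LINT s|\<nu>. h s) = 0" using LIMSEQ_unique[OF _ tendsto_const] by (simp add: o_def LIMSEQ_const_iff)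
  then have h0: "(LINT s|\<nu>. min (max (- s) 0) 1) = 0"
    unfolding h_def by simp
  have "integrable \<nu> (\<lambda>s. min (max (- s) 0) 1)"
    by (rule \<nu>.integrable_const_bound[of _ 1]) auto
  then have "AE s in \<nu>. min (max (- s) 0) 1 = 0"
    using h0 by (subst (asm) integral_nonneg_eq_0_iff_AE) auto
  then have AE: "AE s in \<nu>. 0 \<le> s" by eventually_elim (auto simp: min_def max_def split: if_splits)
  then have "emeasure \<nu> {..<0} = 0"
    by (subst (asm) AE_iff_measurable[of "{..<0}"]) auto
  moreover have "(LINT s|\<nu>. exp (- z * of_real s)) = F z" if "0 < Re z" for z
  proof -
    have "(LINT s|\<nu>. exp (- z * of_real s)) = (LINT s|\<nu>. E z s)"
      using AE by (intro integral_cong_AE) (auto simp: E_def)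
    then show ?thesis using E_int[OF that] by simp
  qed
  ultimately show ?thesis using that \<nu> by blast
qed

section \<open>Bernstein functions\<close>

text \<open>Replaces a mean value argument with endpoint 0, where only the right limit of the
  function is known.\<close>

lemma le_right_limit_of_deriv_nonpos:
  fixes g :: "real \<Rightarrow> real"
  assumes deriv: "\<And>x. 0 < x \<Longrightarrow> x \<le> b \<Longrightarrow> (g has_real_derivative g' x) (at x)"
    and nonpos: "\<And>x. 0 < x \<Longrightarrow> x \<le> b \<Longrightarrow> g' x \<le> 0"
    and lim: "(g \<longlongrightarrow> L) (at_right 0)" and x: "0 < x" "x \<le> b"
  shows "g x \<le> L"
proof (rule tendsto_lowerbound[OF lim])
  have "eventually (\<lambda>u. u \<in> {0<..<x}) (at_right 0)" using x(1) by (rule eventually_at_right_real)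
  then show "eventually (\<lambda>u. g x \<le> g u) (at_right 0)"
  proof eventually_elim
    case (elim u)
    show ?case
    proof (rule DERIV_nonpos_imp_nonincreasing[where a=u and b=x and f=g])
      show "u \<le> x" using elim by simp
      fix z assume "u \<le> z" "z \<le> x"
      then show "\<exists>y. (g has_real_derivative y) (at z) \<and> y \<le> 0"
        using deriv[of z] nonpos[of z] elim x by auto
    qed
  qed
qed simp

text \<open>Half-angle formula together with sin v \<ge> v/2 on [0, 1], the latter because cos
  exceeds cos(\<pi>/3) = 1/2 there.\<close>

lemma one_minus_cos_ge:
  fixes u :: real
  assumes "\<bar>u\<bar> \<le> 1"
  shows "u\<^sup>2 / 8 \<le> 1 - cos u"
proof -
  have sin_ge: "v / 2 \<le> sin v" if "0 \<le> v" "v \<le> 1" for v :: real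
  proof -
    have "sin 0 - 0 / 2 \<le> sin v - v / 2"
    proof (rule DERIV_nonneg_imp_nondecreasing[OF that(1)])
      fix z :: real assume z: "0 \<le> z" "z \<le> v"
      have "cos (pi / 3) \<le> cos z"
        using z that pi_gt3 by (intro cos_monotone_0_pi_le) auto
      then have "0 \<le> cos z - 1 / 2" by (simp add: cos_60)
      then show "\<exists>y. ((\<lambda>v. sin v - v / 2) has_real_derivative y) (at z) \<and> 0 \<le> y"
        by (intro exI[of _ "cos z - 1 / 2"]) (auto intro!: derivative_eq_intros)
    qed
    then show ?thesis by simp
  qed
  have "(\<bar>u\<bar> / 4)\<^sup>2 \<le> (sin (\<bar>u\<bar> / 2))\<^sup>2"
    using sin_ge[of "\<bar>u\<bar> / 2"] assms by (intro power_mono) auto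
  moreover have "1 - cos \<bar>u\<bar> = 2 * (sin (\<bar>u\<bar> / 2))\<^sup>2"
    using cos_double_sin[of "\<bar>u\<bar> / 2"] by simp
  ultimately show ?thesis by (simp add: power_divide)
qed

locale Phi_function =
  fixes \<phi> :: "complex \<Rightarrow> complex" and f :: "real \<Rightarrow> real"
  assumes ext: "bernstein_extension f \<phi>" and \<phi>_0: "\<phi> 0 = 0"
    and f'_lim: "(deriv f \<longlongrightarrow> 1) (at_right 0)"
begin

section \<open>Derivatives of \<phi> and of exp(-\<tau> \<phi>) on the positive axis\<close>

lemma \<phi>_of_real: "0 < x \<Longrightarrow> \<phi> (of_real x) = of_real (f x)"
  and holo: "\<phi> holomorphic_on {z. 0 < Re z}"
  and cont: "continuous_on {z. 0 \<le> Re z} \<phi>"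
  and f_nonneg: "0 < x \<Longrightarrow> 0 \<le> f x"
  and f_smooth: "0 < x \<Longrightarrow> (deriv ^^ n) f differentiable (at x)"
  using ext by (auto simp: bernstein_extension_def bernstein_def smooth_pos_def)

lemma deriv_sign: "0 < x \<Longrightarrow> 0 \<le> (- 1) ^ n * (deriv ^^ Suc n) f x"
  using ext by (auto simp: bernstein_extension_def bernstein_def completely_monotone_def funpow_Suc_right
      simp del: funpow.simps)

lemma has_deriv: "0 < x \<Longrightarrow> ((deriv ^^ n) f has_real_derivative (deriv ^^ Suc n) f x) (at x)"
  using f_smooth[of x n] by (simp add: DERIV_deriv_iff_real_differentiable)

lemma higher_deriv_of_real: "0 < x \<Longrightarrow> (deriv ^^ k) \<phi> (of_real x) = of_real ((deriv ^^ k) f x)"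
proof (induction k arbitrary: x)
  case (Suc k)
  have "(deriv ^^ k) \<phi> holomorphic_on {z. 0 < Re z}"
    by (intro holomorphic_higher_deriv holo) (simp add: open_halfspace_Re_gt)
  then show ?case
    using deriv_of_real_extension[of "(deriv ^^ k) \<phi>" "(deriv ^^ k) f" x] Suc f_smooth by simp
qed (simp add: \<phi>_of_real)

text \<open>\<open>f\<close> is only constrained on the open half-line; its limit at 0 is inherited
  from the continuity of \<phi> on the closed half-plane.\<close>

lemma f_lim: "(f \<longlongrightarrow> 0) (at_right 0)"
proof -
  have "(\<phi> \<longlongrightarrow> \<phi> 0) (at 0 within {z. 0 \<le> Re z})"
    using cont by (simp add: continuous_on_def)
  moreover have "filterlim of_real (at 0 within {z. 0 \<le> Re z}) (at_right (0::real))"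
    unfolding filterlim_at by (auto intro!: tendsto_eq_intros simp: eventually_at_filter)
  ultimately have "((\<lambda>x. \<phi> (of_real x)) \<longlongrightarrow> 0) (at_right (0::real))"
    using filterlim_compose \<phi>_0 by fastforce
  then have "((\<lambda>x. Re (\<phi> (of_real x))) \<longlongrightarrow> 0) (at_right (0::real))" using tendsto_Re by fastforce
  then show ?thesis
    by (rule Lim_transform_eventually)
       (auto simp: eventually_at_filter \<phi>_of_real)
qed

text \<open>Complete monotonicity of exp(-\<tau> \<phi>). Strong induction on F' = -\<tau> \<phi>' F
  by the Leibniz rule: derivatives of \<phi>' and the lower derivatives of \<open>F\<close>
  alternate in sign, and the factor -\<tau> supplies the one missing sign.\<close>

lemma exp_higher_deriv:
  assumes "0 \<le> \<tau>" "0 < x"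
  shows "\<exists>r\<ge>0. (deriv ^^ k) (\<lambda>z. exp (- of_real \<tau> * \<phi> z)) (of_real x) = of_real ((- 1) ^ k * r)"
proof (induction k rule: less_induct)
  case (less k)
  define S where "S = {z. 0 < Re z}"
  have S: "open S" "of_real x \<in> S" using assms by (auto simp: S_def open_halfspace_Re_gt)
  note holoS = holo[folded S_def]
  define F where "F z = exp (- of_real \<tau> * \<phi> z)" for z
  define P where "P z = - of_real \<tau> * deriv \<phi> z" for z
  have F: "F holomorphic_on S" unfolding F_def by (intro holomorphic_intros holoS)
  have d\<phi>: "deriv \<phi> holomorphic_on S" by (intro holomorphic_deriv holoS S)
  then have P: "P holomorphic_on S"
    unfolding P_def by (intro holomorphic_on_mult holomorphic_on_const)
  show ?case
  proof (cases k)
    case 0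
    have "exp (- of_real \<tau> * \<phi> (of_real x)) = of_real (exp (- \<tau> * f x))"
      using assms by (simp add: \<phi>_of_real flip: exp_of_real)
    then show ?thesis using 0 by (intro exI[of _ "exp (- \<tau> * f x)"]) simp
  next
    case (Suc j)
    have dF: "deriv F z = P z * F z" if "z \<in> S" for z
    proof -
      have "(\<phi> has_field_derivative deriv \<phi> z) (at z)" using holomorphic_derivI[OF holoS S(1) that] .
      then have "(F has_field_derivative P z * F z) (at z)"
        unfolding F_def P_def by (auto intro!: derivative_eq_intros)
      then show ?thesis by (rule DERIV_imp_deriv)
    qed
    have P_deriv: "(deriv ^^ i) P (of_real x) = of_real (- \<tau> * (deriv ^^ Suc i) f x)" for i
    proof -
      have "(deriv ^^ i) P (of_real x) = - of_real \<tau> * (deriv ^^ i) (deriv \<phi>) (of_real x)"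
        unfolding P_def by (rule higher_deriv_cmult[OF d\<phi> S(2,1)])
      also have "(deriv ^^ i) (deriv \<phi>) (of_real x) = (deriv ^^ Suc i) \<phi> (of_real x)"
        by (simp add: funpow_swap1)
      finally show ?thesis using higher_deriv_of_real[OF assms(2), of "Suc i"] by simp
    qed
    obtain r where r: "\<And>i. i < k \<Longrightarrow> 0 \<le> r i" "\<And>i. i < k \<Longrightarrow> (deriv ^^ i) F (of_real x) = of_real ((- 1) ^ i * r i)"
      using less.IH unfolding F_def[abs_def, symmetric] by metis
    define q where "q i = (- 1) ^ i * (deriv ^^ Suc i) f x" for i
    have q: "0 \<le> q i" "(deriv ^^ Suc i) f x = (- 1) ^ i * q i" for i
      using deriv_sign[OF assms(2), of i] by (simp_all add: q_def flip: power_mult_distrib mult.assoc)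
    have "(deriv ^^ k) F (of_real x) = (deriv ^^ j) (deriv F) (of_real x)"
      by (simp add: Suc funpow_swap1)
    also have "\<dots> = (deriv ^^ j) (\<lambda>z. P z * F z) (of_real x)"
      by (rule higher_deriv_transform_within_open[OF _ _ S])
         (auto intro!: holomorphic_intros holomorphic_deriv F P S(1) dF)
    also have "\<dots> = (\<Sum>i = 0..j. of_nat (j choose i) * (deriv ^^ i) P (of_real x) * (deriv ^^ (j - i)) F (of_real x))"
      by (rule higher_deriv_mult[OF P F S])
    also have "\<dots> = (\<Sum>i = 0..j. of_real ((- 1) ^ k * (real (j choose i) * (\<tau> * q i) * r (j - i))))"
    proof (intro sum.cong refl)
      fix i assume "i \<in> {0..j}"
      then have ij: "j - i < k" "(- 1 :: real) ^ i * (- 1) ^ (j - i) = (- 1) ^ j"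
        using Suc by (auto simp flip: power_add)
      have "of_nat (j choose i) * (deriv ^^ i) P (of_real x) * (deriv ^^ (j - i)) F (of_real x)
          = of_real (real (j choose i) * (- \<tau> * ((- 1) ^ i * q i)) * ((- 1) ^ (j - i) * r (j - i)))"
        unfolding P_deriv q(2) r(2)[OF ij(1)] by simp
      also have "real (j choose i) * (- \<tau> * ((- 1) ^ i * q i)) * ((- 1) ^ (j - i) * r (j - i))
          = - ((- 1) ^ i * (- 1) ^ (j - i)) * (real (j choose i) * (\<tau> * q i) * r (j - i))"
        by (simp only: mult_minus_left mult_minus_right mult_ac)
      also have "\<dots> = (- 1) ^ k * (real (j choose i) * (\<tau> * q i) * r (j - i))"
        unfolding ij(2) Suc by simp
      finally show "of_nat (j choose i) * (deriv ^^ i) P (of_real x) * (deriv ^^ (j - i)) F (of_real x)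
          = of_real ((- 1) ^ k * (real (j choose i) * (\<tau> * q i) * r (j - i)))" .
    qed
    also have "\<dots> = of_real ((- 1) ^ k * (\<Sum>i = 0..j. real (j choose i) * (\<tau> * q i) * r (j - i)))"
      by (simp only: of_real_sum sum_distrib_left)
    finally show ?thesis
      unfolding F_def[abs_def] using assms(1) q(1) r(1) Suc
      by (intro exI[of _ "\<Sum>i = 0..j. real (j choose i) * (\<tau> * q i) * r (j - i)"])
         (auto intro!: sum_nonneg mult_nonneg_nonneg)
  qed
qed

text \<open>Literally the predicate under the definite description in
  \<open>subordination_measure\<close>.\<close>

definition is_subordinator :: "real measure \<Rightarrow> real \<Rightarrow> bool" where
  "is_subordinator \<nu> \<tau> \<longleftrightarrow> sets \<nu> = sets borel \<and> emeasure \<nu> {..<0} = 0 \<and> emeasure \<nu> UNIV \<le> 1 \<and>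
     (\<forall>z. 0 < Re z \<longrightarrow> (LINT s|\<nu>. exp (- z * of_real s)) = exp (- of_real \<tau> * \<phi> z))"

lemma subordinator_exists:
  assumes "0 \<le> \<tau>"
  shows "\<exists>\<nu>. is_subordinator \<nu> \<tau>"
proof -
  define F where "F z = exp (- of_real \<tau> * \<phi> z)" for z
  have F_real: "F (of_real x) = of_real (exp (- \<tau> * f x))" if "0 < x" for x
    using that by (simp add: F_def \<phi>_of_real flip: exp_of_real)
  have "((\<lambda>x. complex_of_real (exp (- \<tau> * f x))) \<longlongrightarrow> of_real (exp (- \<tau> * 0))) (at_right 0)"
    by (intro tendsto_intros f_lim)
  then have lim: "((\<lambda>x. F (of_real x)) \<longlongrightarrow> 1) (at_right (0::real))"
    by (simp, elim Lim_transform_eventually) (auto simp: eventually_at_filter F_real)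
  have hol: "F holomorphic_on {z. 0 < Re z}" unfolding F_def by (intro holomorphic_intros holo)
  have le: "Re (F (of_real x)) \<le> 1" if "0 < x" for x
    using F_real[OF that] assms f_nonneg[OF that] by simp
  obtain \<nu> where \<nu>: "real_distribution \<nu>" "emeasure \<nu> {..<0} = 0"
    "\<And>z. 0 < Re z \<Longrightarrow> (LINT s|\<nu>. exp (- z * of_real s)) = F z"
    using laplace_representation[OF hol _ lim le] exp_higher_deriv[OF assms] unfolding F_def by metis
  interpret real_distribution \<nu> by fact
  have "emeasure \<nu> UNIV \<le> 1" using emeasure_space_1 by simp
  then have "is_subordinator \<nu> \<tau>"
    unfolding is_subordinator_def using \<nu>(2,3) by (simp only: F_def events_eq_borel) blast
  then show ?thesis ..
qed

lemma subordinator_facts: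
  assumes "is_subordinator \<nu> \<tau>"
  shows "sets \<nu> = sets borel" "space \<nu> = UNIV" "finite_measure \<nu>" "AE s in \<nu>. 0 \<le> s"
proof -
  show sets: "sets \<nu> = sets borel" using assms by (simp add: is_subordinator_def)
  show space: "space \<nu> = UNIV" using sets_eq_imp_space_eq[OF sets] by simp
  show "finite_measure \<nu>"
    using assms by (intro finite_measureI) (auto simp: is_subordinator_def space top_unique)
  show "AE s in \<nu>. 0 \<le> s"
    using assms by (intro AE_I[of _ _ "{..<0}"]) (auto simp: is_subordinator_def)
qed

section \<open>Boundary values, uniqueness and first moment of the subordination measures\<close>

lemma subordinator_closed_half_plane:
  assumes \<nu>: "is_subordinator \<nu> \<tau>" and z: "0 \<le> Re z"
  shows "(LINT s|\<nu>. exp (- z * of_real s)) = exp (- of_real \<tau> * \<phi> z)"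
proof (rule LIMSEQ_unique)
  note [measurable_cong] = subordinator_facts(1)[OF \<nu>]
  interpret finite_measure \<nu> by (rule subordinator_facts[OF \<nu>])
  note AE = subordinator_facts(4)[OF \<nu>]
  define w where "w n = z + of_real (inverse (real (Suc n)))" for n
  have w: "0 < Re (w n)" for n using z by (simp add: w_def add_nonneg_pos)
  have "(\<lambda>n. complex_of_real (inverse (real (Suc n)))) \<longlonglongrightarrow> of_real 0"
    by (intro tendsto_of_real LIMSEQ_inverse_real_of_nat)
  then have w_lim: "w \<longlonglongrightarrow> z" unfolding w_def[abs_def] using tendsto_add[OF tendsto_const] by fastforce
  show "(\<lambda>n. LINT s|\<nu>. exp (- w n * of_real s)) \<longlonglongrightarrow> (LINT s|\<nu>. exp (- z * of_real s))"
  proof (rule integral_dominated_convergence[where w="\<lambda>_. 1"])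
    show "AE s in \<nu>. (\<lambda>n. exp (- w n * of_real s)) \<longlonglongrightarrow> exp (- z * of_real s)"
      by (intro AE_I2 tendsto_intros w_lim)
    show "AE s in \<nu>. norm (exp (- w n * of_real s)) \<le> 1" for n
      using AE by eventually_elim (use w[of n] in \<open>simp add: less_imp_le\<close>)
  qed auto
  have "(\<lambda>n. LINT s|\<nu>. exp (- w n * of_real s)) = (\<lambda>n. exp (- of_real \<tau> * \<phi> (w n)))"
    using \<nu> w by (auto simp: is_subordinator_def)
  moreover have "(\<lambda>n. \<phi> (w n)) \<longlonglongrightarrow> \<phi> z"
    by (rule continuous_on_tendsto_compose[OF cont w_lim]) (use z w in \<open>auto simp: less_imp_le\<close>)
  then have "(\<lambda>n. exp (- of_real \<tau> * \<phi> (w n))) \<longlonglongrightarrow> exp (- of_real \<tau> * \<phi> z)"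
    by (intro tendsto_intros)
  ultimately show "(\<lambda>n. LINT s|\<nu>. exp (- w n * of_real s)) \<longlonglongrightarrow> exp (- of_real \<tau> * \<phi> z)" by simp
qed

text \<open>The defining property allows mass below 1; evaluating the transform at z = 0, where
  \<phi> vanishes, shows that it is exactly 1.\<close>

lemma subordinator_real_distribution:
  assumes \<nu>: "is_subordinator \<nu> \<tau>"
  shows "real_distribution \<nu>"
proof -
  interpret finite_measure \<nu> by (rule subordinator_facts[OF \<nu>])
  have "complex_of_real (measure \<nu> (space \<nu>)) = 1"
    using subordinator_closed_half_plane[OF \<nu>, of 0] by (simp add: \<phi>_0 scaleR_conv_of_real)
  then have "measure \<nu> (space \<nu>) = 1" by simp
  then have "prob_space \<nu>" by (intro prob_spaceI) (simp add: emeasure_eq_measure)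
  then show ?thesis using subordinator_facts[OF \<nu>] by (simp add: real_distribution_def real_distribution_axioms_def)
qed

text \<open>On the imaginary axis the Laplace transform is the characteristic function.\<close>

lemma subordinator_unique:
  assumes "is_subordinator \<nu> \<tau>" "is_subordinator \<nu>' \<tau>"
  shows "\<nu> = \<nu>'"
proof (rule Levy_uniqueness)
  show "char \<nu> = char \<nu>'"
  proof
    fix u
    have "char \<mu> u = exp (- of_real \<tau> * \<phi> (- \<i> * of_real u))" if "is_subordinator \<mu> \<tau>" for \<mu>
      using subordinator_closed_half_plane[OF that, of "- \<i> * of_real u"] by (simp add: char_def mult.assoc)
    then show "char \<nu> u = char \<nu>' u" using assms by simp
  qed
qed (use assms subordinator_real_distribution in auto)

lemma is_subordinator_subordination_measure:
  assumes "0 \<le> \<tau>"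
  shows "is_subordinator (subordination_measure \<phi> \<tau>) \<tau>"
proof -
  have "\<exists>!\<nu>. is_subordinator \<nu> \<tau>"
    using subordinator_exists[OF assms] subordinator_unique by blast
  from theI'[OF this] show ?thesis
    unfolding subordination_measure_def is_subordinator_def .
qed

lemma deriv_f_le_1: "0 < x \<Longrightarrow> deriv f x \<le> 1"
  using has_deriv[of _ 1] deriv_sign[of _ 1]
  by (intro le_right_limit_of_deriv_nonpos[of x "deriv f" "deriv (deriv f)", OF _ _ f'_lim]) auto

lemma f_le: "0 < x \<Longrightarrow> f x \<le> x"
proof -
  assume x: "0 < x"
  have "f x - x \<le> 0"
  proof (rule le_right_limit_of_deriv_nonpos[where g="\<lambda>x. f x - x" and b=x and g'="\<lambda>x. deriv f x - 1"])
    show "((\<lambda>x. f x - x) has_real_derivative deriv f u - 1) (at u)" if "0 < u" for u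
      using has_deriv[OF that, of 0] by (auto intro!: derivative_eq_intros)
    have "((\<lambda>x. f x - x) \<longlongrightarrow> 0 - 0) (at_right 0)" by (intro tendsto_intros f_lim)
    then show "((\<lambda>x. f x - x) \<longlongrightarrow> 0) (at_right 0)" by simp
  qed (use x deriv_f_le_1 in auto)
  then show ?thesis by simp
qed

text \<open>Fatou's lemma for (1 - exp(-x s)) / x, which tends to \<open>s\<close> as x tends to 0
  and has integral (1 - exp(-\<tau> f x)) / x \<le> \<tau> f x / x \<le> \<tau>.\<close>

lemma subordinator_first_moment:
  assumes \<nu>: "is_subordinator \<nu> \<tau>" and \<tau>: "0 \<le> \<tau>"
  shows "integrable \<nu> (\<lambda>s. s)"
proof -
  interpret real_distribution \<nu> by (rule subordinator_real_distribution[OF \<nu>])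
  note AE = subordinator_facts(4)[OF \<nu>]
  define u where "u n s = (1 - exp (- (inverse (real (Suc n)) * s))) / inverse (real (Suc n))" for n s
  have u_int: "(\<integral>\<^sup>+s. ennreal (u n s) \<partial>\<nu>) \<le> ennreal \<tau>" for n
  proof -
    define x where "x = inverse (real (Suc n))"
    have x: "0 < x" by (simp add: x_def)
    have bdd: "integrable \<nu> (\<lambda>s. exp (- (x * s)))"
      by (rule integrable_const_bound[of _ 1]) (use AE x in \<open>auto elim!: eventually_mono\<close>)
    have "complex_of_real (LINT s|\<nu>. exp (- (x * s))) = (LINT s|\<nu>. exp (- of_real x * of_real s))"
      by (subst integral_complex_of_real[symmetric]) (simp flip: exp_of_real)
    also have "\<dots> = exp (- of_real \<tau> * \<phi> (of_real x))"
      using \<nu> x by (simp add: is_subordinator_def)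
    also have "\<dots> = of_real (exp (- \<tau> * f x))" using x by (simp add: \<phi>_of_real flip: exp_of_real)
    finally have L: "(LINT s|\<nu>. exp (- (x * s))) = exp (- \<tau> * f x)" by (simp only: of_real_eq_iff)
    have "(\<integral>\<^sup>+s. ennreal (u n s) \<partial>\<nu>) = ennreal (LINT s|\<nu>. u n s)"
    proof (rule nn_integral_eq_integral)
      show "integrable \<nu> (u n)" unfolding u_def x_def[symmetric] using bdd by simp
      show "AE s in \<nu>. 0 \<le> u n s" using AE by eventually_elim (simp add: u_def)
    qed
    also have "(LINT s|\<nu>. u n s) = (1 - exp (- \<tau> * f x)) / x"
      unfolding u_def x_def[symmetric] using bdd prob_space L by simp
    also have "\<dots> \<le> \<tau>"
    proof -
      have "1 - exp (- \<tau> * f x) \<le> \<tau> * f x" using exp_ge_add_one_self[of "- \<tau> * f x"] by simp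
      also have "\<dots> \<le> \<tau> * x" using \<tau> f_le[OF x] by (rule mult_left_mono[rotated])
      finally show ?thesis using x by (simp add: field_simps)
    qed
    finally show ?thesis by (simp add: ennreal_leI)
  qed
  have u_lim: "(\<lambda>n. u n s) \<longlonglongrightarrow> s" for s
  proof -
    have "((\<lambda>x. - exp (- (x * s))) has_real_derivative s) (at 0)" by (auto intro!: derivative_eq_intros)
    then have "((\<lambda>x. (1 - exp (- (x * s))) / x) \<longlongrightarrow> s) (at 0)" by (simp add: has_field_derivative_iff)
    moreover have "filterlim (\<lambda>n. inverse (real (Suc n))) (at 0) sequentially"
      by (intro filterlim_atI LIMSEQ_inverse_real_of_nat always_eventually) simp
    ultimately show ?thesis unfolding u_def by (rule filterlim_compose)
  qed
  have "(\<integral>\<^sup>+s. ennreal s \<partial>\<nu>) = (\<integral>\<^sup>+s. liminf (\<lambda>n. ennreal (u n s)) \<partial>\<nu>)"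
    using u_lim by (intro nn_integral_cong) (auto intro!: lim_imp_Liminf[symmetric] tendsto_ennrealI)
  also have "\<dots> \<le> liminf (\<lambda>n. \<integral>\<^sup>+s. ennreal (u n s) \<partial>\<nu>)"
    by (rule nn_integral_liminf) (simp add: u_def)
  also have "\<dots> \<le> limsup (\<lambda>n. ennreal \<tau>)"
    by (intro order_trans[OF Liminf_le_Limsup] Limsup_mono always_eventually allI u_int) simp
  also have "\<dots> = ennreal \<tau>" by (simp add: Limsup_const)
  finally have fin: "(\<integral>\<^sup>+s. ennreal s \<partial>\<nu>) < \<infinity>" by (simp add: le_less_trans)
  show ?thesis
  proof (rule integrableI_nonneg[OF _ AE fin])
  qed simp
qed

text \<open>Identity theorem: agreement on the positive axis, which accumulates at 1, would spread
  to the half-plane.\<close>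

lemma nontrivial_on_reals:
  assumes "0 < Re z" "\<phi> z \<noteq> z"
  obtains x where "0 < x" "f x \<noteq> x"
proof (rule ccontr)
  assume "\<not> thesis"
  then have eq: "f x = x" if "0 < x" for x using that \<open>\<And>x. 0 < x \<Longrightarrow> f x \<noteq> x \<Longrightarrow> thesis\<close> by blast
  have "\<phi> z - z = 0"
  proof (rule analytic_continuation[where f="\<lambda>z. \<phi> z - z" and S="{z. 0 < Re z}" and U="of_real ` {0<..}" and \<xi>=1])
    show "(\<lambda>z. \<phi> z - z) holomorphic_on {z. 0 < Re z}" by (intro holomorphic_intros holo)
    show "open {z. 0 < Re z}" by (rule open_halfspace_Re_gt)
    show "connected {z. 0 < Re z}" by (intro convex_connected convex_halfspace_Re_gt)
    show "(1::complex) islimpt of_real ` {0<..}"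
      unfolding islimpt_approachable
    proof (intro allI impI)
      fix e :: real assume "e > 0"
      have "complex_of_real (1 + e / 2) \<in> of_real ` {0<..}"
        using \<open>e > 0\<close> by (intro imageI) simp
      moreover have "complex_of_real (1 + e / 2) - 1 = of_real (e / 2)" by simp
      then have "dist (complex_of_real (1 + e / 2)) 1 = e / 2"
        unfolding dist_norm using \<open>e > 0\<close> by (simp only: norm_of_real)
      ultimately show "\<exists>x'\<in>of_real ` {0<..}. x' \<noteq> (1::complex) \<and> dist x' 1 < e"
        using \<open>e > 0\<close> by (intro bexI[of _ "complex_of_real (1 + e / 2)"]) auto
    qed
  qed (use assms eq in \<open>auto simp: \<phi>_of_real\<close>)
  with assms show False by simp
qed

text \<open>f'' is nondecreasing since f''' \<ge> 0, so one point with f'' < 0 bounds f'' away from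
  0 on everything to its left. Two integrations from 0, with f'(0+) = 1 and f(0+) = 0, give the
  quadratic gap.\<close>

lemma f_le_quadratic:
  assumes "0 < x0" "f x0 \<noteq> x0"
  shows "\<exists>c>0. \<forall>x\<in>{0<..1}. f x \<le> x - c * x\<^sup>2"
proof -
  define h where "h x = x - f x" for x
  have h': "(h has_real_derivative 1 - deriv f x) (at x)" if "0 < x" for x
    unfolding h_def[abs_def] using has_deriv[OF that, of 0] by (auto intro!: derivative_eq_intros)
  have f'': "(deriv f has_real_derivative deriv (deriv f) x) (at x)" if "0 < x" for x
    using has_deriv[OF that, of 1] by simp
  have f''': "(deriv (deriv f) has_real_derivative deriv (deriv (deriv f)) x) (at x)" if "0 < x" for x
    using has_deriv[OF that, of 2] by (simp add: numeral_2_eq_2)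
  have f'''_nonneg: "0 \<le> deriv (deriv (deriv f)) x" if "0 < x" for x
    using deriv_sign[OF that, of 2] by (simp add: numeral_2_eq_2)
  have "((\<lambda>x. x - f x) \<longlongrightarrow> 0 - 0) (at_right 0)" by (intro tendsto_intros f_lim)
  then have h_lim: "(h \<longlongrightarrow> 0) (at_right 0)" by (simp add: h_def[abs_def])
  have "0 < h x0" using f_le[OF assms(1)] assms by (simp add: h_def)
  then have "eventually (\<lambda>u. h u < h x0 \<and> u \<in> {0<..<x0}) (at_right 0)"
    using assms(1) by (intro eventually_conj order_tendstoD(2)[OF h_lim] eventually_at_right_real)
  then obtain u where u: "h u < h x0" "0 < u" "u < x0"
    using eventually_happens'[of "at_right (0::real)"] by (auto simp: trivial_limit_at_right_real)
  \<comment> \<open>Such a point is found by two mean value steps: h = x - f is positive at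
    \<open>x0\<close> and small near 0, so f' < 1 at \<open>x1\<close>; as f' is near 1 at 0, f'' <
    0 at \<open>x2\<close>.\<close>
  obtain x1 where x1: "u < x1" "x1 < x0" "h x0 - h u = (x0 - u) * (1 - deriv f x1)"
    using MVT2[OF u(3), of h "\<lambda>x. 1 - deriv f x"] h' u(2) by auto
  have "0 < (x0 - u) * (1 - deriv f x1)" using x1(3) u(1) by simp
  then have "deriv f x1 < 1" using u(3) by (simp add: zero_less_mult_iff)
  then have "eventually (\<lambda>v. deriv f x1 < deriv f v \<and> v \<in> {0<..<x1}) (at_right 0)"
    using x1(1) u(2) by (intro eventually_conj order_tendstoD(1)[OF f'_lim] eventually_at_right_real) auto
  then obtain v where v: "deriv f x1 < deriv f v" "0 < v" "v < x1"
    using eventually_happens'[of "at_right (0::real)"] by (auto simp: trivial_limit_at_right_real)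
  obtain x2 where x2: "v < x2" "x2 < x1" "deriv f x1 - deriv f v = (x1 - v) * deriv (deriv f) x2"
    using MVT2[OF v(3), of "deriv f" "deriv (deriv f)"] f'' v(2) by auto
  define \<delta> where "\<delta> = - deriv (deriv f) x2"
  have "(x1 - v) * deriv (deriv f) x2 < 0" using x2(3) v(1) by simp
  then have \<delta>: "0 < \<delta>" using v(3) by (simp add: \<delta>_def mult_less_0_iff)
  have f''_le: "deriv (deriv f) x \<le> - \<delta>" if "0 < x" "x \<le> x2" for x
  proof -
    have "deriv (deriv f) x \<le> deriv (deriv f) x2"
      by (rule DERIV_nonneg_imp_nondecreasing[OF that(2)])
         (use that f''' f'''_nonneg in \<open>meson less_le_trans\<close>)
    then show ?thesis by (simp add: \<delta>_def)
  qed
  have f'_le: "deriv f x + \<delta> * x \<le> 1" if "0 < x" "x \<le> x2" for x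
  proof (rule le_right_limit_of_deriv_nonpos[where g="\<lambda>x. deriv f x + \<delta> * x" and b=x2 and g'="\<lambda>x. deriv (deriv f) x + \<delta>"])
    show "((\<lambda>x. deriv f x + \<delta> * x) has_real_derivative deriv (deriv f) y + \<delta>) (at y)" if "0 < y" for y
      using f''[OF that] by (auto intro!: derivative_eq_intros)
    have "((\<lambda>x. deriv f x + \<delta> * x) \<longlongrightarrow> 1 + \<delta> * 0) (at_right 0)" by (intro tendsto_intros f'_lim)
    then show "((\<lambda>x. deriv f x + \<delta> * x) \<longlongrightarrow> 1) (at_right 0)" by simp
    show "deriv (deriv f) y + \<delta> \<le> 0" if "0 < y" "y \<le> x2" for y
      using f''_le[OF that] by simp
  qed (use that in auto)
  have h_ge: "\<delta> / 2 * x\<^sup>2 \<le> h x" if "0 < x" "x \<le> x2" for x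
  proof -
    have "\<delta> / 2 * x\<^sup>2 - h x \<le> 0"
    proof (rule le_right_limit_of_deriv_nonpos[where g="\<lambda>x. \<delta> / 2 * x\<^sup>2 - h x" and b=x2 and g'="\<lambda>x. \<delta> * x - (1 - deriv f x)"])
      show "((\<lambda>x. \<delta> / 2 * x\<^sup>2 - h x) has_real_derivative \<delta> * y - (1 - deriv f y)) (at y)" if "0 < y" for y
        using h'[OF that] by (auto intro!: derivative_eq_intros)
      have "((\<lambda>x. \<delta> / 2 * x\<^sup>2 - h x) \<longlongrightarrow> \<delta> / 2 * 0\<^sup>2 - 0) (at_right 0)" by (intro tendsto_intros h_lim)
      then show "((\<lambda>x. \<delta> / 2 * x\<^sup>2 - h x) \<longlongrightarrow> 0) (at_right 0)" by simp
      show "\<delta> * y - (1 - deriv f y) \<le> 0" if "0 < y" "y \<le> x2" for y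
        using f'_le[OF that] by simp
    qed (use that in auto)
    then show ?thesis by simp
  qed
  \<comment> \<open>To the right of \<open>x3\<close> the gap \<open>h\<close> only grows while
    \<open>x\<^sup>2 \<le> 1\<close>, so shrinking the constant by \<open>x3\<^sup>2\<close> covers
    all of (0, 1].\<close>
  define x3 where "x3 = min x2 1"
  have x3: "0 < x3" "x3 \<le> x2" "x3 \<le> 1" using x2(1) v(2) by (auto simp: x3_def)
  have sq: "x\<^sup>2 \<le> 1" if "0 < x" "x \<le> 1" for x :: real using that by (simp add: power_le_one)
  have "\<delta> / 2 * x3\<^sup>2 * x\<^sup>2 \<le> h x" if x: "0 < x" "x \<le> 1" for x
  proof (cases "x \<le> x3")
    case True
    have "\<delta> / 2 * x3\<^sup>2 * x\<^sup>2 \<le> \<delta> / 2 * x\<^sup>2"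
      using \<delta> sq[OF x3(1,3)] by (intro mult_right_mono) (auto simp: mult_le_cancel_left1)
    then show ?thesis using h_ge[of x] True x x3 by simp
  next
    case False
    have "\<delta> / 2 * x3\<^sup>2 * x\<^sup>2 \<le> \<delta> / 2 * x3\<^sup>2 * 1"
      by (rule mult_left_mono[OF sq[OF x]]) (use \<delta> in simp)
    also have "\<dots> = \<delta> / 2 * x3\<^sup>2" by simp
    also have "\<dots> \<le> h x3" using h_ge[of x3] x3 by simp
    also have "\<dots> \<le> h x"
    proof (rule DERIV_nonneg_imp_nondecreasing[where f=h])
      show "\<exists>y. (h has_real_derivative y) (at z) \<and> 0 \<le> y" if "x3 \<le> z" for z
        using that x3 h'[of z] deriv_f_le_1[of z] by (intro exI[of _ "1 - deriv f z"]) auto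
    qed (use False in auto)
    finally show ?thesis .
  qed
  then have "f x \<le> x - \<delta> / 2 * x3\<^sup>2 * x\<^sup>2" if "x \<in> {0<..1}" for x
    using that by (force simp: h_def)
  moreover have "0 < \<delta> / 2 * x3\<^sup>2" using \<delta> x3 by simp
  ultimately show ?thesis by blast
qed

text \<open>Symmetrization: exp(-2 Re \<phi>(iy)) is the double integral of cos(y (s - t)) against
  the measure \<nu> of exp(-\<phi>). Hence 2 Re \<phi>(iy) \<ge> 1 - exp(-2 Re \<phi>(iy)) is at
  least \<open>y\<^sup>2 / 8\<close> times a truncated second moment of s - t. The constants are c =
  I/16 and \<kappa> = 1/K.\<close>

lemma Re_imaginary_ge_quadratic:
  assumes "0 < x0" "f x0 \<noteq> x0"
  shows "\<exists>c \<kappa>. 0 < c \<and> 0 < \<kappa> \<and> \<kappa> \<le> 1 \<and> (\<forall>y. \<bar>y\<bar> \<le> \<kappa> \<longrightarrow> c * y\<^sup>2 \<le> Re (\<phi> (\<i> * of_real y)))"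
proof -
  obtain \<nu> where \<nu>: "is_subordinator \<nu> 1" using subordinator_exists[of 1] by auto
  interpret real_distribution \<nu> by (rule subordinator_real_distribution[OF \<nu>])
  \<comment> \<open>The truncation keeps |y (s - t)| \<le> 1 for |y| \<le> 1/K, and makes the
    integrals finite without a second moment.\<close>
  define \<rho> where "\<rho> K d = (if \<bar>d\<bar> \<le> K then d\<^sup>2 else 0)" for K d :: real
  have \<rho>_meas [measurable]: "\<rho> K \<in> borel_measurable borel" for K unfolding \<rho>_def[abs_def] by measurable
  have \<rho>_bound: "0 \<le> \<rho> K d" "\<rho> K d \<le> K\<^sup>2" for K d
  proof -
    show "0 \<le> \<rho> K d" by (simp add: \<rho>_def)
    have "d\<^sup>2 \<le> K\<^sup>2" if "\<bar>d\<bar> \<le> K" using power_mono[OF that, of 2] by simp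
    then show "\<rho> K d \<le> K\<^sup>2" by (simp add: \<rho>_def)
  qed
  define J where "J K s = (LINT t|\<nu>. \<rho> K (s - t))" for K s
  have \<rho>_int: "integrable \<nu> (\<lambda>t. \<rho> K (s - t))" for K s
    by (rule integrable_const_bound[of _ "K\<^sup>2"]) (use \<rho>_bound in auto)
  have J_meas [measurable]: "J K \<in> borel_measurable borel" for K
    unfolding J_def[abs_def] by measurable
  have J_bound: "0 \<le> J K s" "J K s \<le> K\<^sup>2" for K s
  proof -
    show "0 \<le> J K s" unfolding J_def by (intro integral_nonneg_AE AE_I2 \<rho>_bound)
    have "J K s \<le> (LINT t|\<nu>. K\<^sup>2)" unfolding J_def by (intro integral_mono \<rho>_int \<rho>_bound) simp
    then show "J K s \<le> K\<^sup>2" using prob_space by simp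
  qed
  have J_int: "integrable \<nu> (J K)" for K
    by (rule integrable_const_bound[of _ "K\<^sup>2"]) (use J_bound in auto)
  \<comment> \<open>Otherwise almost all pairs coincide, so \<nu> is a point mass at some
    \<open>s\<close> and f x = s x; then f'(0+) = 1 forces s = 1, against f x0 \<noteq> x0.\<close>
  have "\<exists>K::nat. 1 \<le> K \<and> 0 < (LINT s|\<nu>. J (real K) s)"
  proof (rule ccontr)
    assume "\<not> ?thesis"
    moreover have "0 \<le> (LINT s|\<nu>. J K s)" for K by (intro integral_nonneg_AE AE_I2 J_bound)
    ultimately have "(LINT s|\<nu>. J (real (Suc K)) s) = 0" for K :: nat
      by (metis le_add1 less_eq_real_def plus_1_eq_Suc)
    then have "AE s in \<nu>. J (real (Suc K)) s = 0" for K :: nat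
      using integral_nonneg_eq_0_iff_AE[OF J_int] J_bound by simp
    then have AE_J: "AE s in \<nu>. \<forall>K :: nat. J (real (Suc K)) s = 0" by (simp only: AE_all_countable) blast
    have "\<exists>s. \<forall>K :: nat. J (real (Suc K)) s = 0"
    proof (rule ccontr)
      assume none: "\<not> ?thesis"
      have "AE s in \<nu>. False" by (rule eventually_mono[OF AE_J]) (use none in blast)
      then show False by simp
    qed
    then obtain s where s: "\<And>K :: nat. J (real (Suc K)) s = 0" by blast
    then have "AE t in \<nu>. \<rho> (real (Suc K)) (s - t) = 0" for K :: nat
      using integral_nonneg_eq_0_iff_AE[OF \<rho>_int] \<rho>_bound unfolding J_def by simp
    then have "AE t in \<nu>. \<forall>K :: nat. \<rho> (real (Suc K)) (s - t) = 0" by (simp only: AE_all_countable) blast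
    then have AE_eq: "AE t in \<nu>. t = s"
    proof eventually_elim
      case (elim t)
      obtain K :: nat where "\<bar>s - t\<bar> \<le> real K" using real_arch_simple by blast
      moreover have "\<rho> (real (Suc K)) (s - t) = 0" using elim by blast
      ultimately have "(s - t)\<^sup>2 = 0" by (simp add: \<rho>_def split: if_splits)
      then show ?case by simp
    qed
    have f_eq: "f x = s * x" if x: "0 < x" for x
    proof -
      have "(LINT t|\<nu>. exp (- of_real x * of_real t)) = (LINT t|\<nu>. exp (- complex_of_real x * of_real s))"
        using AE_eq by (intro integral_cong_AE) auto
      then have "exp (- complex_of_real x * of_real s) = exp (- \<phi> (of_real x))"
        using \<nu> x prob_space by (simp add: is_subordinator_def scaleR_conv_of_real)
      then have "complex_of_real (exp (- x * s)) = of_real (exp (- f x))"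
        using x by (simp add: \<phi>_of_real flip: exp_of_real)
      then show ?thesis by (simp add: mult.commute)
    qed
    have deriv_eq: "deriv f x = s" if "0 < x" for x
    proof (rule DERIV_imp_deriv)
      have "((\<lambda>x. s * x) has_real_derivative s) (at x)" by (auto intro!: derivative_eq_intros)
      then show "(f has_real_derivative s) (at x)"
        by (rule DERIV_cong_ev[THEN iffD1, rotated 3])
           (use that f_eq in \<open>auto intro!: eventually_mono[OF eventually_gt_at_top] simp: eventually_nhds intro: exI[of _ "{0<..}"]\<close>)
    qed
    have "((\<lambda>x. s) \<longlongrightarrow> 1) (at_right (0::real))"
      by (rule Lim_transform_eventually[OF f'_lim]) (auto simp: eventually_at_filter deriv_eq)
    then have "s = 1" by (simp add: tendsto_const_iff)
    then show False using f_eq[OF assms(1)] assms(2) by simp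
  qed
  then obtain K :: nat where K: "1 \<le> K" "0 < (LINT s|\<nu>. J (real K) s)" by blast
  define I where "I = (LINT s|\<nu>. J (real K) s)"
  have "I / 16 * y\<^sup>2 \<le> Re (\<phi> (\<i> * of_real y))" if y: "\<bar>y\<bar> \<le> 1 / real K" for y
  proof -
    let ?c = "LINT t|\<nu>. cos (y * t)" and ?s = "LINT t|\<nu>. sin (y * t)"
    have trig_int: "integrable \<nu> (\<lambda>t. cos (y * t))" "integrable \<nu> (\<lambda>t. sin (y * t))"
      by (rule integrable_const_bound[of _ 1]; simp)+
    have e_int: "integrable \<nu> (\<lambda>t. exp (- (\<i> * of_real y) * of_real t))"
      by (rule integrable_const_bound[of _ 1]) auto
    have chi: "(LINT t|\<nu>. exp (- (\<i> * of_real y) * of_real t)) = exp (- \<phi> (\<i> * of_real y))"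
      using subordinator_closed_half_plane[OF \<nu>, of "\<i> * of_real y"] by simp
    have "Re (exp (- \<phi> (\<i> * of_real y))) = ?c" "Im (exp (- \<phi> (\<i> * of_real y))) = - ?s"
      unfolding chi[symmetric] integral_Re[OF e_int, symmetric] integral_Im[OF e_int, symmetric]
      by (simp_all add: Re_exp Im_exp)
    then have "cmod (exp (- \<phi> (\<i> * of_real y))) ^ 2 = ?c\<^sup>2 + ?s\<^sup>2"
      by (simp only: cmod_power2 power2_minus)
    also have "cmod (exp (- \<phi> (\<i> * of_real y))) ^ 2 = exp (- (2 * Re (\<phi> (\<i> * of_real y))))"
      by (simp add: power2_eq_square flip: exp_add)
    finally have e: "exp (- (2 * Re (\<phi> (\<i> * of_real y)))) = ?c\<^sup>2 + ?s\<^sup>2" .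
    have inner: "y\<^sup>2 / 8 * J (real K) s \<le> 1 - (cos (y * s) * ?c + sin (y * s) * ?s)" for s
    proof -
      have "y\<^sup>2 / 8 * J (real K) s = (LINT t|\<nu>. y\<^sup>2 / 8 * \<rho> (real K) (s - t))" by (simp add: J_def)
      also have "\<dots> \<le> (LINT t|\<nu>. 1 - (cos (y * s) * cos (y * t) + sin (y * s) * sin (y * t)))"
      proof (rule integral_mono)
        fix t
        have "y\<^sup>2 / 8 * \<rho> (real K) (s - t) \<le> 1 - cos (y * (s - t))"
        proof (cases "\<bar>s - t\<bar> \<le> real K")
          case True
          have "\<bar>y * (s - t)\<bar> \<le> 1 / real K * real K"
            unfolding abs_mult by (intro mult_mono y True) auto
          then have "\<bar>y * (s - t)\<bar> \<le> 1" using K(1) by simp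
          then show ?thesis using one_minus_cos_ge[of "y * (s - t)"] True by (simp add: \<rho>_def power_mult_distrib)
        qed (simp add: \<rho>_def)
        then show "y\<^sup>2 / 8 * \<rho> (real K) (s - t) \<le> 1 - (cos (y * s) * cos (y * t) + sin (y * s) * sin (y * t))"
          by (simp add: cos_diff right_diff_distrib)
      qed (use trig_int \<rho>_int in auto)
      also have "\<dots> = 1 - (cos (y * s) * ?c + sin (y * s) * ?s)"
        using trig_int prob_space by simp
      finally show ?thesis .
    qed
    have "y\<^sup>2 / 8 * I = (LINT s|\<nu>. y\<^sup>2 / 8 * J (real K) s)" by (simp add: I_def)
    also have "\<dots> \<le> (LINT s|\<nu>. 1 - (cos (y * s) * ?c + sin (y * s) * ?s))"
      by (intro integral_mono inner) (use trig_int J_int in auto)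
    also have "\<dots> = 1 - (?c\<^sup>2 + ?s\<^sup>2)" using trig_int prob_space by (simp add: power2_eq_square)
    also have "\<dots> \<le> 2 * Re (\<phi> (\<i> * of_real y))"
      using exp_ge_add_one_self[of "- (2 * Re (\<phi> (\<i> * of_real y)))"] by (simp flip: e)
    finally show ?thesis by (simp add: mult.commute)
  qed
  moreover have "0 < I / 16" "0 < 1 / real K" "1 / real K \<le> 1" using K by (auto simp: I_def)
  ultimately show ?thesis by blast
qed

end

section \<open>Lower bounds\<close>

text \<open>One statement for both approximations: \<tau> = n t, r = 1/n gives
  \<open>Delta_op\<close>, and \<tau> = n, r = t/n gives \<open>E_op\<close>. The constant is fixed
  before the measure is, so it is independent of \<tau>, r and t.\<close>

lemma exp_bernstein_spectral_bound:
  fixes T :: "real \<Rightarrow> 'a::complex_banach \<Rightarrow>\<^sub>L 'a"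
  assumes sg: "bounded_C0_semigroup T" and gen: "generator T = op_uminus A" and Phi: "Phi_function \<phi> f"
  shows "\<exists>c>0. \<forall>\<alpha>\<in>{0..2}. \<forall>l \<tau> r t. l \<in> spectrum A \<longrightarrow> 0 \<le> Re l \<longrightarrow> l \<noteq> 0 \<longrightarrow> 0 \<le> \<tau> \<longrightarrow> 0 \<le> r \<longrightarrow> 0 \<le> t \<longrightarrow>
     ereal (c * cmod l powr (- \<alpha>) * cmod (exp (- of_real \<tau> * \<phi> (of_real r * l)) - exp (- l * of_real t)))
       \<le> op_norm (fun_graph (\<lambda>x. exp_bernstein \<phi> \<tau> (\<lambda>s. T (r * s)) x - T t x) O neg_frac_power A \<alpha>)"
proof -
  interpret Phi: Phi_function \<phi> f by (rule Phi)
  obtain M0 where M0: "\<And>t. 0 \<le> t \<Longrightarrow> norm (T t) \<le> M0"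
    using sg by (auto simp: bounded_C0_semigroup_def)
  define M where "M = max 1 M0"
  interpret bdd_semigroup T A M
    by unfold_locales (use sg gen M0 in \<open>auto simp: M_def intro: max.coboundedI2\<close>)
  obtain c where c: "c > 0" and lower: "\<And>\<alpha> l D d H. \<alpha> \<in> {0..2} \<Longrightarrow> l \<in> spectrum A \<Longrightarrow> 0 \<le> Re l \<Longrightarrow> l \<noteq> 0 \<Longrightarrow>
      div_diff l D d H \<Longrightarrow> ereal (c * cmod l powr (- \<alpha>) * cmod d) \<le> op_norm (fun_graph (blinfun_apply D) O neg_frac_power A \<alpha>)"
    using spectral_lower_bound by blast
  have "ereal (c * cmod l powr (- \<alpha>) * cmod (exp (- of_real \<tau> * \<phi> (of_real r * l)) - exp (- l * of_real t)))
       \<le> op_norm (fun_graph (\<lambda>x. exp_bernstein \<phi> \<tau> (\<lambda>s. T (r * s)) x - T t x) O neg_frac_power A \<alpha>)"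
    if \<alpha>: "\<alpha> \<in> {0..2}" and l: "l \<in> spectrum A" "0 \<le> Re l" "l \<noteq> 0" and nonneg: "0 \<le> \<tau>" "0 \<le> r" "0 \<le> t"
    for \<alpha> l \<tau> r t
  proof -
    define \<nu> where "\<nu> = subordination_measure \<phi> \<tau>"
    have \<nu>: "Phi.is_subordinator \<nu> \<tau>"
      unfolding \<nu>_def by (rule Phi.is_subordinator_subordination_measure[OF nonneg(1)])
    interpret \<nu>: real_distribution \<nu> by (rule Phi.subordinator_real_distribution[OF \<nu>])
    interpret subordinated_semigroup T A M \<nu>
      by unfold_locales
         (use \<nu> Phi.subordinator_first_moment[OF \<nu> nonneg(1)] in \<open>auto simp: Phi.is_subordinator_def\<close>)
    obtain H where H: "div_diff l (subordinate r) (LINT s|\<nu>. exp (- l * of_real (r * s))) H"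
      using div_diff_subordinate[OF nonneg(2) l(2)] .
    have "(LINT s|\<nu>. exp (- l * of_real (r * s))) = (LINT s|\<nu>. exp (- (of_real r * l) * of_real s))"
      by (simp add: mult_ac)
    also have "\<dots> = exp (- of_real \<tau> * \<phi> (of_real r * l))"
      by (rule Phi.subordinator_closed_half_plane[OF \<nu>]) (use l nonneg in simp)
    finally have k: "(LINT s|\<nu>. exp (- l * of_real (r * s))) = exp (- of_real \<tau> * \<phi> (of_real r * l))" .
    have "(\<lambda>x. exp_bernstein \<phi> \<tau> (\<lambda>s. T (r * s)) x - T t x) = blinfun_apply (subordinate r - T t)"
      by (rule ext) (simp only: blinfun.diff_left subordinate_apply[OF nonneg(2)] exp_bernstein_def half_line_integral_def flip: \<nu>_def)
    then show ?thesis
      using lower[OF \<alpha> l div_diff_diff[OF H div_diff_T[OF nonneg(3)]]] unfolding k by simp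
  qed
  with c show ?thesis by blast
qed

theorem corollary7p5:
  fixes T :: "real \<Rightarrow> 'a::complex_banach \<Rightarrow>\<^sub>L 'a"
    and A :: "('a \<times> 'a) set"
    and \<phi> :: "complex \<Rightarrow> complex"
  assumes "bounded_C0_semigroup T"
    and "generator T = op_uminus A"
    and "closure (Range A) = UNIV"
    and "\<phi> \<in> Phi"
    and "\<exists>z. 0 < Re z \<and> \<phi> z \<noteq> z"
  shows "({\<bar>s\<bar> | s :: real. \<i> * of_real s \<in> spectrum A} = {0..} \<longrightarrow>
           (\<exists>c>0. \<exists>t\<^sub>0>0. \<forall>\<alpha>\<in>{0<..2}. \<forall>t\<ge>t\<^sub>0. \<forall>n\<ge>1.
              ereal (c * (t / real n) powr (\<alpha> / 2))
                \<le> op_norm (fun_graph (Delta_op \<phi> t n T) O neg_frac_power A \<alpha>) \<and>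
              ereal (c * (t\<^sup>2 / real n) powr (\<alpha> / 2))
                \<le> op_norm (fun_graph (E_op \<phi> t n T) O neg_frac_power A \<alpha>))) \<and>
         (of_real ` {0..} \<subseteq> spectrum A \<longrightarrow>
           (\<exists>t\<^sub>0>0. \<exists>c>0. \<forall>\<alpha>\<in>{0..2}. \<forall>t\<ge>t\<^sub>0. \<forall>n\<ge>1.
              ereal (c * (1 / real n) * t powr (\<alpha> - 1))
                \<le> op_norm (fun_graph (Delta_op \<phi> t n T) O neg_frac_power A \<alpha>) \<and>
              ereal (c * (1 / real n) * t powr \<alpha>)
                \<le> op_norm (fun_graph (E_op \<phi> t n T) O neg_frac_power A \<alpha>)))"
proof -
  obtain f where f: "bernstein_extension f \<phi>" "\<phi> 0 = 0" "(deriv f \<longlongrightarrow> 1) (at_right 0)"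
    using assms(4) by (auto simp: Phi_def)
  interpret Phi_function \<phi> f by unfold_locales (rule f)+
  obtain x0 where x0: "0 < x0" "f x0 \<noteq> x0" using assms(5) nontrivial_on_reals by blast
  define N where "N \<alpha> \<tau> r t = op_norm (fun_graph (\<lambda>x. exp_bernstein \<phi> \<tau> (\<lambda>s. T (r * s)) x - T t x) O neg_frac_power A \<alpha>)"
    for \<alpha> \<tau> r t
  have Delta: "op_norm (fun_graph (Delta_op \<phi> t n T) O neg_frac_power A \<alpha>) = N \<alpha> (real n * t) (1 / real n) t"
    and E: "op_norm (fun_graph (E_op \<phi> t n T) O neg_frac_power A \<alpha>) = N \<alpha> (real n) (t / real n) t" for \<alpha> t n
    by (simp_all only: N_def Delta_op_def[abs_def] E_op_def[abs_def])
  define symbol where "symbol l \<tau> r t = cmod (exp (- of_real \<tau> * \<phi> (of_real r * l)) - exp (- l * of_real t))" for l \<tau> r t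
  obtain c0 where c0: "c0 > 0" and lower: "\<And>\<alpha> l \<tau> r t. \<alpha> \<in> {0..2} \<Longrightarrow> l \<in> spectrum A \<Longrightarrow> 0 \<le> Re l \<Longrightarrow> l \<noteq> 0 \<Longrightarrow>
      0 \<le> \<tau> \<Longrightarrow> 0 \<le> r \<Longrightarrow> 0 \<le> t \<Longrightarrow>
      ereal (c0 * cmod l powr (- \<alpha>) * symbol l \<tau> r t) \<le> N \<alpha> \<tau> r t"
    using exp_bernstein_spectral_bound[OF assms(1,2) Phi_function_axioms] unfolding N_def symbol_def by blast
  show ?thesis
  proof (intro conjI impI, goal_cases)
    case 1
    then have spec: "{\<bar>s\<bar> | s :: real. \<i> * of_real s \<in> spectrum A} = {0..}" .
    obtain c1 \<kappa> where c1: "0 < c1" "0 < \<kappa>" "\<kappa> \<le> 1"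
      and Re_ge: "\<And>y. \<bar>y\<bar> \<le> \<kappa> \<Longrightarrow> c1 * y\<^sup>2 \<le> Re (\<phi> (\<i> * of_real y))"
      using Re_imaginary_ge_quadratic[OF x0] by blast
    \<comment> \<open>On the imaginary axis |exp(-l t)| = 1, while the other exponential has modulus
      at most exp(-\<open>c1 * \<kappa>\<^sup>2\<close>).\<close>
    define \<delta> where "\<delta> = 1 - exp (- (c1 * \<kappa>\<^sup>2))"
    have \<delta>: "\<delta> > 0" using c1 by (simp add: \<delta>_def)
    \<comment> \<open>The scale X = \<open>\<tau> * r\<^sup>2\<close> is t/n or
      \<open>t\<^sup>2 / n\<close>. At |l| = \<kappa> / sqrt X the quadratic bound for \<tau> Re
      \<phi>(r l) becomes the constant \<open>c1 * \<kappa>\<^sup>2\<close>, and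
      \<open>r\<^sup>2 \<le> X\<close> keeps r |l| within \<kappa>.\<close>
    have bound: "ereal (c0 * \<delta> * X powr (\<alpha> / 2)) \<le> N \<alpha> \<tau> r t"
      if \<alpha>: "\<alpha> \<in> {0<..2}" and X: "X > 0" and nonneg: "0 \<le> \<tau>" "0 \<le> r" "0 \<le> t"
        and r: "r\<^sup>2 \<le> X" and \<tau>: "\<tau> * r\<^sup>2 = X" for \<alpha> X \<tau> r t
    proof -
      define \<mu> where "\<mu> = \<kappa> / sqrt X"
      have \<mu>: "\<mu> > 0" using c1 X by (simp add: \<mu>_def)
      then have "\<mu> \<in> {\<bar>s\<bar> | s :: real. \<i> * of_real s \<in> spectrum A}" unfolding spec by simp
      \<comment> \<open>Only one of the two points of this modulus need lie in the spectrum, so the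
        sign of \<open>s\<close> stays open.\<close>
      then obtain s :: real where s: "\<bar>s\<bar> = \<mu>" "\<i> * of_real s \<in> spectrum A" by auto
      have "r \<le> sqrt X" using r by (rule real_le_rsqrt)
      then have "r * \<mu> \<le> \<kappa>" using X c1 by (simp add: \<mu>_def field_simps)
      then have "c1 * (r * s)\<^sup>2 \<le> Re (\<phi> (\<i> * of_real (r * s)))"
        using nonneg s by (intro Re_ge) (simp add: abs_mult)
      then have "\<tau> * (c1 * (r * s)\<^sup>2) \<le> \<tau> * Re (\<phi> (\<i> * of_real (r * s)))"
        using nonneg(1) by (rule mult_left_mono)
      also have "\<tau> * (c1 * (r * s)\<^sup>2) = c1 * \<kappa>\<^sup>2"
      proof -
        have "s\<^sup>2 = \<kappa>\<^sup>2 / X" using s(1) X by (metis \<mu>_def less_imp_le power2_abs power_divide real_sqrt_pow2)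
        then have "\<tau> * (c1 * (r * s)\<^sup>2) = c1 * \<kappa>\<^sup>2 * (\<tau> * r\<^sup>2 / X)" by (simp add: power_mult_distrib mult_ac)
        then show ?thesis using \<tau> X by simp
      qed
      finally have Re_le: "c1 * \<kappa>\<^sup>2 \<le> \<tau> * Re (\<phi> (\<i> * of_real (r * s)))" .
      let ?l = "\<i> * complex_of_real s"
      have "\<delta> \<le> cmod (exp (- ?l * of_real t)) - cmod (exp (- of_real \<tau> * \<phi> (of_real r * ?l)))"
        using Re_le by (simp add: \<delta>_def mult_ac)
      also have "\<dots> \<le> symbol ?l \<tau> r t"
        unfolding symbol_def by (metis norm_minus_commute norm_triangle_ineq2)
      finally have d: "\<delta> \<le> symbol ?l \<tau> r t" .
      have "X powr (\<alpha> / 2) \<le> \<mu> powr (- \<alpha>)"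
      proof -
        have "\<mu> powr (- \<alpha>) = \<kappa> powr (- \<alpha>) * (sqrt X powr \<alpha>)"
          using c1 X by (simp add: \<mu>_def powr_divide powr_minus) (simp add: divide_inverse)
        also have "sqrt X powr \<alpha> = X powr (\<alpha> / 2)"
          using X by (simp add: powr_half_sqrt[symmetric] powr_powr)
        finally have "\<mu> powr (- \<alpha>) = \<kappa> powr (- \<alpha>) * X powr (\<alpha> / 2)" .
        \<comment> \<open>\<kappa> \<le> 1 lets this factor be dropped, which keeps the constant
          free of \<alpha>.\<close>
        moreover have "1 \<le> \<kappa> powr (- \<alpha>)"
          using c1 \<alpha> powr_le1[of \<alpha> \<kappa>] by (simp add: powr_minus one_le_inverse_iff)
        ultimately show ?thesis by (simp add: mult_le_cancel_right1)
      qed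
      then have "c0 * \<delta> * X powr (\<alpha> / 2) \<le> c0 * \<delta> * \<mu> powr (- \<alpha>)"
        using c0 \<delta> by (intro mult_left_mono) auto
      also have "\<dots> = c0 * \<mu> powr (- \<alpha>) * \<delta>" by simp
      also have "\<dots> \<le> c0 * cmod ?l powr (- \<alpha>) * symbol ?l \<tau> r t"
        using c0 d s(1) \<delta> by (intro mult_mono) (auto simp: norm_mult)
      finally have "ereal (c0 * \<delta> * X powr (\<alpha> / 2))
          \<le> ereal (c0 * cmod ?l powr (- \<alpha>) * symbol ?l \<tau> r t)"
        by simp
      also have "\<dots> \<le> N \<alpha> \<tau> r t"
        using \<alpha> s \<mu> nonneg by (intro lower) auto
      finally show ?thesis .
    qed
    have c_pos: "0 < c0 * \<delta>" using c0 \<delta> by simp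
    show ?case
      unfolding Delta E
    proof (rule exI, rule conjI, rule c_pos, rule exI, rule conjI, rule zero_less_one, intro ballI allI impI conjI)
      fix \<alpha> t :: real and n :: nat assume \<alpha>: "\<alpha> \<in> {0<..2}" and t: "1 \<le> t" and n: "1 \<le> n"
      have n': "real n \<ge> 1" using n by simp
      show "ereal (c0 * \<delta> * (t / real n) powr (\<alpha> / 2)) \<le> N \<alpha> (real n * t) (1 / real n) t"
      proof (rule bound[OF \<alpha>])
        \<comment> \<open>Here t \<ge> 1 enters: the condition \<open>r\<^sup>2 \<le> X\<close> for
          r = 1/n and X = t/n reads 1 \<le> t n.\<close>
        have "1 \<le> t * real n" using mult_mono[of 1 t 1 "real n"] t n' by simp
        then show "(1 / real n)\<^sup>2 \<le> t / real n" using n' by (simp add: power2_eq_square field_simps)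
        show "real n * t * (1 / real n)\<^sup>2 = t / real n" using n' by (simp add: power2_eq_square)
      qed (use t n' in auto)
      show "ereal (c0 * \<delta> * (t\<^sup>2 / real n) powr (\<alpha> / 2)) \<le> N \<alpha> (real n) (t / real n) t"
      proof (rule bound[OF \<alpha>])
        show "(t / real n)\<^sup>2 \<le> t\<^sup>2 / real n"
          unfolding power_divide using n' by (intro divide_left_mono) (auto simp: power2_eq_square)
        show "real n * (t / real n)\<^sup>2 = t\<^sup>2 / real n" using n' by (simp add: power2_eq_square)
      qed (use t n' in auto)
    qed
  next
    case 2
    then have spec: "of_real ` {0..} \<subseteq> spectrum A" .
    obtain c2 where c2: "0 < c2" "\<And>x. x \<in> {0<..1} \<Longrightarrow> f x \<le> x - c2 * x\<^sup>2"
      using f_le_quadratic[OF x0] by blast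
    define c where "c = c0 * (exp (- 1) * c2)"
    \<comment> \<open>The spectral point is 1/t, so that \<epsilon> = r/t is the argument of \<phi>:
      1/(n t) or 1/n. As \<tau> \<epsilon> = 1, both exponentials are near exp(-1), and the gap c2
      \<epsilon>^2 of \<phi>, multiplied by \<tau>, separates them by at least exp(-1) c2
      \<epsilon>.\<close>
    have bound: "ereal (c * t powr \<alpha> * \<epsilon>) \<le> N \<alpha> \<tau> r t"
      if \<alpha>: "\<alpha> \<in> {0..2}" and t: "t \<ge> 1" and \<epsilon>: "\<epsilon> \<in> {0<..1}" and r: "r = \<epsilon> * t" and \<tau>: "\<tau> * \<epsilon> = 1" for \<alpha> t \<epsilon> r \<tau>
    proof -
      have \<tau>0: "0 \<le> \<tau>" using \<tau> \<epsilon> by (metis greaterThanAtMost_iff less_eq_real_def zero_less_mult_pos2 zero_less_one)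
      let ?l = "complex_of_real (1 / t)"
      have "\<tau> * f \<epsilon> \<le> \<tau> * (\<epsilon> - c2 * \<epsilon>\<^sup>2)" using c2(2)[OF \<epsilon>] \<tau>0 by (rule mult_left_mono)
      also have "\<dots> = \<tau> * \<epsilon> - c2 * (\<tau> * \<epsilon>) * \<epsilon>" by (simp add: algebra_simps power2_eq_square)
      also have "\<dots> = 1 - c2 * \<epsilon>" unfolding \<tau> by simp
      finally have "exp (- 1 + c2 * \<epsilon>) \<le> exp (- \<tau> * f \<epsilon>)" by simp
      then have "exp (- 1) * exp (c2 * \<epsilon>) \<le> exp (- \<tau> * f \<epsilon>)" by (simp only: exp_add)
      moreover have "exp (- 1) * (1 + c2 * \<epsilon>) \<le> exp (- 1) * exp (c2 * \<epsilon>)"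
        by (intro mult_left_mono exp_ge_add_one_self) simp
      ultimately have "exp (- 1) * c2 * \<epsilon> \<le> exp (- \<tau> * f \<epsilon>) - exp (- 1)" by (simp add: algebra_simps)
      also have "\<dots> \<le> cmod (of_real (exp (- \<tau> * f \<epsilon>) - exp (- 1)))" by (simp only: norm_of_real abs_ge_self)
      also have "complex_of_real (exp (- \<tau> * f \<epsilon>) - exp (- 1)) = exp (- of_real \<tau> * \<phi> (of_real r * ?l)) - exp (- ?l * of_real t)"
      proof -
        have "of_real r * ?l = complex_of_real \<epsilon>" using t by (simp add: r)
        moreover have "- ?l * of_real t = complex_of_real (- 1)" using t by simp
        ultimately show ?thesis using \<epsilon> by (simp add: \<phi>_of_real exp_of_real[symmetric])
      qed
      finally have d: "exp (- 1) * c2 * \<epsilon> \<le> symbol ?l \<tau> r t" unfolding symbol_def .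
      have "cmod ?l powr (- \<alpha>) = t powr \<alpha>" using t by (simp add: powr_minus powr_divide norm_divide)
      then have "c * t powr \<alpha> * \<epsilon> = c0 * cmod ?l powr (- \<alpha>) * (exp (- 1) * c2 * \<epsilon>)" by (simp add: c_def mult_ac)
      also have "\<dots> \<le> c0 * cmod ?l powr (- \<alpha>) * symbol ?l \<tau> r t"
        by (rule mult_left_mono[OF d]) (use c0 in simp)
      finally have "ereal (c * t powr \<alpha> * \<epsilon>)
          \<le> ereal (c0 * cmod ?l powr (- \<alpha>) * symbol ?l \<tau> r t)"
        by simp
      also have "\<dots> \<le> N \<alpha> \<tau> r t"
        using t \<epsilon> r by (intro lower[OF \<alpha> subsetD[OF spec imageI]] \<tau>0) auto
      finally show ?thesis .
    qed
    have c_pos: "0 < c" using c0 c2 by (simp add: c_def)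
    show ?case
      unfolding Delta E
    proof (rule exI, rule conjI, rule zero_less_one, rule exI, rule conjI, rule c_pos, intro ballI allI impI conjI)
      fix \<alpha> t :: real and n :: nat assume \<alpha>: "\<alpha> \<in> {0..2}" and t: "1 \<le> t" and n: "1 \<le> n"
      have n': "real n \<ge> 1" using n by simp
      \<comment> \<open>Needed for \<epsilon> = 1/(n t) to lie in (0, 1], where the quadratic bound
        on \<open>f\<close> holds.\<close>
      have "1 \<le> real n * t" using mult_mono[of 1 "real n" 1 t] t n' by simp
      then have "ereal (c * t powr \<alpha> * (1 / (real n * t))) \<le> N \<alpha> (real n * t) (1 / real n) t"
        using t n' by (intro bound[OF \<alpha>]) auto
      moreover have "t powr \<alpha> * (1 / (real n * t)) = (1 / real n) * t powr (\<alpha> - 1)"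
        using t by (simp add: powr_diff)
      ultimately show "ereal (c * (1 / real n) * t powr (\<alpha> - 1)) \<le> N \<alpha> (real n * t) (1 / real n) t"
        by (simp only: mult.assoc)
      have "ereal (c * t powr \<alpha> * (1 / real n)) \<le> N \<alpha> (real n) (t / real n) t"
        using t n' by (intro bound[OF \<alpha>]) auto
      then show "ereal (c * (1 / real n) * t powr \<alpha>) \<le> N \<alpha> (real n) (t / real n) t"
        by (simp only: mult_ac)
    qed
  qed
qed

end
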